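(* Let $\Gamma$ be a simple connected cubic girth-regular graph of girth $g$ with $n$ vertices and signature $(1,1,2)$. Then $g$ is even and $\Gamma$ is isomorphic to the truncation $\mathrm{Tr}(\mathcal{M})$ of some map $\mathcal{M}$ all of whose face cycles have length $g/2$. In particular, $g/2$ divides $n$. Moreover, if $\Gamma$ is vertex-transitive, then $\mathcal{M}$ is an arc-transitive $\{g/2,\ell\}$-map for some $\ell>g$.
   Context: Cubic means $3$-regular. For a graph of finite girth $g$, a girth cycle is a cycle of length $g$, and $\epsilon(e)$ is the number of girth cycles containing the edge $e$. The signature of a vertex $v$ with incident edges $e_1,\ldots,e_k$ ordered so that $\epsilon(e_1)\le\cdots\le\epsilon(e_k)$ is $(\epsilon(e_1),\ldots,\epsilon(e_k))$; a graph is girth-regular if all vertices have the same signature (the signature of the graph). Graphs underlying maps may have parallel edges and loops: such a graph is $(V,E,\partial)$ with $\partial:E\to\{X\subseteq V:|X|\le2\}$; each edge consists of two mutually inverse arcs, each with a tail. A map: view a connected graph $\Lambda$ as a $1$-dimensional CW complex and, for a set of simple closed walks (closed walks using each edge at most once), attach one disk per walk along the closed curve of the walk (injectively except over vertices); if the result is a closed surface it is a map with skeleton $\Lambda$ and face cycles the given walks. A $\{m,k\}$-map has $k$-regular skeleton and all face cycles of length $m$. An automorphism of a map is a permutation of flags induced by a homeomorphism of the surface preserving the embedded graph; the map is arc-transitive if its automorphism group acts transitively on the arcs of the skeleton. The dihedral scheme of a map: $s\leftrightarrow t$ iff arcs $s,t$ have a common tail and their underlying edges are consecutive edges of some face cycle.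 The truncation $\mathrm{Tr}(\mathcal{M})$ is the simple graph whose vertices are the arcs of the skeleton, with $s,t$ adjacent iff $s\leftrightarrow t$ or $s,t$ are mutually inverse.
   Formalization: In the dihedral scheme, two arcs are related only at the corner where a face cycle passes from one edge to the next; relating all common-tail arcs over consecutive edges makes the claim false when there are loops (e.g. the Möbius ladder on 8 vertices). *)

theory Defs
  imports "HOL-Analysis.Analysis" "HOL-Library.Extended_Nat" "HOL-Combinatorics.Permutations"
begin

section \<open>Simple graphs, girth cycles and signatures\<close>

record 'a sgraph =
  verts :: "'a set"
  edges :: "'a set set"

definition simple_graph :: "'a sgraph \<Rightarrow> bool" where
  "simple_graph G \<longleftrightarrow> (\<forall>e\<in>edges G. e \<subseteq> verts G \<and> card e = 2)"

definition connected_graph :: "'a sgraph \<Rightarrow> bool" where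
  "connected_graph G \<longleftrightarrow> verts G \<noteq> {} \<and>
     (\<forall>u\<in>verts G. \<forall>v\<in>verts G. (u, v) \<in> {(x, y). {x, y} \<in> edges G}\<^sup>*)"

definition incident :: "'a sgraph \<Rightarrow> 'a \<Rightarrow> 'a set set" where
  "incident G v = {e \<in> edges G. v \<in> e}"

definition cubic :: "'a sgraph \<Rightarrow> bool" where
  "cubic G \<longleftrightarrow> (\<forall>v\<in>verts G. card (incident G v) = 3)"

text \<open>A cycle is a subgraph, so it is identified with its set of edges; in particular
  cycles are counted without a starting vertex or a direction.\<close>

definition is_cycle :: "'a sgraph \<Rightarrow> nat \<Rightarrow> 'a set set \<Rightarrow> bool" where
  "is_cycle G k C \<longleftrightarrow> k \<ge> 3 \<and>
     (\<exists>vs. length vs = k \<and> distinct vs \<and> set vs \<subseteq> verts G \<and>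
        C = {{vs ! i, vs ! (Suc i mod k)} | i. i < k} \<and> C \<subseteq> edges G)"

definition girth :: "'a sgraph \<Rightarrow> enat" where
  "girth G = Inf {enat k | k. \<exists>C. is_cycle G k C}"

definition girth_cycles :: "'a sgraph \<Rightarrow> 'a set set set" where
  "girth_cycles G = {C. \<exists>k. enat k = girth G \<and> is_cycle G k C}"

definition eps :: "'a sgraph \<Rightarrow> 'a set \<Rightarrow> nat" where
  "eps G e = card {C \<in> girth_cycles G. e \<in> C}"

definition signature :: "'a sgraph \<Rightarrow> 'a \<Rightarrow> nat list" where
  "signature G v = sorted_list_of_multiset (image_mset (eps G) (mset_set (incident G v)))"

definition girth_regular :: "'a sgraph \<Rightarrow> bool" where
  "girth_regular G \<longleftrightarrow> girth G \<noteq> \<infinity> \<and>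
     (\<forall>u\<in>verts G. \<forall>v\<in>verts G. signature G u = signature G v)"

definition graph_iso :: "('a \<Rightarrow> 'b) \<Rightarrow> 'a sgraph \<Rightarrow> 'b sgraph \<Rightarrow> bool" where
  "graph_iso f G H \<longleftrightarrow> bij_betw f (verts G) (verts H) \<and>
     (\<forall>u\<in>verts G. \<forall>v\<in>verts G. {u, v} \<in> edges G \<longleftrightarrow> {f u, f v} \<in> edges H)"

definition isomorphic_graphs :: "'a sgraph \<Rightarrow> 'b sgraph \<Rightarrow> bool" where
  "isomorphic_graphs G H \<longleftrightarrow> (\<exists>f. graph_iso f G H)"

definition vertex_transitive :: "'a sgraph \<Rightarrow> bool" where
  "vertex_transitive G \<longleftrightarrow>
     (\<forall>u\<in>verts G. \<forall>v\<in>verts G. \<exists>f. graph_iso f G G \<and> f u = v)"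


section \<open>Graphs with loops and parallel edges\<close>

text \<open>Such a graph is presented by its arcs. An edge is the pair \<open>{s, ainv s}\<close> of mutually
  inverse arcs, and its boundary is \<open>{tail s, tail (ainv s)}\<close>. The two arcs of a loop are
  distinct arcs with the same tail.\<close>

record ('v, 'd) agraph =
  nodes :: "'v set"
  arcs :: "'d set"
  ainv :: "'d \<Rightarrow> 'd"
  tail :: "'d \<Rightarrow> 'v"

definition arc_graph :: "('v, 'd, 'z) agraph_scheme \<Rightarrow> bool" where
  "arc_graph L \<longleftrightarrow>
     (\<forall>s\<in>arcs L. tail L s \<in> nodes L \<and> ainv L s \<in> arcs L \<and>
        ainv L s \<noteq> s \<and> ainv L (ainv L s) = s)"

definition connected_arc_graph :: "('v, 'd, 'z) agraph_scheme \<Rightarrow> bool" where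
  "connected_arc_graph L \<longleftrightarrow> nodes L \<noteq> {} \<and>
     (\<forall>u\<in>nodes L. \<forall>v\<in>nodes L.
        (u, v) \<in> {(tail L s, tail L (ainv L s)) | s. s \<in> arcs L}\<^sup>*)"

definition regular_arc_graph :: "('v, 'd, 'z) agraph_scheme \<Rightarrow> nat \<Rightarrow> bool" where
  "regular_arc_graph L k \<longleftrightarrow>
     (\<forall>v\<in>nodes L. finite {s \<in> arcs L. tail L s = v} \<and> card {s \<in> arcs L. tail L s = v} = k)"

definition arc_edge :: "('v, 'd, 'z) agraph_scheme \<Rightarrow> 'd \<Rightarrow> 'd set" where
  "arc_edge L s = {s, ainv L s}"

definition simple_closed_walk :: "('v, 'd, 'z) agraph_scheme \<Rightarrow> 'd list \<Rightarrow> bool" where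
  "simple_closed_walk L w \<longleftrightarrow> w \<noteq> [] \<and> set w \<subseteq> arcs L \<and>
     (\<forall>i<length w. tail L (ainv L (w ! i)) = tail L (w ! (Suc i mod length w))) \<and>
     distinct (map (arc_edge L) w)"


section \<open>Maps\<close>

text \<open>The skeleton together with the walks along which disks are attached.\<close>

record ('v, 'd) premap = "('v, 'd) agraph" +
  faces :: "'d list set"

text \<open>Points of the 2-dimensional cell complex: vertices, points of open edges and points of
  open faces. The point at parameter \<open>t\<close> of an arc \<open>s\<close> is the point at parameter \<open>1 - t\<close> of the
  inverse arc, hence the unordered pair in \<open>edge_curve\<close>.\<close>

datatype ('v, 'd) point = VPt 'v | EPt "('d \<times> real) set" | FPt "'d list" complex

definition edge_curve :: "('v, 'd, 'z) agraph_scheme \<Rightarrow> 'd \<Rightarrow> real \<Rightarrow> ('v, 'd) point" where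
  "edge_curve L s t =
     (if t = 0 then VPt (tail L s)
      else if t = 1 then VPt (tail L (ainv L s))
      else EPt {(s, t), (ainv L s, 1 - t)})"

text \<open>The closed curve of a walk of length \<open>m\<close>: the \<open>i\<close>-th arc of the walk is traversed on the
  \<open>i\<close>-th of \<open>m\<close> equal circular arcs of the unit circle.\<close>

definition walk_curve :: "('v, 'd, 'z) agraph_scheme \<Rightarrow> 'd list \<Rightarrow> complex \<Rightarrow> ('v, 'd) point" where
  "walk_curve L w z =
     (let x = real (length w) * Arg2pi z / (2 * pi)
      in edge_curve L (w ! nat \<lfloor>x\<rfloor>) (frac x))"

definition disk_map :: "('v, 'd, 'z) agraph_scheme \<Rightarrow> 'd list \<Rightarrow> complex \<Rightarrow> ('v, 'd) point" where
  "disk_map L w z = (if norm z < 1 then FPt w z else walk_curve L w z)"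

definition vertex_points :: "('v, 'd, 'z) agraph_scheme \<Rightarrow> ('v, 'd) point set" where
  "vertex_points L = VPt ` nodes L"

definition edge_points :: "('v, 'd, 'z) agraph_scheme \<Rightarrow> ('v, 'd) point set" where
  "edge_points L = (\<Union>s\<in>arcs L. edge_curve L s ` {0<..<1})"

definition open_face :: "'d list \<Rightarrow> ('v, 'd) point set" where
  "open_face w = FPt w ` ball 0 1"

definition surface_points :: "('v, 'd, 'z) premap_scheme \<Rightarrow> ('v, 'd) point set" where
  "surface_points M = vertex_points M \<union> edge_points M \<union> (\<Union>w\<in>faces M. open_face w)"

text \<open>The weak topology determined by the characteristic maps of the cells, that is, the quotient
  topology of the disjoint union of the vertices, the closed edges and the closed disks.\<close>

definition surface_open :: "('v, 'd, 'z) premap_scheme \<Rightarrow> ('v, 'd) point set \<Rightarrow> bool" where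
  "surface_open M U \<longleftrightarrow> U \<subseteq> surface_points M \<and>
     (\<forall>s\<in>arcs M. openin (top_of_set {0..1}) {t \<in> {0..1}. edge_curve M s t \<in> U}) \<and>
     (\<forall>w\<in>faces M. openin (top_of_set (cball 0 1)) {z \<in> cball 0 1. disk_map M w z \<in> U})"

definition surface :: "('v, 'd, 'z) premap_scheme \<Rightarrow> ('v, 'd) point topology" where
  "surface M = topology (surface_open M)"

lemma istopology_surface_open: "istopology (surface_open M)"
proof -
  have 1: "openin T {t \<in> S. c t \<in> A \<inter> B}"
    if "openin T {t \<in> S. c t \<in> A}" "openin T {t \<in> S. c t \<in> B}"
    for T :: "'x topology" and S and c :: "'x \<Rightarrow> ('a, 'b) point" and A B
  proof -
    have "{t \<in> S. c t \<in> A \<inter> B} = {t \<in> S. c t \<in> A} \<inter> {t \<in> S. c t \<in> B}" by blast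
    then show ?thesis using that by (simp add: openin_Int)
  qed
  have 2: "openin T {t \<in> S. c t \<in> \<Union>\<K>}"
    if "\<And>A. A \<in> \<K> \<Longrightarrow> openin T {t \<in> S. c t \<in> A}"
    for T :: "'x topology" and S and c :: "'x \<Rightarrow> ('a, 'b) point" and \<K>
  proof -
    have "{t \<in> S. c t \<in> \<Union>\<K>} = \<Union>((\<lambda>A. {t \<in> S. c t \<in> A}) ` \<K>)" by blast
    moreover have "openin T (\<Union>((\<lambda>A. {t \<in> S. c t \<in> A}) ` \<K>))"
      by (rule openin_Union) (use that in blast)
    ultimately show ?thesis by simp
  qed
  show ?thesis
    unfolding istopology_def
  proof (intro conjI allI impI)
    fix A B assume A: "surface_open M A" and B: "surface_open M B"
    show "surface_open M (A \<inter> B)"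
      unfolding surface_open_def
      by (intro conjI ballI 1) (use A B in \<open>auto simp: surface_open_def\<close>)
  next
    fix \<K> assume K: "\<forall>A\<in>\<K>. surface_open M A"
    show "surface_open M (\<Union>\<K>)"
      unfolding surface_open_def
      by (intro conjI ballI 2) (use K in \<open>auto simp: surface_open_def\<close>)
  qed
qed

lemma openin_surface: "openin (surface M) = surface_open M"
  by (simp add: surface_def istopology_surface_open topology_inverse')

definition closed_surface :: "'p topology \<Rightarrow> bool" where
  "closed_surface X \<longleftrightarrow>
     compact_space X \<and> connected_space X \<and> Hausdorff_space X \<and>
     (\<forall>x\<in>topspace X. \<exists>U W. openin X U \<and> x \<in> U \<and> open (W :: complex set) \<and>
        subtopology X U homeomorphic_space top_of_set W)"

definition is_map :: "('v, 'd, 'z) premap_scheme \<Rightarrow> bool" where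
  "is_map M \<longleftrightarrow> arc_graph M \<and> connected_arc_graph M \<and>
     (\<forall>w\<in>faces M. simple_closed_walk M w) \<and> closed_surface (surface M)"

definition mk_map :: "('v, 'd, 'z) premap_scheme \<Rightarrow> nat \<Rightarrow> nat \<Rightarrow> bool" where
  "mk_map M m k \<longleftrightarrow> is_map M \<and> regular_arc_graph M k \<and> (\<forall>w\<in>faces M. length w = m)"


section \<open>Map automorphisms\<close>

text \<open>A flag is a mutually incident triple of vertex, edge and face; as loops are allowed, the
  first two entries are recorded as an arc. Since a face cycle uses an edge at most
  once, the arc and the face determine a unique triangle of the barycentric subdivision.\<close>

definition flags :: "('v, 'd, 'z) premap_scheme \<Rightarrow> ('d \<times> 'd list) set" where
  "flags M = {(s, w). s \<in> arcs M \<and> w \<in> faces M \<and> (s \<in> set w \<or> ainv M s \<in> set w)}"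

definition maps_arc ::
  "('v, 'd, 'z) premap_scheme \<Rightarrow> (('v, 'd) point \<Rightarrow> ('v, 'd) point) \<Rightarrow> 'd \<Rightarrow> 'd \<Rightarrow> bool" where
  "maps_arc M h s t \<longleftrightarrow>
     (\<exists>\<phi> :: real \<Rightarrow> real. continuous_on {0..1} \<phi> \<and> strict_mono_on {0..1} \<phi> \<and>
        \<phi> 0 = 0 \<and> \<phi> 1 = 1 \<and> (\<forall>x\<in>{0..1}. h (edge_curve M s x) = edge_curve M t (\<phi> x)))"

definition map_automorphism ::
  "('v, 'd, 'z) premap_scheme \<Rightarrow> ('d \<times> 'd list \<Rightarrow> 'd \<times> 'd list) \<Rightarrow> bool" where
  "map_automorphism M \<pi> \<longleftrightarrow> \<pi> permutes flags M \<and>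
     (\<exists>h. homeomorphic_map (surface M) (surface M) h \<and>
        h ` vertex_points M = vertex_points M \<and> h ` edge_points M = edge_points M \<and>
        (\<forall>(s, w)\<in>flags M. maps_arc M h s (fst (\<pi> (s, w))) \<and>
           h ` open_face w = open_face (snd (\<pi> (s, w)))))"

definition arc_transitive_map :: "('v, 'd, 'z) premap_scheme \<Rightarrow> bool" where
  "arc_transitive_map M \<longleftrightarrow>
     (\<forall>s\<in>arcs M. \<forall>t\<in>arcs M. \<exists>\<pi>. map_automorphism M \<pi> \<and>
        fst ` \<pi> ` {x \<in> flags M. fst x = s} = {t})"


section \<open>Truncation\<close>

text \<open>Consecutive edges of a face cycle are related at the corner where the cycle passes from
  one to the other: the cycle enters the corner along \<open>w ! i\<close> and leaves it along the next
  arc, so the two arcs with tail at this corner are \<open>ainv M (w ! i)\<close> and the next arc. If the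
  edges are loops or parallel, other pairs of their arcs may also have a common tail, but are
  not at this corner and are not related by this occurrence.\<close>

definition dihedral_scheme :: "('v, 'd, 'z) premap_scheme \<Rightarrow> 'd \<Rightarrow> 'd \<Rightarrow> bool" where
  "dihedral_scheme M s t \<longleftrightarrow> tail M s = tail M t \<and>
     (\<exists>w\<in>faces M. \<exists>i<length w. {s, t} = {ainv M (w ! i), w ! (Suc i mod length w)})"

definition truncation :: "('v, 'd, 'z) premap_scheme \<Rightarrow> 'd sgraph" where
  "truncation M = \<lparr>verts = arcs M,
     edges = {{s, t} | s t. s \<in> arcs M \<and> t \<in> arcs M \<and> s \<noteq> t \<and>
                (dihedral_scheme M s t \<or> t = ainv M s)}\<rparr>"

end

theory Submission
  imports Defs
begin

text \<open>
  Call an edge red if it lies on two girth cycles and blue if it lies on one. Counting girth cycles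
  at a vertex shows that each of them uses the red edge and exactly one blue edge there, so girth
  cycles alternate between red and blue and \<open>g\<close> is even. The red edges form a perfect matching and
  the blue edges a 2-factor whose cycles are not girth cycles, hence are longer than \<open>g\<close>. Take the
  vertices of \<open>\<Gamma>\<close> as arcs, the red matching as inversion, the blue cycles as vertices and the girth
  cycles (recorded by every other vertex) as faces. Each red edge lies on two faces and the corners
  at a blue cycle are arranged cyclically, so the complex is a closed surface, and its truncation
  is \<open>\<Gamma>\<close> itself.

  Charts are obtained from continuous functions on the whole complex. Around a vertex or the midpoint
  of an edge, \<open>k\<close> half-disks are glued cyclically; the \<open>j\<close>-th is mapped to the \<open>j\<close>-th of \<open>k\<close> equal
  sectors of a disk, and the result is damped to vanish outside the star. These functions separate
  points, and compactness makes them embeddings.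
\<close>

section \<open>Charts\<close>

text \<open>The delicate claim is \<open>closed_surface\<close>, since neighbourhoods in the weak
  topology are awkward to describe. A function given compatibly on the disks is continuous without
  any such description, so every chart is a globally defined function. The extra real coordinate
  pays for this: it falls to 0 at the edge of the chart domain, so that extension by 0 is
  continuous, and where it is positive it still lets the plane coordinate be recovered.

  The radius 1/2, in units of one boundary arc, serves two ends: corners of one face sit at integer
  positions, so half-disks of this radius are disjoint, and a chart at the midpoint of an edge
  reaches the whole open edge.

  The strict bound on the degree comes from colours alone: a blue cycle has no red edge and a girth
  cycle has some. For arc-transitivity, an automorphism of \<open>\<Gamma>\<close> respects the
  colours, but moves the chosen walk of a girth cycle to the chosen walk of the image only up to
  rotation and reversal; hence the homeomorphism rotates or reflects each disk.\<close>

text \<open>The second component is positive exactly on the chart domain and recovers the coordinate \<open>z\<close>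
  from the first, while the pair extends continuously by \<open>0\<close> to the rest of the space.\<close>

definition cone_coords :: "real \<Rightarrow> complex \<Rightarrow> complex \<times> real" where
  "cone_coords c z = (of_real (c - norm z) * z, c - norm z)"

text \<open>Injectivity is asked only where \<open>snd (f p) > 0\<close>, yet it separates such a
  \<open>p\<close> from every other point of \<open>X\<close>, because equal values put both points
  in the domain. Defining \<open>f\<close> on the whole space makes preimages of closed sets closed
  in \<open>X\<close>.\<close>

definition disk_chart :: "'p topology \<Rightarrow> real \<Rightarrow> ('p \<Rightarrow> complex \<times> real) \<Rightarrow> bool" where
  "disk_chart X c f \<longleftrightarrow> continuous_map X euclidean f \<and>
     (\<forall>p\<in>topspace X. \<forall>q\<in>topspace X. snd (f p) > 0 \<longrightarrow> f p = f q \<longrightarrow> p = q) \<and>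
     f ` {p \<in> topspace X. snd (f p) > 0} = cone_coords c ` ball 0 c"

text \<open>On this ball the second component exceeds \<open>d\<close>, so dividing by it is
  continuous and undoes \<open>cone_coords\<close>.\<close>

lemma homeomorphic_cone_coords_ball:
  assumes "0 < d"
  shows "top_of_set (cone_coords c ` ball 0 (c - d)) homeomorphic_space top_of_set (ball (0::complex) (c - d))"
proof -
  have "homeomorphism (ball 0 (c - d)) (cone_coords c ` ball 0 (c - d)) (cone_coords c) (\<lambda>(a, h). a / of_real h)"
  proof
    show "continuous_on (ball 0 (c - d)) (cone_coords c)"
      unfolding cone_coords_def by (intro continuous_intros)
    have "continuous_on (cone_coords c ` ball 0 (c - d)) (\<lambda>p. fst p / of_real (snd p))"
      using assms by (intro continuous_intros) (auto simp: cone_coords_def)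
    then show "continuous_on (cone_coords c ` ball 0 (c - d)) (\<lambda>(a, h). a / of_real h)"
      by (simp add: case_prod_unfold)
  qed (use assms in \<open>auto simp: cone_coords_def complex_eq_iff\<close>)
  then have "homeomorphic_maps (top_of_set (cone_coords c ` ball 0 (c - d))) (top_of_set (ball 0 (c - d)))
      (\<lambda>(a, h). a / of_real h) (cone_coords c)"
    unfolding homeomorphic_maps_def homeomorphism_def
    by (simp add: continuous_map_in_subtopology image_subset_iff_funcset[symmetric])
  then show ?thesis unfolding homeomorphic_space_def by blast
qed

text \<open>A continuous injection of a compact space into a Hausdorff space is an embedding. Since
  \<open>f\<close> is continuous on all of \<open>X\<close>, the set where its second component is
  at least \<open>d\<close> is closed, hence compact, and the open set where it exceeds
  \<open>d\<close> inherits the embedding. The same functions separate points, which gives the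
  Hausdorff property.\<close>

lemma closed_surface_if_disk_charts:
  assumes comp: "compact_space X" and conn: "connected_space X"
    and charts: "\<And>x. x \<in> topspace X \<Longrightarrow> \<exists>c f. disk_chart X c f \<and> snd (f x) > 0"
  shows "closed_surface X"
proof -
  have haus: "Hausdorff_space X"
    unfolding Hausdorff_space_def
  proof (intro allI impI)
    fix x y assume xy: "x \<in> topspace X \<and> y \<in> topspace X \<and> x \<noteq> y"
    obtain c f where f: "disk_chart X c f" "snd (f x) > 0" using charts xy by blast
    then have "f x \<noteq> f y" using xy unfolding disk_chart_def by blast
    then obtain U V where UV: "open U" "open V" "f x \<in> U" "f y \<in> V" "U \<inter> V = {}"
      by (meson hausdorff)
    have cont: "continuous_map X euclidean f" using f unfolding disk_chart_def by blast
    have "openin X {p \<in> topspace X. f p \<in> U}" "openin X {p \<in> topspace X. f p \<in> V}"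
      using cont UV by (auto simp: openin_continuous_map_preimage)
    then show "\<exists>U V. openin X U \<and> openin X V \<and> x \<in> U \<and> y \<in> V \<and> disjnt U V"
      using UV xy by (intro exI[of _ "{p \<in> topspace X. f p \<in> U}"] exI[of _ "{p \<in> topspace X. f p \<in> V}"])
        (auto simp: disjnt_def)
  qed
  have "\<exists>U W. openin X U \<and> x \<in> U \<and> open (W :: complex set) \<and>
        subtopology X U homeomorphic_space top_of_set W" if x: "x \<in> topspace X" for x
  proof -
    obtain c f where f: "disk_chart X c f" "snd (f x) > 0" using charts x by blast
    \<comment> \<open>Any value strictly between 0 and \<open>snd (f x)\<close> would do:
      \<open>x\<close> must lie in the open set \<open>U\<close>, and \<open>K\<close> inside the
      chart domain.\<close>
    define d where "d = snd (f x) / 2"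
    have d: "0 < d" "d < snd (f x)" using f by (auto simp: d_def)
    have cont: "continuous_map X euclidean f"
      and inj: "\<And>p q. p\<in>topspace X \<Longrightarrow> q\<in>topspace X \<Longrightarrow> snd (f p) > 0 \<Longrightarrow> f p = f q \<Longrightarrow> p = q"
      and img: "f ` {p \<in> topspace X. snd (f p) > 0} = cone_coords c ` ball 0 c"
      using f unfolding disk_chart_def by blast+
    define K where "K = {p \<in> topspace X. f p \<in> {q. d \<le> snd q}}"
    define U where "U = {p \<in> topspace X. f p \<in> {q. d < snd q}}"
    have "closed {q :: complex \<times> real. d \<le> snd q}"
      by (intro closed_Collect_le continuous_intros)
    then have "closedin X K"
      unfolding K_def by (intro closedin_continuous_map_preimage[OF cont]) auto
    then have "compact_space (subtopology X K)"
      using comp closedin_compact_space compact_space_subtopology by blast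
    then have emb: "embedding_map (subtopology X K) euclidean f"
    proof (intro continuous_imp_embedding_map)
      show "continuous_map (subtopology X K) euclidean f"
        using cont continuous_map_from_subtopology by blast
      show "inj_on f (topspace (subtopology X K))"
        using inj d by (auto simp: inj_on_def K_def)
    qed auto
    have "open {q :: complex \<times> real. d < snd q}"
      by (intro open_Collect_less continuous_intros)
    then have oU: "openin X U"
      unfolding U_def by (intro openin_continuous_map_preimage[OF cont]) auto
    have UK: "U \<subseteq> K" by (auto simp: U_def K_def)
    have tK: "topspace (subtopology X K) = K" and tU: "topspace (subtopology X U) = U"
      by (auto simp: K_def U_def)
    have "homeomorphic_map (subtopology (subtopology X K) U) (subtopology (top_of_set (f ` K)) (f ` U)) f"
      using emb unfolding embedding_map_def tK
      by (rule homeomorphic_map_subtopologies) (use UK in \<open>auto simp: K_def\<close>)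
    moreover have "K \<inter> U = U" "f ` K \<inter> f ` U = f ` U" using UK by auto
    ultimately have "homeomorphic_map (subtopology X U) (top_of_set (f ` topspace (subtopology X U))) f"
      unfolding tU by (simp add: subtopology_subtopology)
    then have "subtopology X U homeomorphic_space top_of_set (f ` topspace (subtopology X U))"
      by (rule homeomorphic_map_imp_homeomorphic_space)
    moreover have "f ` topspace (subtopology X U) = cone_coords c ` ball 0 (c - d)"
    proof -
      have "f ` U = {q \<in> f ` {p \<in> topspace X. snd (f p) > 0}. d < snd q}"
        using d by (auto simp: U_def)
      also have "\<dots> = cone_coords c ` ball 0 (c - d)"
        unfolding img using d by (auto simp: cone_coords_def)
      finally show ?thesis unfolding tU .
    qed
    ultimately have "subtopology X U homeomorphic_space top_of_set (ball (0::complex) (c - d))"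
      using homeomorphic_cone_coords_ball[OF d(1), of c] homeomorphic_space_trans by simp blast
    then show ?thesis using oU x d by (intro exI[of _ U] exI[of _ "ball 0 (c-d)"]) (auto simp: U_def)
  qed
  then show ?thesis unfolding closed_surface_def using comp conn haus by blast
qed

section \<open>Boundary circles of the disks\<close>

lemma cis_eq_cis_iff: "cis a = cis b \<longleftrightarrow> (\<exists>n::int. a = b + 2 * pi * of_int n)"
  using sin_cos_eq_iff[of a b] by (auto simp: complex_eq_iff)

definition rim_angle :: "'d list \<Rightarrow> real \<Rightarrow> real" where
  "rim_angle w a = 2 * pi * a / real (length w)"

text \<open>The boundary of a disk is parametrised by positions modulo the length of the walk: the \<open>i\<close>-th arc
  occupies the positions from \<open>i\<close> to \<open>i + 1\<close>.\<close>

definition rim :: "('v, 'd, 'z) agraph_scheme \<Rightarrow> 'd list \<Rightarrow> real \<Rightarrow> ('v, 'd) point" where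
  "rim L w a = disk_map L w (cis (rim_angle w a))"

text \<open>Integer indices let rotations \<open>i + r\<close> and reversals \<open>r - i\<close> of
  a closed walk be written without wrap-around.\<close>

definition cyclic_nth :: "'d list \<Rightarrow> int \<Rightarrow> 'd" where
  "cyclic_nth w i = w ! nat (i mod int (length w))"

lemma cyclic_nth_in_set: "w \<noteq> [] \<Longrightarrow> cyclic_nth w i \<in> set w"
  by (simp add: cyclic_nth_def nat_less_iff)

lemma cyclic_nth_nat: "i < length w \<Longrightarrow> cyclic_nth w (int i) = w ! i"
  by (simp add: cyclic_nth_def)

lemma cyclic_nth_Suc: "i < length w \<Longrightarrow> cyclic_nth w (int i + 1) = w ! (Suc i mod length w)"
  by (simp add: cyclic_nth_def nat_mod_distrib nat_add_distrib)

lemma cis_rim_angle_eq_iff: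
  assumes "w \<noteq> []"
  shows "cis (rim_angle w a) = cis (rim_angle w b) \<longleftrightarrow> (\<exists>n::int. a = b + of_int n * real (length w))"
proof -
  have "rim_angle w a = rim_angle w b + 2 * pi * of_int n \<longleftrightarrow> a = b + of_int n * real (length w)" for n
  proof -
    have "rim_angle w b + 2 * pi * of_int n = rim_angle w (b + of_int n * real (length w))"
      using assms by (simp add: rim_angle_def field_simps)
    then show ?thesis using assms by (simp add: rim_angle_def)
  qed
  then show ?thesis by (simp add: cis_eq_cis_iff)
qed

lemma norm_one_imp_cis_rim_angle:
  assumes "w \<noteq> []" "norm z = 1"
  obtains a where "z = cis (rim_angle w a)"
proof
  show "z = cis (rim_angle w (real (length w) * Arg2pi z / (2 * pi)))"
    using assms Arg2pi_eq[of z] by (simp add: rim_angle_def cis_conv_exp)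
qed

lemma rim_periodic: "w \<noteq> [] \<Longrightarrow> rim L w (a + of_int n * real (length w)) = rim L w a"
  using cis_rim_angle_eq_iff[of w "a + of_int n * real (length w)" a] by (auto simp: rim_def)

lemma edge_curve_ainv:
  assumes "arc_graph L" "s \<in> arcs L"
  shows "edge_curve L (ainv L s) (1 - t) = edge_curve L s t"
  using assms by (auto simp: edge_curve_def arc_graph_def insert_commute)

lemma edge_curve_eq_interior:
  assumes "0 < t" "t < 1" "edge_curve L s t = edge_curve L s' t'" "0 \<le> t'" "t' \<le> 1" 
    "arc_graph L" "s \<in> arcs L" "s' \<in> arcs L"
  shows "0 < t' \<and> t' < 1 \<and> (s' = s \<and> t' = t \<or> s' = ainv L s \<and> t' = 1 - t)"
proof -
  have t': "0 < t'" "t' < 1" using assms by (auto simp: edge_curve_def split: if_splits)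
  then have "(s, t) \<in> {(s', t'), (ainv L s', 1 - t')}"
    using assms by (auto simp: edge_curve_def split: if_splits)
  then show ?thesis using t' assms by (auto simp: arc_graph_def)
qed

lemma edge_curve_eq_VPt:
  "0 \<le> t \<Longrightarrow> t \<le> 1 \<Longrightarrow> edge_curve L s t = VPt v \<longleftrightarrow> t = 0 \<and> tail L s = v \<or> t = 1 \<and> tail L (ainv L s) = v"
  by (auto simp: edge_curve_def)

lemma rim_edge_curve_less:
  assumes "w \<noteq> []" "0 \<le> t" "t < 1"
  shows "rim L w (of_int i + t) = edge_curve L (cyclic_nth w i) t"
proof -
  define m where "m = length w"
  define j where "j = i mod int m"
  have m: "m > 0" using assms by (simp add: m_def)
  have j: "0 \<le> j" "j < int m" using m by (auto simp: j_def)
  have le: "real_of_int j + t < real m" using j assms by linarith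
  have "of_int i + t = (of_int j + t) + of_int (i div int m) * real m"
  proof -
    have "i = j + (i div int m) * int m" unfolding j_def by simp
    then have "real_of_int i = of_int (j + (i div int m) * int m)" by simp
    then show ?thesis by simp
  qed
  then have "rim L w (of_int i + t) = rim L w (of_int j + t)"
    using rim_periodic[OF assms(1)] by (metis m_def)
  also have "\<dots> = edge_curve L (cyclic_nth w i) t"
  proof -
    \<comment> \<open>\<open>Arg2pi\<close> takes values from 0 up to, but excluding, a full turn;
      this is why the position was first reduced below \<open>m\<close>.\<close>
    have "Arg2pi (cis (rim_angle w (of_int j + t))) = rim_angle w (of_int j + t)"
      by (rule Arg2pi_unique[of 1])
        (use m j le assms pi_gt_zero in \<open>auto simp: cis_conv_exp rim_angle_def m_def[symmetric] pos_divide_less_eq\<close>)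
    then have "real (length w) * Arg2pi (cis (rim_angle w (of_int j + t))) / (2 * pi) = of_int j + t"
      using m by (simp add: rim_angle_def m_def)
    moreover have "\<lfloor>of_int j + t\<rfloor> = j" "frac (of_int j + t) = t"
      using assms by (auto simp: frac_def floor_unique)
    ultimately show ?thesis
      by (simp add: rim_def disk_map_def walk_curve_def cyclic_nth_def j_def m_def)
  qed
  finally show ?thesis .
qed

text \<open>At \<open>t = 1\<close> the curve of the walk already evaluates the next arc at 0; the
  two values agree because consecutive arcs of a closed walk share a vertex.\<close>

lemma rim_edge_curve:
  assumes w: "simple_closed_walk L w" and "0 \<le> t" "t \<le> 1"
  shows "rim L w (of_int i + t) = edge_curve L (cyclic_nth w i) t"
proof (cases "t = 1")
  case True
  have ne: "w \<noteq> []" using w by (simp add: simple_closed_walk_def)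
  define j where "j = nat (i mod int (length w))"
  have j: "j < length w" using ne by (simp add: j_def nat_less_iff)
  have "rim L w (of_int i + t) = rim L w (of_int (i + 1) + 0)" using True by simp
  also have "\<dots> = VPt (tail L (cyclic_nth w (i + 1)))"
    by (subst rim_edge_curve_less[OF ne]) (auto simp: edge_curve_def)
  also have "cyclic_nth w (i + 1) = cyclic_nth w (int j + 1)"
    using ne by (simp add: j_def cyclic_nth_def mod_simps)
  also have "\<dots> = w ! (Suc j mod length w)" using j by (rule cyclic_nth_Suc)
  also have "tail L (w ! (Suc j mod length w)) = tail L (ainv L (w ! j))"
    using w j by (simp add: simple_closed_walk_def)
  finally show ?thesis using True by (simp add: edge_curve_def cyclic_nth_def j_def)
qed (use assms in \<open>auto simp: simple_closed_walk_def intro: rim_edge_curve_less\<close>)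

lemma real_eq_int_plus_frac: obtains i :: int and t :: real where "a = of_int i + t" "0 \<le> t" "t < 1"
  using that[of "\<lfloor>a\<rfloor>" "frac a"] frac_ge_0[of a] frac_lt_1[of a] by (simp add: frac_def)

section \<open>The cell complex of a map\<close>

text \<open>The last two assumptions put every point on some closed disk, so the surface is a
  quotient of finitely many disks. Length at least 2 makes an arc at most half of the boundary
  circle, so offsets below 1 along the rim can be recovered by \<open>Arg\<close>.\<close>

locale cell_complex =
  fixes M :: "('v, 'd, 'z) premap_scheme"
  assumes arc_graph: "arc_graph M"
    and walks: "w \<in> faces M \<Longrightarrow> simple_closed_walk M w"
    and length_face: "w \<in> faces M \<Longrightarrow> 2 \<le> length w"
    and finite_faces: "finite (faces M)"
    and arc_in_face: "s \<in> arcs M \<Longrightarrow> \<exists>w\<in>faces M. s \<in> set w \<or> ainv M s \<in> set w"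
    and node_has_arc: "v \<in> nodes M \<Longrightarrow> \<exists>s\<in>arcs M. tail M s = v"
begin

lemma face_nonempty: "w \<in> faces M \<Longrightarrow> w \<noteq> []"
  using walks by (auto simp: simple_closed_walk_def)

lemma ainv_arc: "s \<in> arcs M \<Longrightarrow> ainv M s \<in> arcs M" "s \<in> arcs M \<Longrightarrow> ainv M (ainv M s) = s"
    "s \<in> arcs M \<Longrightarrow> tail M s \<in> nodes M" "s \<in> arcs M \<Longrightarrow> ainv M s \<noteq> s"
  using arc_graph by (auto simp: arc_graph_def)

lemma face_arcs: "w \<in> faces M \<Longrightarrow> set w \<subseteq> arcs M"
  using walks by (auto simp: simple_closed_walk_def)

lemma cyclic_nth_arc: "w \<in> faces M \<Longrightarrow> cyclic_nth w i \<in> arcs M"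
  using face_arcs cyclic_nth_in_set face_nonempty by blast

lemma rim_edge: "w \<in> faces M \<Longrightarrow> 0 \<le> t \<Longrightarrow> t \<le> 1 \<Longrightarrow> rim M w (of_int i + t) = edge_curve M (cyclic_nth w i) t"
  using rim_edge_curve walks by blast

lemma rim_edge_rev:
  assumes "w \<in> faces M" "0 \<le> t" "t \<le> 1"
  shows "rim M w (of_int i + 1 - t) = edge_curve M (ainv M (cyclic_nth w i)) t"
proof -
  have "rim M w (of_int i + (1 - t)) = edge_curve M (cyclic_nth w i) (1 - t)"
    by (rule rim_edge) (use assms in auto)
  also have "\<dots> = edge_curve M (ainv M (cyclic_nth w i)) (1 - (1 - t))"
    using edge_curve_ainv[OF arc_graph cyclic_nth_arc] assms by metis
  finally show ?thesis by (simp add: algebra_simps)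
qed

lemma edge_curve_in_surface_points:
  assumes "s \<in> arcs M" "0 \<le> t" "t \<le> 1"
  shows "edge_curve M s t \<in> surface_points M"
proof (cases "t = 0 \<or> t = 1")
  case False
  then have "edge_curve M s t \<in> edge_points M" using assms unfolding edge_points_def by force
  then show ?thesis by (simp add: surface_points_def)
qed (use ainv_arc assms in \<open>auto simp: edge_curve_def surface_points_def vertex_points_def\<close>)

lemma norm_one_imp_rim:
  assumes "w \<in> faces M" "norm z = 1"
  obtains i t where "z = cis (rim_angle w (of_int i + t))" "0 \<le> t" "t < 1"
    "disk_map M w z = edge_curve M (cyclic_nth w i) t"
proof -
  obtain a where a: "z = cis (rim_angle w a)"
    using norm_one_imp_cis_rim_angle face_nonempty assms by metis
  moreover obtain i t where "a = of_int i + t" "0 \<le> t" "t < 1" by (rule real_eq_int_plus_frac)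
  ultimately show thesis
    using that rim_edge[OF assms(1), of t i] by (auto simp: rim_def)
qed

lemma disk_map_in_surface_points:
  assumes "w \<in> faces M" "z \<in> cball 0 1"
  shows "disk_map M w z \<in> surface_points M"
proof (cases "norm z < 1")
  case True
  then show ?thesis using assms by (force simp: disk_map_def surface_points_def open_face_def)
next
  case False
  then have "norm z = 1" using assms by auto
  then obtain i t where "0 \<le> t" "t < 1" "disk_map M w z = edge_curve M (cyclic_nth w i) t"
    using norm_one_imp_rim assms by metis
  then show ?thesis using edge_curve_in_surface_points cyclic_nth_arc assms by simp
qed

lemma topspace_surface: "topspace (surface M) = surface_points M"
proof -
  have "{t \<in> {0..1}. edge_curve M s t \<in> surface_points M} = {0..1}" if "s \<in> arcs M" for s
    using edge_curve_in_surface_points[OF that] by auto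
  moreover have "{z \<in> cball 0 1. disk_map M w z \<in> surface_points M} = cball 0 1" if "w \<in> faces M" for w
    using disk_map_in_surface_points[OF that] by auto
  ultimately have "surface_open M (surface_points M)"
    unfolding surface_open_def by (auto simp del: atLeastAtMost_iff)
  then show ?thesis
    unfolding topspace_def openin_surface by (auto simp: surface_open_def)
qed

lemma edge_on_rim:
  assumes "s \<in> arcs M"
  obtains w a \<sigma> where "w \<in> faces M" "\<bar>\<sigma>\<bar> = 1" "\<And>t. 0 \<le> t \<Longrightarrow> t \<le> 1 \<Longrightarrow> edge_curve M s t = rim M w (a + \<sigma> * t)"
proof -
  obtain w where w: "w \<in> faces M" "s \<in> set w \<or> ainv M s \<in> set w" using arc_in_face assms by blast
  then obtain i where i: "i < length w" "w ! i = s \<or> w ! i = ainv M s" by (metis in_set_conv_nth)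
  then have c: "cyclic_nth w (int i) = s \<or> cyclic_nth w (int i) = ainv M s" by (simp add: cyclic_nth_nat)
  show thesis
  proof (cases "cyclic_nth w (int i) = s")
    case True
    then show thesis using that[of w 1 "of_int (int i)"] rim_edge[OF w(1), of _ "int i"] w(1) by auto
  next
    case False
    then have "ainv M (cyclic_nth w (int i)) = s" using c ainv_arc(2)[OF assms] by auto
    then show thesis
      using that[of w "-1" "of_int (int i) + 1"] rim_edge_rev[OF w(1), of _ "int i"] w(1) by auto
  qed
qed

lemma disk_map_surj:
  assumes "p \<in> topspace (surface M)"
  obtains w z where "w \<in> faces M" "z \<in> cball 0 1" "p = disk_map M w z"
proof -
  note disk = that
  have edge: thesis if st: "p = edge_curve M s t" "s \<in> arcs M" "0 \<le> t" "t \<le> 1" for s t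
  proof -
    obtain w a \<sigma> where "w \<in> faces M" "\<bar>\<sigma>\<bar> = 1"
      "\<And>t. 0 \<le> t \<Longrightarrow> t \<le> 1 \<Longrightarrow> edge_curve M s t = rim M w (a + \<sigma> * t)"
      using edge_on_rim[OF st(2)] by metis
    then show thesis using st disk[of w "cis (rim_angle w (a + \<sigma> * t))"] by (simp add: rim_def)
  qed
  consider (v) v where "v \<in> nodes M" "p = VPt v" | (e) "p \<in> edge_points M"
    | (f) w where "w \<in> faces M" "p \<in> open_face w"
    using assms by (auto simp: topspace_surface surface_points_def vertex_points_def)
  then show thesis
  proof cases
    case v
    then obtain s where "s \<in> arcs M" "tail M s = v" using node_has_arc by blast
    then show thesis using v edge[of s 0] by (simp add: edge_curve_def)
  next
    case e
    then obtain s t where "s \<in> arcs M" "0 < t" "t < 1" "p = edge_curve M s t"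
      by (auto simp: edge_points_def)
    then show thesis using edge[of s t] by simp
  next
    case f
    then obtain z where "norm z < 1" "p = FPt w z" by (auto simp: open_face_def)
    then show thesis using f disk[of w z] by (simp add: disk_map_def)
  qed
qed

lemma continuous_disk_map:
  assumes "w \<in> faces M"
  shows "continuous_map (top_of_set (cball 0 1)) (surface M) (disk_map M w)"
  unfolding continuous_map_def openin_surface topspace_surface
  using disk_map_in_surface_points assms by (auto simp: surface_open_def)

lemma continuous_edge_curve:
  assumes "s \<in> arcs M"
  shows "continuous_map (top_of_set {0..1}) (surface M) (edge_curve M s)"
  unfolding continuous_map_def openin_surface topspace_surface
  using edge_curve_in_surface_points assms by (auto simp: surface_open_def)

text \<open>Each edge is a continuous image of a segment of some rim, so the edge clauses of
  \<open>surface_open\<close> follow from the disk clauses and continuity needs checking on the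
  disks only.\<close>

lemma continuous_map_from_surface:
  assumes cont: "\<And>w. w \<in> faces M \<Longrightarrow> continuous_map (top_of_set (cball 0 1)) Y (\<lambda>z. f (disk_map M w z))"
  shows "continuous_map (surface M) Y f"
  unfolding continuous_map_def
proof (intro conjI allI impI)
  show "f \<in> topspace (surface M) \<rightarrow> topspace Y"
  proof
    fix p assume "p \<in> topspace (surface M)"
    then obtain w z where "w \<in> faces M" "z \<in> cball 0 1" "p = disk_map M w z" by (rule disk_map_surj)
    then show "f p \<in> topspace Y" using cont[of w] by (auto simp: continuous_map_def Pi_iff)
  qed
next
  fix V assume V: "openin Y V"
  let ?U = "{p \<in> topspace (surface M). f p \<in> V}"
  have F: "openin (top_of_set (cball 0 1)) {z \<in> cball 0 1. disk_map M w z \<in> ?U}" if w: "w \<in> faces M" for w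
  proof -
    have "{z \<in> cball 0 1. disk_map M w z \<in> ?U} = {z \<in> topspace (top_of_set (cball 0 1)). f (disk_map M w z) \<in> V}"
      using disk_map_in_surface_points[OF w] by (auto simp: topspace_surface)
    then show ?thesis using openin_continuous_map_preimage[OF cont[OF w] V] by simp
  qed
  have "openin (top_of_set {0..1}) {t \<in> {0..1}. edge_curve M s t \<in> ?U}" if s: "s \<in> arcs M" for s
  proof -
    obtain w a \<sigma> where w: "w \<in> faces M" "\<bar>\<sigma>\<bar> = 1"
      and e: "\<And>t. 0 \<le> t \<Longrightarrow> t \<le> 1 \<Longrightarrow> edge_curve M s t = rim M w (a + \<sigma> * t)"
      using edge_on_rim[OF s] by metis
    have "continuous_on {0..1} (\<lambda>t. cis (rim_angle w (a + \<sigma> * t)))"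
      unfolding rim_angle_def using face_nonempty[OF w(1)] by (intro continuous_intros) auto
    then have "continuous_map (top_of_set {0..1}) (top_of_set (cball 0 1)) (\<lambda>t. cis (rim_angle w (a + \<sigma> * t)))"
      by (auto simp: continuous_map_in_subtopology)
    from openin_continuous_map_preimage[OF this F[OF w(1)]]
    have "openin (top_of_set {0..1}) {t \<in> {0..1}. cis (rim_angle w (a + \<sigma> * t)) \<in> {z \<in> cball 0 1. disk_map M w z \<in> ?U}}"
      by simp
    also have "{t \<in> {0..1}. cis (rim_angle w (a + \<sigma> * t)) \<in> {z \<in> cball 0 1. disk_map M w z \<in> ?U}}
      = {t \<in> {0..1}. edge_curve M s t \<in> ?U}"
      using e by (auto simp: rim_def)
    finally show ?thesis .
  qed
  then show "openin (surface M) ?U"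
    unfolding openin_surface surface_open_def using F by (auto simp: topspace_surface)
qed

text \<open>A point of an open face records its disk and its coordinate, so identifications occur
  only along boundaries. There every point has a normal form with \<open>0 \<le> t\<close> and
  \<open>t < 1\<close>, whence the shape of the hypothesis.\<close>

lemma function_on_surface:
  assumes compat: "\<And>w i t w' i' t'. w \<in> faces M \<Longrightarrow> w' \<in> faces M \<Longrightarrow> 0 \<le> t \<Longrightarrow> t < 1 \<Longrightarrow> 0 \<le> t' \<Longrightarrow> t' < 1 \<Longrightarrow>
      edge_curve M (cyclic_nth w i) t = edge_curve M (cyclic_nth w' i') t' \<Longrightarrow>
      F w (cis (rim_angle w (of_int i + t))) = F w' (cis (rim_angle w' (of_int i' + t')))"
  shows "\<exists>f. \<forall>w\<in>faces M. \<forall>z\<in>cball 0 1. f (disk_map M w z) = F w z"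
proof -
  define P where "P p x \<longleftrightarrow> fst x \<in> faces M \<and> snd x \<in> cball 0 1 \<and> p = disk_map M (fst x) (snd x)" for p x
  define f where "f p = (let x = (SOME x. P p x) in F (fst x) (snd x))" for p
  show ?thesis
  proof (intro exI[of _ f] ballI)
    fix w and z :: complex assume wz: "w \<in> faces M" "z \<in> cball 0 1"
    let ?p = "disk_map M w z"
    define x where "x = (SOME x. P ?p x)"
    have "P ?p (w, z)" using wz by (simp add: P_def)
    then have "P ?p x" unfolding x_def by (rule someI)
    then have x: "fst x \<in> faces M" "snd x \<in> cball 0 1" and eq: "disk_map M w z = disk_map M (fst x) (snd x)"
      by (auto simp: P_def)
    have "F (fst x) (snd x) = F w z"
    proof (cases "norm z < 1")
      case True
      have "norm (snd x) < 1"
      proof (rule ccontr)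
        assume "\<not> norm (snd x) < 1"
        then show False using eq True x by (auto simp: disk_map_def walk_curve_def edge_curve_def Let_def split: if_splits)
      qed
      then show ?thesis using eq True by (simp add: disk_map_def)
    next
      case False
      then have z: "norm z = 1" using wz by auto
      have "\<not> norm (snd x) < 1"
        using eq False wz by (auto simp: disk_map_def walk_curve_def edge_curve_def Let_def split: if_splits)
      then have x1: "norm (snd x) = 1" using x by auto
      obtain i t where "z = cis (rim_angle w (of_int i + t))" "0 \<le> t" "t < 1"
        "disk_map M w z = edge_curve M (cyclic_nth w i) t" using norm_one_imp_rim[OF wz(1) z] by metis
      moreover obtain i' t' where "snd x = cis (rim_angle (fst x) (of_int i' + t'))" "0 \<le> t'" "t' < 1"
        "disk_map M (fst x) (snd x) = edge_curve M (cyclic_nth (fst x) i') t'" using norm_one_imp_rim[OF x(1) x1] by metis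
      ultimately show ?thesis using compat[OF wz(1) x(1), of t t' i i'] eq by simp
    qed
    then show "f ?p = F w z" by (simp add: f_def x_def Let_def)
  qed
qed

lemma compact_surface: "compact_space (surface M)"
proof -
  have "topspace (surface M) = (\<Union>w\<in>faces M. disk_map M w ` cball 0 1)"
  proof
    show "topspace (surface M) \<subseteq> (\<Union>w\<in>faces M. disk_map M w ` cball 0 1)"
      by (auto elim!: disk_map_surj)
    show "(\<Union>w\<in>faces M. disk_map M w ` cball 0 1) \<subseteq> topspace (surface M)"
      using disk_map_in_surface_points unfolding topspace_surface by blast
  qed
  moreover have "compactin (surface M) (disk_map M w ` cball 0 1)" if "w \<in> faces M" for w
    by (rule image_compactin[OF _ continuous_disk_map[OF that]]) (simp add: compactin_subtopology)
  ultimately show ?thesis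
    unfolding compact_space_def using finite_faces by (auto intro!: compactin_Union)
qed

text \<open>Each disk joins its points to a vertex, and edge curves join the vertices along the
  connected skeleton.\<close>

lemma connected_surface:
  assumes "connected_arc_graph M"
  shows "connected_space (surface M)"
proof -
  let ?C = "connected_component_of (surface M)"
  have disk: "?C (disk_map M w z) (disk_map M w z')" if "w \<in> faces M" "z \<in> cball 0 1" "z' \<in> cball 0 1" for w z z'
  proof -
    have "connectedin (surface M) (disk_map M w ` cball 0 1)"
      by (rule connectedin_continuous_map_image[OF continuous_disk_map[OF that(1)]])
        (simp add: connectedin_subtopology convex_connected)
    then show ?thesis using that unfolding connected_component_of_def by blast
  qed
  have edge: "?C (VPt (tail M s)) (VPt (tail M (ainv M s)))" if "s \<in> arcs M" for s
  proof -
    have "connectedin (surface M) (edge_curve M s ` {0..1})"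
      by (rule connectedin_continuous_map_image[OF continuous_edge_curve[OF that]])
        (simp add: connectedin_subtopology convex_connected)
    moreover have "VPt (tail M s) \<in> edge_curve M s ` {0..1}" "VPt (tail M (ainv M s)) \<in> edge_curve M s ` {0..1}"
      by (force simp: edge_curve_def)+
    ultimately show ?thesis unfolding connected_component_of_def by blast
  qed
  have nodes: "?C (VPt u) (VPt v)" if "u \<in> nodes M" "v \<in> nodes M" for u v
  proof -
    have "(u, v) \<in> {(tail M s, tail M (ainv M s)) | s. s \<in> arcs M}\<^sup>*"
      using assms that by (simp add: connected_arc_graph_def)
    then show ?thesis
    proof (induction rule: rtrancl_induct)
      case base
      then show ?case using that(1)
        by (simp add: connected_component_of_refl topspace_surface surface_points_def vertex_points_def)
    next
      case (step y z)
      then have "?C (VPt y) (VPt z)" using edge by auto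
      then show ?case by (rule connected_component_of_trans[OF step.IH])
    qed
  qed
  have vert: "\<exists>v\<in>nodes M. ?C p (VPt v)" if "p \<in> topspace (surface M)" for p
  proof -
    from that obtain w z where w: "w \<in> faces M" "z \<in> cball 0 1" "p = disk_map M w z" by (rule disk_map_surj)
    have "disk_map M w 1 = VPt (tail M (cyclic_nth w 0))"
      using rim_edge[OF w(1), of 0 0] by (simp add: rim_def rim_angle_def edge_curve_def)
    then show ?thesis using disk[of w z 1] w ainv_arc(3)[OF cyclic_nth_arc[OF w(1)], of 0]
      by (intro bexI[of _ "tail M (cyclic_nth w 0)"]) auto
  qed
  show ?thesis
    unfolding connected_space_iff_connected_component
  proof (intro ballI)
    fix x y assume "x \<in> topspace (surface M)" "y \<in> topspace (surface M)"
    then obtain u v where "u \<in> nodes M" "?C x (VPt u)" "v \<in> nodes M" "?C y (VPt v)" using vert by meson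
    then show "?C x y"
      by (metis nodes connected_component_of_trans connected_component_of_sym)
  qed
qed

end

section \<open>Cyclically glued half-disks\<close>

text \<open>Maps the half-plane \<open>y \<ge> 0\<close>, with radius measured by \<open>N = \<bar>x\<bar> + 2 * y\<close>, onto the \<open>j\<close>-th of
  \<open>k\<close> sectors; the direction is \<open>0\<close> or \<open>1\<close> on the two boundary rays. At \<open>N = 0\<close> the junk value of the
  quotient is multiplied by \<open>0\<close>.\<close>

definition sector_coords :: "nat \<Rightarrow> nat \<Rightarrow> real \<Rightarrow> real \<times> real \<Rightarrow> complex \<times> real" where
  "sector_coords k j \<sigma> p =
     (let N = \<bar>fst p\<bar> + 2 * snd p; h = max 0 (1/2 - N)
      in (of_real (h * N) * cis (2 * pi * (real j + (snd p + max 0 (\<sigma> * fst p)) / N) / real k), h))"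

text \<open>Signed offset from position \<open>a\<close> along the rim, in units of one arc, and
  depth below the rim. The branch cut of \<open>Arg\<close> falls on the ray opposite to
  \<open>a\<close>.\<close>

definition half_coords :: "'d list \<Rightarrow> real \<Rightarrow> complex \<Rightarrow> real \<times> real" where
  "half_coords w a z = (real (length w) * Arg (z * cis (- rim_angle w a)) / (2 * pi), 1 - norm z)"

lemma rim_angle_add: "rim_angle w (a + b) = rim_angle w a + rim_angle w b"
  by (simp add: rim_angle_def add_divide_distrib distrib_left)

lemma half_coords_polar:
  assumes "w \<noteq> []"
  shows "z = of_real (norm z) * cis (rim_angle w (a + fst (half_coords w a z)))"
proof (cases "z = 0")
  case False
  let ?u = "z * cis (- rim_angle w a)"
  have "rim_angle w (fst (half_coords w a z)) = Arg ?u"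
    using assms by (simp add: rim_angle_def half_coords_def)
  moreover have "?u = of_real (norm z) * cis (Arg ?u)"
    using False cis_Arg[of ?u] by (simp add: sgn_eq norm_mult)
  moreover have "z = ?u * cis (rim_angle w a)" by (simp add: mult.assoc cis_mult)
  ultimately have "z = (of_real (norm z) * cis (rim_angle w (fst (half_coords w a z)))) * cis (rim_angle w a)"
    by simp
  then show ?thesis by (simp add: rim_angle_add mult.assoc cis_mult add.commute)
qed simp

text \<open>With at least two arcs on the circle, an offset below 1 is less than a half turn, so
  \<open>Arg\<close> returns it unchanged whatever multiple of the length was added.\<close>

lemma half_coords_eval:
  assumes "2 \<le> length w" "0 < r" "\<bar>x\<bar> < 1"
  shows "half_coords w a (of_real r * cis (rim_angle w (a + x + of_int n * real (length w)))) = (x, 1 - r)"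
proof -
  have ne: "w \<noteq> []" using assms by auto
  let ?m = "real (length w)"
  have "cis (rim_angle w (a + x + of_int n * ?m)) = cis (rim_angle w (a + x))"
    using cis_rim_angle_eq_iff[OF ne] by blast
  then have "of_real r * cis (rim_angle w (a + x + of_int n * ?m)) * cis (- rim_angle w a) = rcis r (rim_angle w x)"
    by (simp add: rcis_def rim_angle_add mult.assoc cis_mult)
  moreover have "\<bar>rim_angle w x\<bar> < pi"
  proof -
    have "\<bar>rim_angle w x\<bar> = pi * (2 * \<bar>x\<bar> / ?m)" by (simp add: rim_angle_def abs_mult)
    also have "\<dots> < pi * 1"
    proof (rule mult_strict_left_mono)
      have "2 \<le> ?m" using assms by simp
      then show "2 * \<bar>x\<bar> / ?m < 1" using assms(3) by (subst pos_divide_less_eq) linarith+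
    qed simp
    finally show ?thesis by simp
  qed
  ultimately have "Arg (of_real r * cis (rim_angle w (a + x + of_int n * ?m)) * cis (- rim_angle w a)) = rim_angle w x"
    using assms by (auto intro!: Arg_rcis)
  then show ?thesis using ne assms by (auto simp: half_coords_def norm_mult rim_angle_def)
qed

text \<open>Only the origin needs care: the direction has no limit there, but it enters through
  \<open>cis\<close>, of norm 1, and is multiplied by a factor tending to 0.\<close>

lemma continuous_on_sector_coords:
  assumes "0 < k"
  shows "continuous_on {p. 0 \<le> snd p} (sector_coords k j \<sigma>)"
proof -
  let ?N = "\<lambda>p::real \<times> real. \<bar>fst p\<bar> + 2 * snd p"
  let ?g = "\<lambda>p. of_real (max 0 (1/2 - ?N p) * ?N p) * cis (2 * pi * (real j + (snd p + max 0 (\<sigma> * fst p)) / ?N p) / real k)"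
  have "continuous (at p within {p. 0 \<le> snd p}) ?g" if p: "0 \<le> snd p" for p
  proof (cases "?N p = 0")
    case True
    have N0: "(?N \<longlongrightarrow> 0) (at p within {p. 0 \<le> snd p})"
    proof -
      have "(?N \<longlongrightarrow> ?N p) (at p within {p. 0 \<le> snd p})" by (intro tendsto_intros)
      then show ?thesis using True by simp
    qed
    have "((\<lambda>p. max 0 (1/2 - ?N p) * ?N p) \<longlongrightarrow> max 0 (1/2 - 0) * 0) (at p within {p. 0 \<le> snd p})"
      by (intro tendsto_intros N0)
    then have "((\<lambda>p. norm (max 0 (1/2 - ?N p) * ?N p)) \<longlongrightarrow> 0) (at p within {p. 0 \<le> snd p})"
      using tendsto_norm_zero by fastforce
    then have "(?g \<longlongrightarrow> 0) (at p within {p. 0 \<le> snd p})"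
      by (rule Lim_null_comparison[rotated]) (simp only: norm_mult norm_of_real norm_cis mult_1_right real_norm_def order.refl eventually_True)
    moreover have "?g p = 0" using True by simp
    ultimately show ?thesis by (simp only: continuous_within)
  next
    case False
    have "open {p. ?N p \<noteq> 0}" by (intro open_Collect_neq continuous_intros)
    moreover have "continuous_on {p. ?N p \<noteq> 0} ?g" using assms by (intro continuous_intros) auto
    ultimately have "isCont ?g p" using False continuous_on_eq_continuous_at by blast
    then show ?thesis by (rule continuous_at_imp_continuous_within)
  qed
  then have 1: "continuous_on {p. 0 \<le> snd p} ?g"
    by (simp add: continuous_on_eq_continuous_within)
  show ?thesis
    unfolding sector_coords_def Let_def
    by (rule continuous_on_Pair[OF 1]) (intro continuous_intros)
qed

lemma sector_coords_zero: "1/2 \<le> \<bar>fst p\<bar> + 2 * snd p \<Longrightarrow> sector_coords k j \<sigma> p = 0"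
  by (simp add: sector_coords_def Let_def zero_prod_def)

text \<open>The discontinuities of \<open>half_coords\<close>, on the cut and at the centre of the
  disk, are harmless because the damping factor vanishes near both.\<close>

lemma continuous_on_sector_half_coords:
  assumes "0 < k" "2 \<le> length w"
  shows "continuous_on (cball 0 1) (\<lambda>z. sector_coords k j \<sigma> (half_coords w a z))"
proof -
  define u where "u z = z * cis (- rim_angle w a)" for z
  have cu: "continuous_on A u" for A unfolding u_def by (intro continuous_intros)
  have hc: "half_coords w a z = (real (length w) * Arg (u z) / (2 * pi), 1 - norm z)" for z
    by (simp add: half_coords_def u_def)
  let ?f = "\<lambda>z. sector_coords k j \<sigma> (half_coords w a z)"
  define S where "S = cball 0 1 \<inter> {z. u z \<notin> \<real>\<^sub>\<le>\<^sub>0}"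
  \<comment> \<open>For \<open>Re (u z) < 0\<close> the angle is at least a right angle, which is an
    offset of at least 1/2 since the walk has length at least 2; for \<open>norm z < 1/2\<close> the
    depth alone exceeds 1/2. So the function is 0 on \<open>T\<close>.\<close>
  define T where "T = cball 0 1 \<inter> ({z. Re (u z) < 0} \<union> ball 0 (1/2))"
  have ST: "cball 0 1 = S \<union> T"
  proof -
    have "z \<in> T" if "z \<in> cball 0 1" "u z \<in> \<real>\<^sub>\<le>\<^sub>0" for z
    proof (cases "Re (u z) < 0")
      case False
      then have "u z = 0" using that by (auto simp: complex_nonpos_Reals_iff complex_eq_iff)
      then have "z = 0" by (simp add: u_def)
      then show ?thesis by (simp add: T_def)
    qed (use that in \<open>simp add: T_def\<close>)
    then show ?thesis unfolding S_def using T_def by blast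
  qed
  have zero: "?f z = 0" if "z \<in> T" for z
  proof (rule sector_coords_zero, cases "norm z < 1/2")
    case True
    have "snd (half_coords w a z) = 1 - norm z" by (simp add: hc)
    then show "1/2 \<le> \<bar>fst (half_coords w a z)\<bar> + 2 * snd (half_coords w a z)"
      using True abs_ge_zero[of "fst (half_coords w a z)"] by linarith
  next
    case False
    then have "Re (u z) < 0" "norm z \<le> 1" using that by (auto simp: T_def)
    then have "pi / 2 \<le> \<bar>Arg (u z)\<bar>" 
      using Arg_Re_pos[of "u z"] by (auto simp: not_less[symmetric])
    then have "2 * (pi / 2) \<le> real (length w) * \<bar>Arg (u z)\<bar>"
      using assms by (intro mult_mono) auto
    then have "1/2 \<le> \<bar>fst (half_coords w a z)\<bar>" 
      by (simp add: hc abs_mult pos_le_divide_eq)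
    moreover have "snd (half_coords w a z) = 1 - norm z" by (simp add: hc)
    ultimately show "1/2 \<le> \<bar>fst (half_coords w a z)\<bar> + 2 * snd (half_coords w a z)"
      using \<open>norm z \<le> 1\<close> by linarith
  qed
  have "continuous_on S (half_coords w a)"
    unfolding hc S_def by (intro continuous_intros cu) auto
  then have 1: "continuous_on S ?f"
    by (rule continuous_on_compose2[OF continuous_on_sector_coords[OF assms(1)]]) (auto simp: S_def hc)
  have 2: "continuous_on T ?f"
    using continuous_on_cong[OF refl zero, of T] by (simp add: zero_prod_def)
  have "closed (\<real>\<^sub>\<le>\<^sub>0 :: complex set)" by (rule closed_nonpos_Reals_complex)
  then have "open (u -` (- \<real>\<^sub>\<le>\<^sub>0))"
    by (intro open_vimage cu) auto
  then have "openin (top_of_set (cball 0 1)) S"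
    unfolding S_def by (simp add: openin_open_Int vimage_def)
  moreover have "open ({z. Re (u z) < 0} \<union> ball 0 (1/2))"
    by (intro open_Un open_Collect_less continuous_intros cu) auto
  then have "openin (top_of_set (cball 0 1)) T"
    unfolding T_def by (rule openin_open_Int)
  ultimately show ?thesis
    using continuous_on_Un_local_open[of S T ?f] 1 2 unfolding ST by blast
qed

text \<open>The three alternatives are exactly the identifications made by gluing: the common
  centre, the same point of one half-disk, and a point on a ray shared by two neighbours. The second
  component fixes the radius, so only the angles remain to be compared.\<close>

lemma sector_coords_eqD:
  assumes jk: "j < k" "j' < k" and sg: "\<sigma> = 1 \<or> \<sigma> = -1" "\<sigma>' = 1 \<or> \<sigma>' = -1"
    and y: "0 \<le> y" "0 \<le> y'" and N: "\<bar>x\<bar> + 2 * y < 1/2" "\<bar>x'\<bar> + 2 * y' < 1/2"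
    and eq: "sector_coords k j \<sigma> (x, y) = sector_coords k j' \<sigma>' (x', y')"
  shows "(x = 0 \<and> y = 0 \<and> x' = 0 \<and> y' = 0) \<or> (j = j' \<and> \<sigma> * x = \<sigma>' * x' \<and> y = y') \<or>
    (y = 0 \<and> y' = 0 \<and> \<sigma> * x = - (\<sigma>' * x') \<and>
      (0 \<le> \<sigma> * x \<and> j' = Suc j mod k \<or> \<sigma> * x \<le> 0 \<and> j = Suc j' mod k))"
proof -
  define n where "n = \<bar>x\<bar> + 2 * y"
  define \<xi> where "\<xi> = \<sigma> * x"
  define \<xi>' where "\<xi>' = \<sigma>' * x'"
  have ax: "\<bar>\<xi>\<bar> = \<bar>x\<bar>" "\<bar>\<xi>'\<bar> = \<bar>x'\<bar>" using sg by (auto simp: \<xi>_def \<xi>'_def)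
  define l where "l = (y + max 0 \<xi>) / n"
  define l' where "l' = (y' + max 0 \<xi>') / n"
  have n': "\<bar>x'\<bar> + 2 * y' = n" using eq N by (simp add: sector_coords_def Let_def n_def)
  have n0: "0 \<le> n" using y by (simp add: n_def)
  show ?thesis
  proof (cases "n = 0")
    case True
    then have "\<bar>x\<bar> = 0" "y = 0" "\<bar>x'\<bar> = 0" "y' = 0" using n' y unfolding n_def by linarith+
    then show ?thesis by simp
  next
    case False
    then have np: "0 < n" using n0 by simp
    have "of_real ((1/2 - n) * n) * cis (2 * pi * (real j + l) / real k) =
          of_real ((1/2 - n) * n) * cis (2 * pi * (real j' + l') / real k)"
      using eq N n' by (simp add: sector_coords_def Let_def l_def l'_def n_def \<xi>_def \<xi>'_def)
    moreover have "(1/2 - n) * n \<noteq> 0" using N np by (simp add: n_def)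
    ultimately have "cis (2 * pi * (real j + l) / real k) = cis (2 * pi * (real j' + l') / real k)"
      by (simp only: mult_cancel_left of_real_eq_0_iff) blast
    then obtain m :: int where "2 * pi * (real j + l) / real k = 2 * pi * (real j' + l') / real k + 2 * pi * of_int m"
      using cis_eq_cis_iff by blast
    also have "\<dots> = 2 * pi * ((real j' + l') / real k + of_int m)" by (simp add: algebra_simps)
    finally have "2 * pi * ((real j + l) / real k) = 2 * pi * ((real j' + l') / real k + of_int m)" by simp
    then have "(real j + l) / real k = (real j' + l') / real k + of_int m"
      by (rule mult_left_cancel[THEN iffD1, rotated]) simp
    then have jm: "real j + l = real j' + l' + of_int m * real k" using jk by (simp add: field_simps)
    have yl: "l * n = y + max 0 \<xi>" "l' * n = y' + max 0 \<xi>'" using np by (auto simp: l_def l'_def)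
    have nx: "n = \<bar>\<xi>\<bar> + 2 * y" "n = \<bar>\<xi>'\<bar> + 2 * y'" using ax n' by (auto simp: n_def)
    have l01: "0 \<le> l" "l \<le> 1" "0 \<le> l'" "l' \<le> 1"
      using np y nx by (auto simp: l_def l'_def pos_divide_le_eq)
    have L1: "y = 0 \<and> \<xi> \<ge> 0" if "l = 1" using that yl(1) nx(1) y by (auto simp: max_def split: if_splits)
    have L0: "y = 0 \<and> \<xi> \<le> 0" if "l = 0" using that yl(1) nx(1) y by (auto simp: max_def split: if_splits)
    have L1': "y' = 0 \<and> \<xi>' \<ge> 0" if "l' = 1" using that yl(2) nx(2) y by (auto simp: max_def split: if_splits)
    have L0': "y' = 0 \<and> \<xi>' \<le> 0" if "l' = 0" using that yl(2) nx(2) y by (auto simp: max_def split: if_splits)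
    have LL: "y = y' \<and> \<xi> = \<xi>'" if "l = l'" using that yl nx by (auto simp: max_def abs_if split: if_splits)
    \<comment> \<open>\<open>d\<close> is the difference \<open>l' - l\<close> of two numbers
      between 0 and 1. It is an integer, so unless the directions agree they are the two extremes,
      which occur only on boundary rays.\<close>
    define d where "d = int j - int j' - m * int k"
    have "l' - l = of_int d" using jm by (simp add: d_def)
    then have "d = 0 \<or> d = 1 \<or> d = -1" using l01 by linarith
    then consider "d = 0" "l = l'" | "d = 1" "l' = 1" "l = 0" | "d = -1" "l' = 0" "l = 1"
      using \<open>l' - l = of_int d\<close> l01 by force
    then show ?thesis
    proof cases
      case 1
      then have "int j mod int k = int j' mod int k" by (simp add: d_def algebra_simps)
      then have "j = j'" using jk by simp
      then show ?thesis using LL 1 by (auto simp: \<xi>_def \<xi>'_def)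
    next
      case 2
      then have "int j = (int j' + 1) + m * int k" by (simp add: d_def algebra_simps)
      then have "int j mod int k = (int j' + 1) mod int k" by simp
      then have "int j = int (Suc j' mod k)" using jk by (simp add: zmod_int add.commute)
      then have "j = Suc j' mod k" by simp
      then show ?thesis using L0[OF 2(3)] L1'[OF 2(2)] nx by (auto simp: \<xi>_def \<xi>'_def)
    next
      case 3
      then have "int j' = (int j + 1) + (- m) * int k" by (simp add: d_def algebra_simps)
      then have "int j' mod int k = (int j + 1) mod int k" by (metis mod_mult_self1)
      then have "int j' = int (Suc j mod k)" using jk by (simp add: zmod_int add.commute)
      then have "j' = Suc j mod k" by simp
      then show ?thesis using L1[OF 3(3)] L0'[OF 3(2)] nx by (auto simp: \<xi>_def \<xi>'_def)
    qed
  qed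
qed

lemma sector_coords_surj:
  assumes "0 < k" "norm z < 1/2"
  obtains j where "j < k" "\<And>\<sigma>. \<sigma> = 1 \<or> \<sigma> = -1 \<Longrightarrow>
    \<exists>x y. 0 \<le> y \<and> \<bar>x\<bar> + 2 * y < 1/2 \<and> sector_coords k j \<sigma> (x, y) = cone_coords (1/2) z"
proof -
  define r where "r = norm z"
  define \<kappa> where "\<kappa> = real k * Arg2pi z / (2 * pi)"
  define j where "j = nat \<lfloor>\<kappa>\<rfloor>"
  define l where "l = frac \<kappa>"
  have k0: "0 \<le> \<kappa>" using Arg2pi[of z] assms by (simp add: \<kappa>_def)
  have "real k * Arg2pi z < real k * (2 * pi)" using Arg2pi_lt_2pi assms by simp
  then have "\<kappa> < real k" by (simp add: \<kappa>_def pos_divide_less_eq)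
  then have jk: "j < k" using k0 unfolding j_def by linarith
  have kj: "\<kappa> = real j + l" using k0 by (simp add: j_def l_def frac_def)
  have l: "0 \<le> l" "l < 1" by (auto simp: l_def frac_ge_0 frac_lt_1)
  have z: "z = of_real r * cis (2 * pi * \<kappa> / real k)"
    using Arg2pi_eq[of z] assms by (simp add: r_def \<kappa>_def cis_conv_exp)
  show thesis
  proof (rule that[OF jk])
    fix \<sigma> :: real assume sg: "\<sigma> = 1 \<or> \<sigma> = -1"
    \<comment> \<open>The coordinates \<open>p\<close> and \<open>q\<close> unfold the half-plane to
      a quadrant by \<open>y = min p q\<close> and \<open>\<sigma> * x = q - p\<close>. Then the
      radius is \<open>p + q\<close>, and \<open>y + max 0 (\<sigma> * x)\<close> is
      \<open>q\<close>, so radius \<open>r\<close> and direction \<open>l\<close> require exactly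
      these values.\<close>
    define p where "p = r * (1 - l)"
    define q where "q = r * l"
    define y where "y = min p q"
    define x where "x = \<sigma> * (q - p)"
    have r0: "0 \<le> r" by (simp add: r_def)
    have pq: "0 \<le> p" "0 \<le> q" "p + q = r" using l r0 mult_left_le[of l r] by (auto simp: p_def q_def right_diff_distrib)
    have ax: "\<bar>x\<bar> = \<bar>q - p\<bar>" "\<sigma> * x = q - p" using sg by (auto simp: x_def)
    have n: "\<bar>x\<bar> + 2 * y = r" using pq ax by (auto simp: y_def min_def)
    have q: "y + max 0 (\<sigma> * x) = r * l" using ax by (auto simp: y_def q_def)
    have "sector_coords k j \<sigma> (x, y) = (of_real ((1/2 - r) * r) * cis (2 * pi * (real j + r * l / r) / real k), 1/2 - r)"
      using assms(2) unfolding sector_coords_def Let_def fst_conv snd_conv n q by (simp add: r_def[symmetric])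
    also have "\<dots> = cone_coords (1/2) z"
    proof (cases "r = 0")
      case False
      then have "real j + r * l / r = \<kappa>" using kj by simp
      moreover have "of_real ((1/2 - r) * r) * cis (2 * pi * \<kappa> / real k) = of_real (1/2 - r) * z"
        by (subst z) (simp add: mult.assoc)
      ultimately show ?thesis by (simp add: cone_coords_def r_def)
    qed (simp add: cone_coords_def r_def)
    finally show "\<exists>x y. 0 \<le> y \<and> \<bar>x\<bar> + 2 * y < 1/2 \<and> sector_coords k j \<sigma> (x, y) = cone_coords (1/2) z"
      using pq n assms(2) by (intro exI[of _ x] exI[of _ y]) (auto simp: y_def r_def)
  qed
qed

text \<open>The \<open>j\<close>-th half-disk is centred at position \<open>a j\<close> of the boundary of the disk \<open>W j\<close>; the sign \<open>\<sigma> j\<close>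
  says in which direction its boundary leads to the next half-disk.\<close>

locale star = cell_complex M for M :: "('v, 'd, 'z) premap_scheme" +
  fixes k :: nat and W :: "nat \<Rightarrow> 'd list" and a \<sigma> :: "nat \<Rightarrow> real"
  assumes k_pos: "0 < k"
    and W_face: "j < k \<Longrightarrow> W j \<in> faces M"
    and sign: "j < k \<Longrightarrow> \<sigma> j = 1 \<or> \<sigma> j = -1"
    and separated: "j < k \<Longrightarrow> j' < k \<Longrightarrow> W j = W j' \<Longrightarrow> j \<noteq> j' \<Longrightarrow>
          1 \<le> \<bar>a j - a j' - of_int n * real (length (W j))\<bar>"
    and glue: "j < k \<Longrightarrow> 0 \<le> t \<Longrightarrow> t \<le> 1/2 \<Longrightarrow>
          rim M (W j) (a j + \<sigma> j * t) = rim M (W (Suc j mod k)) (a (Suc j mod k) - \<sigma> (Suc j mod k) * t)"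
    and only: "j < k \<Longrightarrow> 0 \<le> t \<Longrightarrow> t < 1/2 \<Longrightarrow> w \<in> faces M \<Longrightarrow>
          rim M (W j) (a j + \<sigma> j * t) = rim M w b \<Longrightarrow>
          \<exists>i<k. W i = w \<and> (\<exists>n::int.
             b = a i + \<sigma> i * t + of_int n * real (length w) \<and> (t = 0 \<or> i = j) \<or>
             b = a i + - \<sigma> i * t + of_int n * real (length w) \<and> (t = 0 \<or> i = Suc j mod k))"
begin

text \<open>Several half-disks may lie on the same face, hence the sum; on the closed disk at most
  one term is nonzero, by \<open>near_unique\<close>.\<close>

definition star_coords :: "'d list \<Rightarrow> complex \<Rightarrow> complex \<times> real" where
  "star_coords w z = (\<Sum>j<k. if W j = w then sector_coords k j (\<sigma> j) (half_coords w (a j) z) else 0)"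

definition near :: "nat \<Rightarrow> complex \<Rightarrow> bool" where
  "near j z \<longleftrightarrow> \<bar>fst (half_coords (W j) (a j) z)\<bar> + 2 * snd (half_coords (W j) (a j) z) < 1/2"

lemma nearD:
  assumes "near j z" "norm z \<le> 1"
  shows "\<bar>fst (half_coords (W j) (a j) z)\<bar> < 1/2" "0 < norm z"
    "0 \<le> snd (half_coords (W j) (a j) z)" "snd (half_coords (W j) (a j) z) = 1 - norm z"
proof -
  show s: "snd (half_coords (W j) (a j) z) = 1 - norm z" by (simp add: half_coords_def)
  then show s0: "0 \<le> snd (half_coords (W j) (a j) z)" using assms by simp
  show "\<bar>fst (half_coords (W j) (a j) z)\<bar> < 1/2" using assms s0 unfolding near_def by linarith
  show "0 < norm z" using assms s unfolding near_def by linarith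
qed

text \<open>Two offsets below 1/2 would bring the centres closer than 1 modulo the length of the
  walk, against \<open>separated\<close>.\<close>

lemma near_unique:
  assumes "near j z" "near i z" "norm z \<le> 1" "j < k" "i < k" "W j = W i"
  shows "j = i"
proof (rule ccontr)
  assume ne: "j \<noteq> i"
  let ?x = "fst (half_coords (W j) (a j) z)" and ?x' = "fst (half_coords (W i) (a i) z)"
  have Wn: "W j \<noteq> []" using W_face face_nonempty assms by blast
  have "of_real (norm z) * cis (rim_angle (W j) (a j + ?x)) = of_real (norm z) * cis (rim_angle (W i) (a i + ?x'))"
    using half_coords_polar[of "W j" z "a j"] half_coords_polar[of "W i" z "a i"] Wn assms by simp
  then have "cis (rim_angle (W j) (a j + ?x)) = cis (rim_angle (W j) (a i + ?x'))"
    using nearD(2)[OF assms(1,3)] assms(6) by simp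
  then obtain n :: int where "a j + ?x = a i + ?x' + of_int n * real (length (W j))"
    using cis_rim_angle_eq_iff[OF Wn] by blast
  then have "\<bar>a j - a i - of_int n * real (length (W j))\<bar> < 1"
    using nearD(1)[OF assms(1,3)] nearD(1)[OF assms(2,3)] by linarith
  then show False using separated[of j i n] ne assms by linarith
qed

lemma star_coords_near:
  assumes "j < k" "near j z" "norm z \<le> 1"
  shows "star_coords (W j) z = sector_coords k j (\<sigma> j) (half_coords (W j) (a j) z)"
proof -
  have "star_coords (W j) z = (\<Sum>i\<in>{j}. if W i = W j then sector_coords k i (\<sigma> i) (half_coords (W j) (a i) z) else 0)"
    unfolding star_coords_def
  proof (rule sum.mono_neutral_right)
    show "\<forall>i\<in>{..<k} - {j}. (if W i = W j then sector_coords k i (\<sigma> i) (half_coords (W j) (a i) z) else 0) = 0"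
    proof (clarsimp split: if_splits)
      fix i assume i: "i < k" "i \<noteq> j" "W i = W j"
      then have "\<not> near i z" using near_unique[of j z i] assms by auto
      then show "sector_coords k i (\<sigma> i) (half_coords (W j) (a i) z) = 0"
        using i by (intro sector_coords_zero) (simp add: near_def)
    qed
  qed (use assms in auto)
  then show ?thesis by simp
qed

lemma star_coords_nonzero:
  assumes "star_coords w z \<noteq> 0"
  obtains j where "j < k" "W j = w" "near j z"
proof -
  have "\<exists>j<k. W j = w \<and> near j z"
  proof (rule ccontr)
    assume none: "\<not> (\<exists>j<k. W j = w \<and> near j z)"
    have "star_coords w z = 0"
      unfolding star_coords_def
    proof (rule sum.neutral, intro ballI)
      fix j assume "j \<in> {..<k}"
      then show "(if W j = w then sector_coords k j (\<sigma> j) (half_coords w (a j) z) else 0) = 0"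
        using none by (auto simp: near_def intro!: sector_coords_zero)
    qed
    then show False using assms by simp
  qed
  then show thesis using that by blast
qed

lemma star_coords_rim:
  assumes "j < k" "\<bar>x\<bar> < 1/2"
  shows "star_coords (W j) (cis (rim_angle (W j) (a j + x + of_int n * real (length (W j))))) = sector_coords k j (\<sigma> j) (x, 0)"
proof -
  let ?z = "cis (rim_angle (W j) (a j + x + of_int n * real (length (W j))))"
  have h: "half_coords (W j) (a j) ?z = (x, 0)"
    using half_coords_eval[of "W j" 1 x "a j" n] assms length_face[OF W_face[OF assms(1)]] by auto
  then have "near j ?z" using assms by (simp add: near_def)
  then show ?thesis using star_coords_near[of j ?z] assms h by simp
qed

text \<open>The common value on the ray shared by half-disks \<open>j\<close> and
  \<open>Suc j mod k\<close>, at distance \<open>t\<close> from the centre: direction 1 in the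
  former is direction 0 in the latter.\<close>

definition spoke_coords :: "nat \<Rightarrow> real \<Rightarrow> complex \<times> real" where
  "spoke_coords j t = (of_real ((1/2 - t) * t) * cis (2 * pi * real (Suc j) / real k), 1/2 - t)"

lemma sector_coords_spoke:
  assumes "j < k" "0 \<le> t" "t < 1/2"
  shows "sector_coords k j (\<sigma> j) (\<sigma> j * t, 0) = spoke_coords j t"
    "sector_coords k (Suc j mod k) (\<sigma> (Suc j mod k)) (- \<sigma> (Suc j mod k) * t, 0) = spoke_coords j t"
proof -
  show "sector_coords k j (\<sigma> j) (\<sigma> j * t, 0) = spoke_coords j t"
    using sign[OF assms(1)] assms by (auto simp: sector_coords_def spoke_coords_def Let_def add.commute)
  have "Suc j mod k < k" using k_pos by simp
  moreover have "cis (2 * pi * real (Suc j mod k) / real k) = cis (2 * pi * real (Suc j) / real k)"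
  proof (cases "Suc j = k")
    case True
    then have "2 * pi * real (Suc j) / real k = 2 * pi" by simp
    then show ?thesis using True by (simp del: of_nat_Suc)
  qed (use assms in simp)
  ultimately show "sector_coords k (Suc j mod k) (\<sigma> (Suc j mod k)) (- \<sigma> (Suc j mod k) * t, 0) = spoke_coords j t"
    using sign[of "Suc j mod k"] assms by (auto simp: sector_coords_def spoke_coords_def Let_def simp del: of_nat_Suc)
qed

text \<open>\<open>only\<close> lists all boundary positions lying over the point, and at each of
  them the value is that of the spoke. At \<open>t = 0\<close> any half-disk may occur, but there
  all spokes take the same value.\<close>

lemma star_coords_spoke:
  assumes "j < k" "0 \<le> t" "t < 1/2" "w \<in> faces M" "rim M (W j) (a j + \<sigma> j * t) = rim M w b"
  shows "star_coords w (cis (rim_angle w b)) = spoke_coords j t"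
proof -
  obtain i and n :: int where i: "i < k" "W i = w" and
    b: "b = a i + \<sigma> i * t + of_int n * real (length w) \<and> (t = 0 \<or> i = j) \<or>
        b = a i + - \<sigma> i * t + of_int n * real (length w) \<and> (t = 0 \<or> i = Suc j mod k)"
    using only[OF assms] by blast
  have t: "\<bar>\<sigma> i * t\<bar> < 1/2" "\<bar>- \<sigma> i * t\<bar> < 1/2" using sign[OF i(1)] assms by auto
  have 0: "sector_coords k i (\<sigma> i) (0, 0) = spoke_coords j 0" by (simp add: sector_coords_def spoke_coords_def Let_def)
  from b show ?thesis
  proof (elim disjE conjE)
    assume "b = a i + \<sigma> i * t + of_int n * real (length w)" "t = 0"
    then show ?thesis using star_coords_rim[OF i(1) t(1), of n] i 0 by simp
  next
    assume "b = a i + - \<sigma> i * t + of_int n * real (length w)" "t = 0"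
    then show ?thesis using star_coords_rim[OF i(1) t(1), of n] i 0 by simp
  next
    assume "b = a i + \<sigma> i * t + of_int n * real (length w)" "i = j"
    then show ?thesis using star_coords_rim[OF i(1) t(1), of n] i sector_coords_spoke(1)[OF assms(1-3)] by simp
  next
    assume "b = a i + - \<sigma> i * t + of_int n * real (length w)" "i = Suc j mod k"
    then show ?thesis
      using star_coords_rim[OF i(1) t(2), of n] i sector_coords_spoke(2)[OF assms(1-3)] by simp
  qed
qed

lemma rim_spoke:
  assumes j: "j < k" and x: "\<bar>x\<bar> < 1/2"
  obtains i t where "i < k" "0 \<le> t" "t < 1/2" "rim M (W j) (a j + x) = rim M (W i) (a i + \<sigma> i * t)"
proof (cases "0 \<le> \<sigma> j * x")
  case True
  have "\<sigma> j * (\<sigma> j * x) = x" "\<sigma> j * x < 1/2" using sign[OF j] x by auto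
  then show thesis using that[OF j True] by metis
next
  case False
  \<comment> \<open>A backward offset from centre \<open>j\<close> lies on the spoke that half-disk
    \<open>j\<close> shares with its cyclic predecessor.\<close>
  define i where "i = (if j = 0 then k - 1 else j - 1)"
  have i: "i < k" "Suc i mod k = j" using j k_pos by (auto simp: i_def)
  define t where "t = - (\<sigma> j * x)"
  have t: "a j - \<sigma> j * t = a j + x" "0 \<le> t" "t < 1/2" using sign[OF j] x False by (auto simp: t_def)
  then have "rim M (W i) (a i + \<sigma> i * t) = rim M (W j) (a j - \<sigma> j * t)"
    using glue[OF i(1), of t] i(2) by simp
  then have "rim M (W j) (a j + x) = rim M (W i) (a i + \<sigma> i * t)" using t(1) by metis
  then show thesis using that i(1) t by blast
qed

lemma star_coords_nonzero_rim:
  assumes "star_coords w (cis (rim_angle w b)) \<noteq> 0"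
  obtains i t where "i < k" "0 \<le> t" "t < 1/2" "rim M w b = rim M (W i) (a i + \<sigma> i * t)"
proof -
  let ?z = "cis (rim_angle w b)"
  obtain j where j: "j < k" "W j = w" "near j ?z" using star_coords_nonzero assms by blast
  define x where "x = fst (half_coords w (a j) ?z)"
  have "?z = cis (rim_angle w (a j + x))"
    using half_coords_polar[of w ?z "a j"] face_nonempty[OF W_face[OF j(1)]] j by (simp add: x_def)
  then have "rim M w b = rim M (W j) (a j + x)" using j by (simp add: rim_def)
  moreover have "\<bar>x\<bar> < 1/2" using nearD(1)[OF j(3)] j by (simp add: x_def)
  ultimately show thesis using rim_spoke[OF j(1)] that by metis
qed

text \<open>Either the point is on a spoke, whose value does not depend on the disk, or it is out of
  reach of every half-disk and both sides are 0.\<close>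

lemma star_coords_compat:
  assumes "w \<in> faces M" "w' \<in> faces M" "rim M w b = rim M w' b'"
  shows "star_coords w (cis (rim_angle w b)) = star_coords w' (cis (rim_angle w' b'))"
proof (cases "\<exists>i t. i < k \<and> 0 \<le> t \<and> t < 1/2 \<and> rim M w b = rim M (W i) (a i + \<sigma> i * t)")
  case True
  then obtain i t where "i < k" "0 \<le> t" "t < 1/2" "rim M (W i) (a i + \<sigma> i * t) = rim M w b" by metis
  then show ?thesis using star_coords_spoke assms by metis
next
  case False
  then have "star_coords w (cis (rim_angle w b)) = 0" "star_coords w' (cis (rim_angle w' b')) = 0"
    using star_coords_nonzero_rim assms by metis+
  then show ?thesis by simp
qed

lemma rim_center:
  assumes "j < k" shows "rim M (W j) (a j) = rim M (W 0) (a 0)"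
  using assms
proof (induction j)
  case (Suc j)
  then show ?case using glue[of j 0] by simp
qed simp

text \<open>Injectivity is \<open>sector_coords_eqD\<close> followed by \<open>glue\<close>:
  whatever the sector maps identify is already identified in the surface. Surjectivity onto the cone
  comes from \<open>sector_coords_surj\<close>.\<close>

lemma star_chart:
  "\<exists>f. disk_chart (surface M) (1/2) f \<and>
     (\<forall>j<k. \<forall>x. \<bar>x\<bar> < 1/2 \<longrightarrow> 0 < snd (f (rim M (W j) (a j + x))))"
proof -
  have compat: "star_coords w (cis (rim_angle w (of_int i + t))) = star_coords w' (cis (rim_angle w' (of_int i' + t')))"
    if "w \<in> faces M" "w' \<in> faces M" "0 \<le> t" "t < 1" "0 \<le> t'" "t' < 1"
      "edge_curve M (cyclic_nth w i) t = edge_curve M (cyclic_nth w' i') t'" for w i t w' i' t'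
    using that star_coords_compat rim_edge by simp
  obtain f where f: "\<And>w z. w \<in> faces M \<Longrightarrow> z \<in> cball 0 1 \<Longrightarrow> f (disk_map M w z) = star_coords w z"
    using function_on_surface[of star_coords] compat by metis
  have cont: "continuous_map (surface M) euclidean f"
  proof (rule continuous_map_from_surface)
    fix w assume w: "w \<in> faces M"
    have "continuous_on (cball 0 1) (star_coords w)"
      unfolding star_coords_def
    proof (rule continuous_on_sum)
      fix j
      show "continuous_on (cball 0 1) (\<lambda>z. if W j = w then sector_coords k j (\<sigma> j) (half_coords w (a j) z) else 0)"
        using continuous_on_sector_half_coords[OF k_pos length_face[OF w]] by (cases "W j = w") auto
    qed
    then have "continuous_on (cball 0 1) (\<lambda>z. f (disk_map M w z))"
      using f[OF w] continuous_on_cong by (metis (no_types, lifting))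
    then show "continuous_map (top_of_set (cball 0 1)) euclidean (\<lambda>z. f (disk_map M w z))" by simp
  qed
  have pos: "\<exists>j<k. \<exists>z. norm z \<le> 1 \<and> near j z \<and> p = disk_map M (W j) z \<and> f p = star_coords (W j) z"
    if p: "p \<in> topspace (surface M)" "0 < snd (f p)" for p
  proof -
    from p(1) obtain w z where w: "w \<in> faces M" "z \<in> cball 0 1" "p = disk_map M w z" by (rule disk_map_surj)
    then have "star_coords w z \<noteq> 0" using p(2) f by auto
    then obtain j where "j < k" "W j = w" "near j z" by (rule star_coords_nonzero)
    then show ?thesis using w f by auto
  qed
  have inj: "p = q" if p: "p \<in> topspace (surface M)" and q: "q \<in> topspace (surface M)"
    and pp: "0 < snd (f p)" and eq: "f p = f q" for p q
  proof -
    have qp: "0 < snd (f q)" using pp eq by simp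
    obtain j z where j: "j < k" "norm z \<le> 1" "near j z" "p = disk_map M (W j) z" "f p = star_coords (W j) z"
      using pos[OF p pp] by blast
    obtain i z' where i: "i < k" "norm z' \<le> 1" "near i z'" "q = disk_map M (W i) z'" "f q = star_coords (W i) z'"
      using pos[OF q qp] by blast
    obtain x y where xy: "half_coords (W j) (a j) z = (x, y)" by force
    obtain x' y' where xy': "half_coords (W i) (a i) z' = (x', y')" by force
    have z: "z = of_real (1 - y) * cis (rim_angle (W j) (a j + x))"
      using half_coords_polar[of "W j" z "a j"] nearD(4)[OF j(3,2)] xy face_nonempty[OF W_face[OF j(1)]] by simp
    have z': "z' = of_real (1 - y') * cis (rim_angle (W i) (a i + x'))"
      using half_coords_polar[of "W i" z' "a i"] nearD(4)[OF i(3,2)] xy' face_nonempty[OF W_face[OF i(1)]] by simp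
    have b: "\<bar>x\<bar> + 2 * y < 1/2" "\<bar>x'\<bar> + 2 * y' < 1/2" "0 \<le> y" "0 \<le> y'"
      using nearD(3)[OF j(3,2)] nearD(3)[OF i(3,2)] j(3) i(3) xy xy' by (auto simp: near_def)
    have x: "\<bar>x\<bar> \<le> 1/2" "\<bar>x'\<bar> \<le> 1/2" using b by auto
    have seq: "sector_coords k j (\<sigma> j) (x, y) = sector_coords k i (\<sigma> i) (x', y')"
      using eq j i star_coords_near[OF j(1,3,2)] star_coords_near[OF i(1,3,2)] xy xy' by simp
    have sg: "\<sigma> j * (\<sigma> j * u) = u" "\<sigma> i * (\<sigma> i * u) = u" "\<bar>\<sigma> j * u\<bar> = \<bar>u\<bar>" "\<bar>\<sigma> i * u\<bar> = \<bar>u\<bar>" for u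
      using sign[OF j(1)] sign[OF i(1)] by auto
    have pr: "p = rim M (W j) (a j + x)" "q = rim M (W i) (a i + x')" if "y = 0" "y' = 0"
      using that j(4) i(4) z z' by (simp_all add: rim_def)
    from sector_coords_eqD[OF j(1) i(1) sign[OF j(1)] sign[OF i(1)] b(3,4,1,2) seq]
    show "p = q"
    proof (elim disjE conjE)
      assume "x = 0" "y = 0" "x' = 0" "y' = 0"
      then have "p = rim M (W j) (a j)" "q = rim M (W i) (a i)" using pr by auto
      then show ?thesis using rim_center j i by metis
    next
      assume e: "j = i" "\<sigma> j * x = \<sigma> i * x'" "y = y'"
      then have "x = x'" using sign[OF j(1)] by auto
      then show ?thesis using e z z' j i by simp
    next
      assume e: "y = 0" "y' = 0" "\<sigma> j * x = - (\<sigma> i * x')" "0 \<le> \<sigma> j * x" "i = Suc j mod k"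
      define t where "t = \<sigma> j * x"
      have "\<sigma> i * x' = - t" using e(3) by (simp add: t_def)
      then have "x' = - (\<sigma> i * t)" using sg(2)[of x'] by simp
      moreover have "x = \<sigma> j * t" using sg(1)[of x] by (simp add: t_def)
      moreover have "t \<le> 1/2" "0 \<le> t" using sg(3)[of x] x e(4) unfolding t_def by linarith+
      ultimately have t: "x = \<sigma> j * t" "x' = - (\<sigma> i * t)" "t \<le> 1/2" "0 \<le> t" by blast+
      have "rim M (W j) (a j + \<sigma> j * t) = rim M (W i) (a i - \<sigma> i * t)"
        unfolding e(5) by (rule glue[OF j(1) t(4,3)])
      then show ?thesis using t pr[OF e(1,2)] by simp
    next
      assume e: "y = 0" "y' = 0" "\<sigma> j * x = - (\<sigma> i * x')" "\<sigma> j * x \<le> 0" "j = Suc i mod k"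
      define t where "t = \<sigma> i * x'"
      have t: "x' = \<sigma> i * t" "x = - (\<sigma> j * t)" "t \<le> 1/2" "0 \<le> t"
        using sg(1)[of x] sg(2)[of x'] sg(4)[of x'] e(3,4) x by (auto simp: t_def)
      have "rim M (W i) (a i + \<sigma> i * t) = rim M (W j) (a j - \<sigma> j * t)"
        unfolding e(5) by (rule glue[OF i(1) t(4,3)])
      then show ?thesis using t pr[OF e(1,2)] by simp
    qed
  qed
  have pt: "\<exists>p\<in>topspace (surface M). f p = sector_coords k j (\<sigma> j) (x, y) \<and> p = disk_map M (W j) (of_real (1 - y) * cis (rim_angle (W j) (a j + x)))"
    if "j < k" "0 \<le> y" "\<bar>x\<bar> + 2 * y < 1/2" for j x y
  proof -
    define z where "z = of_real (1 - y) * cis (rim_angle (W j) (a j + x))"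
    have "\<bar>x\<bar> < 1" "0 < 1 - y" using that by linarith+
    then have h: "half_coords (W j) (a j) z = (x, y)"
      using half_coords_eval[of "W j" "1 - y" x "a j" 0] length_face[OF W_face[OF that(1)]] by (simp add: z_def)
    have nz: "norm z \<le> 1" unfolding z_def norm_mult norm_of_real norm_cis using that(2) \<open>0 < 1 - y\<close> by simp
    have "near j z" using h that by (simp add: near_def)
    then have "f (disk_map M (W j) z) = sector_coords k j (\<sigma> j) (x, y)"
      using star_coords_near[OF that(1) _ nz] f[OF W_face[OF that(1)], of z] nz h by simp
    moreover have "disk_map M (W j) z \<in> topspace (surface M)"
      using disk_map_in_surface_points[OF W_face[OF that(1)], of z] nz by (simp add: topspace_surface)
    ultimately show ?thesis using z_def by blast
  qed
  have "f ` {p \<in> topspace (surface M). snd (f p) > 0} = cone_coords (1/2) ` ball 0 (1/2)"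
  proof (intro equalityI subsetI)
    fix c assume "c \<in> f ` {p \<in> topspace (surface M). snd (f p) > 0}"
    then obtain p where p: "p \<in> topspace (surface M)" "0 < snd (f p)" "c = f p" by auto
    then obtain j z where j: "j < k" "norm z \<le> 1" "near j z" "f p = star_coords (W j) z" using pos by blast
    let ?h = "half_coords (W j) (a j) z"
    define N where "N = \<bar>fst ?h\<bar> + 2 * snd ?h"
    have N: "0 \<le> N" "N < 1/2" using nearD(3)[OF j(3,2)] j(3) by (auto simp: N_def near_def)
    obtain \<theta> where "sector_coords k j (\<sigma> j) ?h = (of_real ((1/2 - N) * N) * cis \<theta>, 1/2 - N)"
      using N unfolding sector_coords_def Let_def N_def[symmetric] by (metis max.absorb2 diff_ge_0_iff_ge less_imp_le)
    then have "c = cone_coords (1/2) (of_real N * cis \<theta>)"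
      using p j star_coords_near[OF j(1,3,2)] N by (simp add: cone_coords_def norm_mult)
    then show "c \<in> cone_coords (1/2) ` ball 0 (1/2)" using N by (auto simp: norm_mult)
  next
    fix c assume "c \<in> cone_coords (1/2) ` ball 0 (1/2)"
    then obtain z where z: "norm z < 1/2" "c = cone_coords (1/2) z" by auto
    obtain j where j: "j < k" "\<And>\<sigma>. \<sigma> = 1 \<or> \<sigma> = -1 \<Longrightarrow>
        \<exists>x y. 0 \<le> y \<and> \<bar>x\<bar> + 2 * y < 1/2 \<and> sector_coords k j \<sigma> (x, y) = cone_coords (1/2) z"
      using sector_coords_surj[OF k_pos z(1)] by blast
    then obtain x y where "0 \<le> y" "\<bar>x\<bar> + 2 * y < 1/2" "sector_coords k j (\<sigma> j) (x, y) = c"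
      using sign[OF j(1)] z by metis
    then obtain p where "p \<in> topspace (surface M)" "f p = c" using pt[OF j(1)] by metis
    moreover have "0 < snd c" using z by (simp add: cone_coords_def)
    ultimately show "c \<in> f ` {p \<in> topspace (surface M). snd (f p) > 0}" by blast
  qed
  then have "disk_chart (surface M) (1/2) f"
    unfolding disk_chart_def using cont inj by blast
  moreover have "0 < snd (f (rim M (W j) (a j + x)))" if "j < k" "\<bar>x\<bar> < 1/2" for j x
    using pt[of j 0 x] that by (auto simp: rim_def sector_coords_def Let_def)
  ultimately show ?thesis by blast
qed

end

section \<open>Maps are closed surfaces\<close>

lemma inj_on_Suc_mod: "j < k \<Longrightarrow> l < k \<Longrightarrow> Suc l mod k = Suc j mod k \<Longrightarrow> l = j"
  by (auto simp: mod_Suc split: if_splits)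

text \<open>The combinatorial form of being a surface: every edge has two sides, and the link of
  every vertex is a single circle. Corner \<open>j\<close> is the passage of \<open>W j\<close>
  after its arc number \<open>I j\<close>, between the arcs \<open>S j\<close> and
  \<open>S (Suc j mod k)\<close>; the disjunction leaves the direction of travel open, since the
  faces carry no consistent orientation.\<close>

locale polygonal_map = cell_complex M for M :: "('v, 'd, 'z) premap_scheme" +
  assumes edge_in_two_faces: "s \<in> arcs M \<Longrightarrow> \<exists>w0 i0 w1 i1. w0 \<in> faces M \<and> w1 \<in> faces M \<and> w0 \<noteq> w1 \<and>
      i0 < length w0 \<and> i1 < length w1 \<and> w0 ! i0 \<in> {s, ainv M s} \<and> w1 ! i1 \<in> {s, ainv M s} \<and>
      (\<forall>w\<in>faces M. \<forall>i<length w. w ! i \<in> {s, ainv M s} \<longrightarrow> w = w0 \<and> i = i0 \<or> w = w1 \<and> i = i1)"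
    and corners_cyclic: "v \<in> nodes M \<Longrightarrow> \<exists>k S W I. 0 < k \<and> inj_on S {..<k} \<and> inj_on (\<lambda>j. (W j, I j)) {..<k} \<and>
      (\<forall>j<k. W j \<in> faces M \<and> I j < length (W j) \<and> S j \<in> arcs M \<and> tail M (S j) = v \<and>
         (ainv M (W j ! I j) = S j \<and> W j ! (Suc (I j) mod length (W j)) = S (Suc j mod k) \<or>
          ainv M (W j ! I j) = S (Suc j mod k) \<and> W j ! (Suc (I j) mod length (W j)) = S j)) \<and>
      (\<forall>w\<in>faces M. \<forall>i<length w. tail M (ainv M (w ! i)) = v \<longrightarrow> (\<exists>j<k. w = W j \<and> i = I j))"
begin

text \<open>The cone function is 0 on the boundary circle, so its extension by 0 to the other faces
  respects every identification.\<close>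

lemma face_chart:
  assumes w: "w \<in> faces M" and z: "norm z < 1"
  shows "\<exists>c f. disk_chart (surface M) c f \<and> 0 < snd (f (disk_map M w z))"
proof -
  define F where "F w' z = (if w' = w then cone_coords 1 z else 0)" for w' z
  have F1: "F w' z = 0" if "norm z = 1" for w' z
    using that by (simp add: F_def cone_coords_def zero_prod_def)
  then have "\<exists>f. \<forall>w\<in>faces M. \<forall>z\<in>cball 0 1. f (disk_map M w z) = F w z"
    by (intro function_on_surface) simp
  then obtain f where f: "\<And>w z. w \<in> faces M \<Longrightarrow> z \<in> cball 0 1 \<Longrightarrow> f (disk_map M w z) = F w z" by blast
  have cont: "continuous_map (surface M) euclidean f"
  proof (rule continuous_map_from_surface)
    fix w' assume w': "w' \<in> faces M"
    have "continuous_on (cball 0 1) (F w')"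
      unfolding F_def cone_coords_def by (cases "w' = w") (auto intro!: continuous_intros)
    then have "continuous_on (cball 0 1) (\<lambda>z. f (disk_map M w' z))"
      using f[OF w'] continuous_on_cong by (metis (no_types, lifting))
    then show "continuous_map (top_of_set (cball 0 1)) euclidean (\<lambda>z. f (disk_map M w' z))" by simp
  qed
  have pos: "\<exists>z. norm z < 1 \<and> p = disk_map M w z \<and> f p = cone_coords 1 z"
    if "p \<in> topspace (surface M)" "0 < snd (f p)" for p
  proof -
    from that(1) obtain w' z where "w' \<in> faces M" "z \<in> cball 0 1" "p = disk_map M w' z" by (rule disk_map_surj)
    then show ?thesis using that(2) f[of w' z] by (auto simp: F_def cone_coords_def split: if_splits)
  qed
  have cone_inj: "z = z'" if "norm z < 1" "cone_coords 1 z = cone_coords 1 z'" for z z'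
  proof -
    have "norm z = norm z'" using that by (simp add: cone_coords_def)
    then have "of_real (1 - norm z) * z = of_real (1 - norm z) * z'" using that by (simp add: cone_coords_def)
    moreover have "complex_of_real (1 - norm z) \<noteq> 0" using that(1) by (simp only: of_real_eq_0_iff)
    ultimately show ?thesis by (metis mult_left_cancel)
  qed
  have inj: "p = q" if "p \<in> topspace (surface M)" "q \<in> topspace (surface M)" "0 < snd (f p)" "f p = f q" for p q
    using pos[OF that(1,3)] pos[OF that(2)] that cone_inj by metis
  have "f ` {p \<in> topspace (surface M). snd (f p) > 0} = cone_coords 1 ` ball 0 1"
  proof (intro equalityI subsetI)
    fix c assume "c \<in> f ` {p \<in> topspace (surface M). snd (f p) > 0}"
    then show "c \<in> cone_coords 1 ` ball 0 1" using pos by fastforce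
  next
    fix c assume "c \<in> cone_coords 1 ` ball 0 1"
    then obtain z where z: "norm z < 1" "c = cone_coords 1 z" by auto
    then have "f (disk_map M w z) = c" "0 < snd c" using f[OF w, of z] by (auto simp: F_def cone_coords_def)
    moreover have "disk_map M w z \<in> topspace (surface M)"
      using disk_map_in_surface_points[OF w, of z] z by (simp add: topspace_surface)
    ultimately show "c \<in> f ` {p \<in> topspace (surface M). snd (f p) > 0}" by blast
  qed
  then have "disk_chart (surface M) 1 f" unfolding disk_chart_def using cont inj by blast
  moreover have "0 < snd (f (disk_map M w z))" using f[OF w, of z] z by (simp add: F_def cone_coords_def)
  ultimately show ?thesis by blast
qed

lemma edge_chart:
  assumes s: "s \<in> arcs M" and t: "0 < t" "t < 1"
  shows "\<exists>c f. disk_chart (surface M) c f \<and> 0 < snd (f (edge_curve M s t))"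
proof -
  obtain w0 i0 w1 i1 where w01: "w0 \<in> faces M" "w1 \<in> faces M" "w0 \<noteq> w1" "i0 < length w0" "i1 < length w1"
      "w0 ! i0 \<in> {s, ainv M s}" "w1 ! i1 \<in> {s, ainv M s}"
    and only01: "\<And>w i. w \<in> faces M \<Longrightarrow> i < length w \<Longrightarrow> w ! i \<in> {s, ainv M s} \<Longrightarrow> w = w0 \<and> i = i0 \<or> w = w1 \<and> i = i1"
    using edge_in_two_faces[OF s] by metis
  define W where "W j = (if j = (0::nat) then w0 else w1)" for j
  define I where "I j = (if j = (0::nat) then i0 else i1)" for j
  \<comment> \<open>Position \<open>I j + 1/2\<close> is the midpoint of the edge on the rim of
    \<open>W j\<close>.\<close>
  define a where "a j = real (I j) + 1/2" for j
  define \<delta> :: "nat \<Rightarrow> real" where "\<delta> j = (if W j ! I j = s then 1 else -1)" for j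
  \<comment> \<open>\<open>\<delta> j\<close> is the direction of face \<open>j\<close> relative to
    \<open>s\<close>. The first half-disk is left towards the end of \<open>s\<close> and the second
    towards its start, so the second sign is reversed.\<close>
  define \<sigma> :: "nat \<Rightarrow> real" where "\<sigma> j = (if j = 0 then \<delta> j else - \<delta> j)" for j
  have WI: "W j \<in> faces M" "I j < length (W j)" "W j ! I j \<in> {s, ainv M s}" for j
    using w01 by (auto simp: W_def I_def)
  have curve: "rim M (W j) (a j + \<delta> j * u) = edge_curve M s (1/2 + u)" if u: "\<bar>u\<bar> \<le> 1/2" for j u
  proof (cases "W j ! I j = s")
    case True
    then show ?thesis
      using rim_edge[OF WI(1), of "1/2 + u" j "int (I j)"] u cyclic_nth_nat[OF WI(2)[of j]]
      by (simp add: a_def \<delta>_def algebra_simps abs_le_iff)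
  next
    case False
    then have "W j ! I j = ainv M s" using WI(3)[of j] by simp
    then have "ainv M (cyclic_nth (W j) (int (I j))) = s" using cyclic_nth_nat[OF WI(2)[of j]] ainv_arc(2)[OF s] by simp
    then show ?thesis
      using rim_edge_rev[OF WI(1), of "1/2 + u" j "int (I j)"] u False
      by (simp add: a_def \<delta>_def algebra_simps abs_le_iff)
  qed
  have dsign: "\<delta> j = 1 \<or> \<delta> j = -1" for j by (simp add: \<delta>_def)
  interpret star M 2 W a \<sigma>
  proof unfold_locales
    show "W j \<in> faces M" for j by (rule WI)
    show "\<sigma> j = 1 \<or> \<sigma> j = -1" for j by (auto simp: \<sigma>_def \<delta>_def)
    show "1 \<le> \<bar>a j - a j' - of_int n * real (length (W j))\<bar>"
      if "j < 2" "j' < 2" "W j = W j'" "j \<noteq> j'" for j j' :: nat and n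
      using that w01(3) by (auto simp: W_def split: if_splits)
    show "rim M (W j) (a j + \<sigma> j * t) = rim M (W (Suc j mod 2)) (a (Suc j mod 2) - \<sigma> (Suc j mod 2) * t)"
      if "j < 2" "0 \<le> t" "t \<le> 1/2" for j t
    proof -
      have "j = 0 \<or> j = 1" using that by auto
      then show ?thesis using curve[of t 0] curve[of t 1] curve[of "-t" 0] curve[of "-t" 1] that
        by (auto simp: \<sigma>_def)
    qed
    show "\<exists>i<2. W i = w \<and> (\<exists>n::int.
             b = a i + \<sigma> i * t + of_int n * real (length w) \<and> (t = 0 \<or> i = j) \<or>
             b = a i + - \<sigma> i * t + of_int n * real (length w) \<and> (t = 0 \<or> i = Suc j mod 2))"
      if j: "j < 2" and t: "0 \<le> t" "t < 1/2" and w: "w \<in> faces M"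
        and eq: "rim M (W j) (a j + \<sigma> j * t) = rim M w b" for j t w b
    proof -
      \<comment> \<open>Signed displacement from the midpoint along \<open>s\<close>: spoke 0 points
        forwards and spoke 1 backwards.\<close>
      define \<tau> where "\<tau> = (if j = 0 then t else - t)"
      have "\<sigma> j * t = \<delta> j * \<tau>" by (simp add: \<tau>_def \<sigma>_def)
      then have e1: "rim M w b = edge_curve M s (1/2 + \<tau>)" using curve[of \<tau> j] eq t by (simp add: \<tau>_def)
      obtain i' t' where b: "b = of_int i' + t'" "0 \<le> t'" "t' < 1" by (rule real_eq_int_plus_frac)
      define l where "l = nat (i' mod int (length w))"
      have l: "l < length w" using face_nonempty[OF w] by (simp add: l_def nat_less_iff)
      have i': "real_of_int i' = real l + of_int (i' div int (length w)) * real (length w)"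
      proof -
        have "i' = int l + (i' div int (length w)) * int (length w)" using face_nonempty[OF w] by (simp add: l_def)
        then have "real_of_int i' = of_int (int l + (i' div int (length w)) * int (length w))" by simp
        then show ?thesis by simp
      qed
      have "edge_curve M s (1/2 + \<tau>) = edge_curve M (w ! l) t'"
        using e1 rim_edge[OF w, of t' i'] b by (simp add: cyclic_nth_def l_def)
      moreover have "w ! l \<in> arcs M" using face_arcs[OF w] l by auto
      ultimately have wl: "w ! l = s \<and> t' = 1/2 + \<tau> \<or> w ! l = ainv M s \<and> t' = 1 - (1/2 + \<tau>)"
        using edge_curve_eq_interior[of "1/2 + \<tau>" M s "w ! l" t'] arc_graph s b t by (auto simp: \<tau>_def split: if_splits)
      then have "w = w0 \<and> l = i0 \<or> w = w1 \<and> l = i1" using only01[OF w l] by auto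
      then have "w = W 0 \<and> l = I 0 \<or> w = W 1 \<and> l = I 1" by (simp add: W_def I_def)
      then have "\<exists>i<2. w = W i \<and> l = I i"
        by (elim disjE) (rule exI[of _ 0], simp, rule exI[of _ 1], simp)
      then obtain i where i: "i < 2" "w = W i" "l = I i" by blast
      have "t' = 1/2 + \<delta> i * \<tau>" using wl i ainv_arc(4)[OF s] by (auto simp: \<delta>_def)
      then have bb: "b = a i + \<delta> i * \<tau> + of_int (i' div int (length w)) * real (length w)"
        using b i' i by (simp add: a_def)
      have "i = 0 \<or> i = 1" "j = 0 \<or> j = 1" using i j by auto
      then have "\<delta> i * \<tau> = \<sigma> i * t \<and> i = j \<or> \<delta> i * \<tau> = - \<sigma> i * t \<and> i = Suc j mod 2"
        by (auto simp: \<sigma>_def \<tau>_def)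
      then show ?thesis using bb i by metis
    qed
  qed simp
  obtain f where f: "disk_chart (surface M) (1/2) f"
    "\<forall>j<2. \<forall>x. \<bar>x\<bar> < 1/2 \<longrightarrow> 0 < snd (f (rim M (W j) (a j + x)))"
    using star_chart by blast
  define u where "u = t - 1/2"
  have u: "\<bar>u\<bar> < 1/2" "edge_curve M s (1/2 + u) = edge_curve M s t" using t by (auto simp: u_def abs_if)
  then have "\<bar>\<delta> 0 * u\<bar> < 1/2" using dsign[of 0] by auto
  then have "0 < snd (f (edge_curve M s t))" using f(2)[rule_format, of 0 "\<delta> 0 * u"] curve[of u 0] u by simp
  then show ?thesis using f(1) by blast
qed

lemma vertex_chart:
  assumes v: "v \<in> nodes M"
  shows "\<exists>c f. disk_chart (surface M) c f \<and> 0 < snd (f (VPt v))"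
proof -
  from corners_cyclic[OF v] obtain k S W I where k: "0 < k"
    and injS: "inj_on S {..<k}" and injWI: "inj_on (\<lambda>j. (W j, I j)) {..<k}"
    and corners: "\<forall>j<k. W j \<in> faces M \<and> I j < length (W j) \<and> S j \<in> arcs M \<and> tail M (S j) = v \<and>
         (ainv M (W j ! I j) = S j \<and> W j ! (Suc (I j) mod length (W j)) = S (Suc j mod k) \<or>
          ainv M (W j ! I j) = S (Suc j mod k) \<and> W j ! (Suc (I j) mod length (W j)) = S j)"
    and all: "\<forall>w\<in>faces M. \<forall>i<length w. tail M (ainv M (w ! i)) = v \<longrightarrow> (\<exists>j<k. w = W j \<and> i = I j)"
    by (elim exE conjE)
  note cor = corners[rule_format]
  \<comment> \<open>The corner comes at the end of arc number \<open>I j\<close>, that is, at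
    position \<open>I j + 1\<close>.\<close>
  define a where "a j = real (I j) + 1" for j
  \<comment> \<open>Sign 1 means that \<open>W j\<close> enters the corner along the inverse of
    \<open>S j\<close> and leaves along \<open>S (Suc j mod k)\<close>; sign -1 stands for the
    opposite direction of travel.\<close>
  define \<sigma> :: "nat \<Rightarrow> real" where
    "\<sigma> j = (if ainv M (W j ! I j) = S j \<and> W j ! (Suc (I j) mod length (W j)) = S (Suc j mod k) then 1 else -1)" for j
  have out: "rim M (W j) (a j + t) = edge_curve M (W j ! (Suc (I j) mod length (W j))) t"
    and inn: "rim M (W j) (a j + - t) = edge_curve M (ainv M (W j ! I j)) t"
    if "j < k" "0 \<le> t" "t \<le> 1/2" for j t
    using that rim_edge[of "W j" t "int (I j) + 1"] rim_edge_rev[of "W j" t "int (I j)"] cor[OF that(1)]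
      cyclic_nth_nat[of "I j" "W j"] cyclic_nth_Suc[of "I j" "W j"] by (auto simp: a_def)
  have plus: "rim M (W j) (a j + \<sigma> j * t) = edge_curve M (S (Suc j mod k)) t"
    and minus: "rim M (W j) (a j - \<sigma> j * t) = edge_curve M (S j) t"
    if "j < k" "0 \<le> t" "t \<le> 1/2" for j t
    using out[OF that] inn[OF that] cor[OF that(1)] by (auto simp: \<sigma>_def)
  have Suck: "Suc j mod k < k" for j using k by simp
  interpret star M k W a \<sigma>
  proof unfold_locales
    show "0 < k" by (rule k)
    show "W j \<in> faces M" if "j < k" for j using cor that by blast
    show "\<sigma> j = 1 \<or> \<sigma> j = -1" for j by (simp add: \<sigma>_def)
    show "1 \<le> \<bar>a j - a j' - of_int n * real (length (W j))\<bar>"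
      if j: "j < k" "j' < k" "W j = W j'" "j \<noteq> j'" for j j' n
    proof -
      have "I j \<noteq> I j'" using injWI j by (auto simp: inj_on_def)
      moreover have "I j < length (W j)" "I j' < length (W j)" using cor j by metis+
      ultimately have "int (I j) mod int (length (W j)) \<noteq> int (I j') mod int (length (W j))" by simp
      then have "int (I j) \<noteq> int (I j') + n * int (length (W j))" by (metis mod_mult_self1)
      then have "1 \<le> \<bar>int (I j) - int (I j') - n * int (length (W j))\<bar>" by linarith
      then have "real_of_int 1 \<le> of_int \<bar>int (I j) - int (I j') - n * int (length (W j))\<bar>" by (rule of_int_le_iff[THEN iffD2])
      then show ?thesis by (simp add: a_def)
    qed
    show "rim M (W j) (a j + \<sigma> j * t) = rim M (W (Suc j mod k)) (a (Suc j mod k) - \<sigma> (Suc j mod k) * t)"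
      if "j < k" "0 \<le> t" "t \<le> 1/2" for j t
      using plus[OF that] minus[OF Suck that(2,3)] by simp
    show "\<exists>i<k. W i = w \<and> (\<exists>n::int.
             b = a i + \<sigma> i * t + of_int n * real (length w) \<and> (t = 0 \<or> i = j) \<or>
             b = a i + - \<sigma> i * t + of_int n * real (length w) \<and> (t = 0 \<or> i = Suc j mod k))"
      if j: "j < k" and t: "0 \<le> t" "t < 1/2" and w: "w \<in> faces M"
        and eq: "rim M (W j) (a j + \<sigma> j * t) = rim M w b" for j t w b
    proof -
      let ?m = "int (length w)"
      let ?s = "S (Suc j mod k)"
      have s: "?s \<in> arcs M" "tail M ?s = v" using cor[OF Suck] by blast+
      obtain i' t' where b: "b = of_int i' + t'" "0 \<le> t'" "t' < 1" by (rule real_eq_int_plus_frac)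
      \<comment> \<open>Every passage of \<open>w\<close> through \<open>v\<close> is a listed
        corner, up to a multiple of the length.\<close>
      have corner: "\<exists>l<k. W l = w \<and> q = int (I l) + (q div ?m) * ?m \<and>
          ainv M (W l ! I l) = ainv M (cyclic_nth w q) \<and> W l ! (Suc (I l) mod length (W l)) = cyclic_nth w (q + 1)"
        if q: "tail M (ainv M (cyclic_nth w q)) = v" for q
      proof -
        define p where "p = nat (q mod ?m)"
        have p: "p < length w" using face_nonempty[OF w] by (simp add: p_def nat_less_iff)
        have pq: "cyclic_nth w q = w ! p" by (simp add: cyclic_nth_def p_def)
        then obtain l where l: "l < k" "w = W l" "p = I l" using all[rule_format, OF w p] q by auto
        have "int p = q mod ?m" using face_nonempty[OF w] by (simp add: p_def)
        then have "q = int (I l) + (q div ?m) * ?m" using l by simp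
        moreover have "cyclic_nth w (q + 1) = w ! (Suc p mod length w)"
        proof -
          have "cyclic_nth w (q + 1) = cyclic_nth w (int p + 1)"
            using \<open>int p = q mod ?m\<close> by (simp add: cyclic_nth_def mod_simps)
          then show ?thesis using cyclic_nth_Suc[OF p] by simp
        qed
        ultimately show ?thesis using l pq by (intro exI[of _ l]) auto
      qed
      have walk: "tail M (ainv M (cyclic_nth w (i' - 1))) = tail M (cyclic_nth w i')"
        using rim_edge[OF w, of 1 "i' - 1"] rim_edge[OF w, of 0 i'] by (simp add: edge_curve_def)
      have e: "edge_curve M ?s t = edge_curve M (cyclic_nth w i') t'"
        using plus[OF j] t eq rim_edge[OF w, of t' i'] b by simp
      have si: "cyclic_nth w i' \<in> arcs M" by (rule cyclic_nth_arc[OF w])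
      \<comment> \<open>The point is \<open>v\<close> itself, or lies inside an edge that
        \<open>w\<close> follows away from \<open>v\<close> or towards \<open>v\<close>. The corner
        in question is the start of arc \<open>i'\<close> in the first two cases, hence the index
        \<open>i' - 1\<close> below, and its end in the third.\<close>
      consider (zero) "t = 0" "t' = 0" "tail M (cyclic_nth w i') = v"
        | (out) "0 < t" "cyclic_nth w i' = ?s" "t' = t"
        | (inn) "0 < t" "cyclic_nth w i' = ainv M ?s" "t' = 1 - t"
      proof (cases "t = 0")
        case True
        then have "edge_curve M (cyclic_nth w i') t' = VPt v" using e s by (simp add: edge_curve_def)
        then show ?thesis using edge_curve_eq_VPt b True zero by (metis less_irrefl less_imp_le)
      next
        case False
        then show ?thesis
          using edge_curve_eq_interior[of t M ?s "cyclic_nth w i'" t'] e t b arc_graph s si out inn by auto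
      qed
      then show ?thesis
      proof cases
        case zero
        then obtain l where l: "l < k" "W l = w" "i' - 1 = int (I l) + ((i' - 1) div ?m) * ?m"
          using corner[of "i' - 1"] walk by auto
        then have "real_of_int (i' - 1) = of_int (int (I l) + ((i' - 1) div ?m) * ?m)" by simp
        then have "b = a l + \<sigma> l * t + of_int ((i' - 1) div ?m) * real (length w)"
          using b zero by (simp add: a_def)
        then show ?thesis using l zero by blast
      next
        case out
        then obtain l where l: "l < k" "W l = w" "i' - 1 = int (I l) + ((i' - 1) div ?m) * ?m"
            "W l ! (Suc (I l) mod length (W l)) = ?s"
          using corner[of "i' - 1"] walk s by auto
        then have "real_of_int (i' - 1) = of_int (int (I l) + ((i' - 1) div ?m) * ?m)" by simp
        then have bb: "b = a l + t + of_int ((i' - 1) div ?m) * real (length w)"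
          using b out by (simp add: a_def)
        show ?thesis
        proof (cases "\<sigma> l = 1")
          case True
          then have "S (Suc l mod k) = ?s" using l(4) by (simp add: \<sigma>_def split: if_splits)
          then have "l = j" using injS Suck inj_on_Suc_mod[OF j l(1)] by (auto simp: inj_on_def)
          then show ?thesis using bb l True by (intro exI[of _ l]) auto
        next
          case False
          then have "S l = ?s" "\<sigma> l = -1" using l(4) cor[OF l(1)] by (auto simp: \<sigma>_def split: if_splits)
          then have "l = Suc j mod k" using injS Suck l(1) by (auto simp: inj_on_def)
          then show ?thesis using bb l \<open>\<sigma> l = -1\<close> by (intro exI[of _ l]) auto
        qed
      next
        case inn
        then have "ainv M (cyclic_nth w i') = ?s" using ainv_arc(2)[OF s(1)] by simp
        then obtain l where l: "l < k" "W l = w" "i' = int (I l) + (i' div ?m) * ?m" "ainv M (W l ! I l) = ?s"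
          using corner[of i'] s by auto
        then have "real_of_int i' = of_int (int (I l) + (i' div ?m) * ?m)" by simp
        then have bb: "b = a l + - t + of_int (i' div ?m) * real (length w)"
          using b inn by (simp add: a_def)
        show ?thesis
        proof (cases "\<sigma> l = 1")
          case True
          then have "S l = ?s" using l(4) by (simp add: \<sigma>_def split: if_splits)
          then have "l = Suc j mod k" using injS Suck l(1) by (auto simp: inj_on_def)
          then show ?thesis using bb l True by (intro exI[of _ l]) auto
        next
          case False
          then have "S (Suc l mod k) = ?s" "\<sigma> l = -1" using l(4) cor[OF l(1)] by (auto simp: \<sigma>_def split: if_splits)
          then have "l = j" using injS Suck inj_on_Suc_mod[OF j l(1)] by (auto simp: inj_on_def)
          then show ?thesis using bb l \<open>\<sigma> l = -1\<close> by (intro exI[of _ l]) auto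
        qed
      qed
    qed
  qed
  obtain f where f: "disk_chart (surface M) (1/2) f"
    "\<forall>j<k. \<forall>x. \<bar>x\<bar> < 1/2 \<longrightarrow> 0 < snd (f (rim M (W j) (a j + x)))"
    using star_chart by blast
  have "rim M (W 0) (a 0 + 0) = VPt v" using minus[OF k, of 0] cor[OF k] by (simp add: edge_curve_def)
  then have "0 < snd (f (VPt v))" using f(2)[rule_format, OF k, of 0] by simp
  then show ?thesis using f(1) by blast
qed

theorem closed_surface_surface:
  assumes "connected_arc_graph M"
  shows "closed_surface (surface M)"
proof (rule closed_surface_if_disk_charts)
  fix p assume "p \<in> topspace (surface M)"
  then consider (v) v where "v \<in> nodes M" "p = VPt v" | (e) s t where "s \<in> arcs M" "0 < t" "t < 1" "p = edge_curve M s t"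
    | (f) w z where "w \<in> faces M" "norm z < 1" "p = disk_map M w z"
    by (auto simp: topspace_surface surface_points_def vertex_points_def edge_points_def open_face_def disk_map_def)
  then show "\<exists>c f. disk_chart (surface M) c f \<and> 0 < snd (f p)"
    using vertex_chart edge_chart face_chart by cases auto
qed (use compact_surface connected_surface assms in auto)

end

section \<open>Automorphisms\<close>

context polygonal_map
begin

lemma edge_curve_eq_iff:
  assumes "s \<in> arcs M" "s' \<in> arcs M" "0 \<le> t" "t < 1" "0 \<le> t'" "t' < 1"
  shows "edge_curve M s t = edge_curve M s' t' \<longleftrightarrow>
    t = 0 \<and> t' = 0 \<and> tail M s = tail M s' \<or> 0 < t \<and> (s' = s \<and> t' = t \<or> s' = ainv M s \<and> t' = 1 - t)"
proof (cases "t = 0")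
  case True
  then show ?thesis using assms by (auto simp: edge_curve_def)
next
  case False
  then have "0 < t" using assms by simp
  then show ?thesis
    using edge_curve_eq_interior[of t M s s' t'] edge_curve_ainv[OF arc_graph assms(1), of t] arc_graph assms by auto
qed

lemma finite_arcs: "finite (arcs M)"
proof -
  have "arcs M \<subseteq> (\<Union>w\<in>faces M. set w \<union> ainv M ` set w)"
  proof
    fix s assume s: "s \<in> arcs M"
    then obtain w where "w \<in> faces M" "s \<in> set w \<or> ainv M s \<in> set w" using arc_in_face by blast
    moreover have "s = ainv M (ainv M s)" using ainv_arc(2)[OF s] by simp
    ultimately show "s \<in> (\<Union>w\<in>faces M. set w \<union> ainv M ` set w)" by blast
  qed
  moreover have "finite (\<Union>w\<in>faces M. set w \<union> ainv M ` set w)" using finite_faces by simp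
  ultimately show ?thesis by (rule finite_subset)
qed

text \<open>Each disk is mapped by a rotation or a reflection onto the disk of its image face. Arcs
  go to arcs with the parameter preserved, so these maps agree on common edges and glue to a
  continuous bijection of a compact Hausdorff space. \<open>turn\<close> asks only that the image
  walk agrees with the given one up to rotation or reversal.\<close>

lemma map_automorphism_of_arc_permutation:
  assumes conn: "connected_arc_graph M"
    and bij: "bij_betw f (arcs M) (arcs M)"
    and inv: "\<And>s. s \<in> arcs M \<Longrightarrow> f (ainv M s) = ainv M (f s)"
    and tails: "\<And>s t. s \<in> arcs M \<Longrightarrow> t \<in> arcs M \<Longrightarrow> tail M (f s) = tail M (f t) \<longleftrightarrow> tail M s = tail M t"
    and T: "\<And>w. w \<in> faces M \<Longrightarrow> T w \<in> faces M" and injT: "inj_on T (faces M)"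
    and len: "\<And>w. w \<in> faces M \<Longrightarrow> length (T w) = length w"
    and turn: "\<And>w. w \<in> faces M \<Longrightarrow> (\<exists>r. \<forall>i. cyclic_nth (T w) (i + r) = f (cyclic_nth w i)) \<or>
                 (\<exists>r. \<forall>i. cyclic_nth (T w) (r - i) = ainv M (f (cyclic_nth w i)))"
  obtains \<pi> where "map_automorphism M \<pi>" "\<And>s w. (s, w) \<in> flags M \<Longrightarrow> \<pi> (s, w) = (f s, T w)"
proof -
  have fa: "f s \<in> arcs M" if "s \<in> arcs M" for s using bij that by (auto simp: bij_betw_def)
  have finj: "f s = f t \<longleftrightarrow> s = t" if "s \<in> arcs M" "t \<in> arcs M" for s t
    using bij that by (auto simp: bij_betw_def inj_on_def)
  have ec_iff: "edge_curve M (f s) t = edge_curve M (f s') t' \<longleftrightarrow> edge_curve M s t = edge_curve M s' t'"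
    if "s \<in> arcs M" "s' \<in> arcs M" "0 \<le> t" "t < 1" "0 \<le> t'" "t' < 1" for s s' t t'
    unfolding edge_curve_eq_iff[OF that] edge_curve_eq_iff[OF fa[OF that(1)] fa[OF that(2)] that(3-6)]
    using that tails finj ainv_arc(1)[OF that(1)] inv[OF that(1), symmetric] by auto
  have "\<exists>\<rho>. (\<forall>z. norm (\<rho> z) = norm z) \<and> continuous_on UNIV \<rho> \<and> inj \<rho> \<and> surj \<rho> \<and>
      (\<forall>i t. 0 \<le> t \<longrightarrow> t \<le> 1 \<longrightarrow> disk_map M (T w) (\<rho> (cis (rim_angle w (of_int i + t)))) = edge_curve M (f (cyclic_nth w i)) t)"
    if w: "w \<in> faces M" for w
    using turn[OF w]
  proof
    assume "\<exists>r. \<forall>i. cyclic_nth (T w) (i + r) = f (cyclic_nth w i)"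
    then obtain r where r: "\<And>i. cyclic_nth (T w) (i + r) = f (cyclic_nth w i)" by blast
    define u where "u = cis (rim_angle w (of_int r))"
    have u: "norm u = 1" "u \<noteq> 0" by (auto simp: u_def)
    have "surj (\<lambda>z. z * u)" using u by (auto intro!: surjI[of _ "\<lambda>z. z / u"])
    moreover have "disk_map M (T w) (cis (rim_angle w (of_int i + t)) * u) = edge_curve M (f (cyclic_nth w i)) t"
      if "0 \<le> t" "t \<le> 1" for i t
    proof -
      have "cis (rim_angle w (of_int i + t)) * u = cis (rim_angle (T w) (of_int (i + r) + t))"
        using len[OF w] by (simp add: u_def cis_mult rim_angle_def add_divide_distrib algebra_simps)
      then show ?thesis using rim_edge[OF T[OF w] that, of "i + r"] r[of i] by (simp add: rim_def)
    qed
    ultimately show ?thesis using u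
      by (intro exI[of _ "\<lambda>z. z * u"]) (auto simp: norm_mult inj_on_def intro!: continuous_intros)
  next
    assume "\<exists>r. \<forall>i. cyclic_nth (T w) (r - i) = ainv M (f (cyclic_nth w i))"
    then obtain r where r: "\<And>i. cyclic_nth (T w) (r - i) = ainv M (f (cyclic_nth w i))" by blast
    \<comment> \<open>The reflection sends position \<open>p\<close> to \<open>r + 1 - p\<close>.
      Arc \<open>i\<close> occupies the positions from \<open>i\<close> to \<open>i + 1\<close>, so
      its image occupies those from \<open>r - i\<close> to \<open>r - i + 1\<close>; hence the
      \<open>+ 1\<close>.\<close>
    define u where "u = cis (rim_angle w (of_int r + 1))"
    have u: "norm u = 1" "u \<noteq> 0" by (auto simp: u_def)
    have "surj (\<lambda>z. cnj z * u)" using u by (auto intro!: surjI[of _ "\<lambda>z. cnj (z / u)"])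
    moreover have "disk_map M (T w) (cnj (cis (rim_angle w (of_int i + t))) * u) = edge_curve M (f (cyclic_nth w i)) t"
      if "0 \<le> t" "t \<le> 1" for i t
    proof -
      have "cnj (cis (rim_angle w (of_int i + t))) * u = cis (rim_angle (T w) (of_int (r - i) + 1 - t))"
        using len[OF w] by (simp add: u_def cis_cnj cis_mult rim_angle_def add_divide_distrib diff_divide_distrib algebra_simps)
      moreover have "ainv M (cyclic_nth (T w) (r - i)) = f (cyclic_nth w i)"
        using r[of i] ainv_arc(2)[OF fa[OF cyclic_nth_arc[OF w]]] by simp
      ultimately show ?thesis using rim_edge_rev[OF T[OF w] that, of "r - i"] by (simp add: rim_def)
    qed
    ultimately show ?thesis using u
      by (intro exI[of _ "\<lambda>z. cnj z * u"]) (auto simp: norm_mult inj_on_def intro!: continuous_intros)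
  qed
  then obtain \<rho> where \<rho>: "\<And>w. w \<in> faces M \<Longrightarrow> (\<forall>z. norm (\<rho> w z) = norm z) \<and> continuous_on UNIV (\<rho> w) \<and> inj (\<rho> w) \<and> surj (\<rho> w) \<and>
      (\<forall>i t. 0 \<le> t \<longrightarrow> t \<le> 1 \<longrightarrow> disk_map M (T w) (\<rho> w (cis (rim_angle w (of_int i + t)))) = edge_curve M (f (cyclic_nth w i)) t)"
    by metis
  have norm\<rho>: "norm (\<rho> w z) = norm z" and inj\<rho>: "inj (\<rho> w)" and surj\<rho>: "surj (\<rho> w)" and cont\<rho>: "continuous_on UNIV (\<rho> w)"
    if "w \<in> faces M" for w z using \<rho>[OF that] by blast+
  have rim\<rho>: "disk_map M (T w) (\<rho> w (cis (rim_angle w (of_int i + t)))) = edge_curve M (f (cyclic_nth w i)) t"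
    if "w \<in> faces M" "0 \<le> t" "t \<le> 1" for w i t using \<rho>[OF that(1)] that by blast
  have "\<exists>h. \<forall>w\<in>faces M. \<forall>z\<in>cball 0 1. h (disk_map M w z) = disk_map M (T w) (\<rho> w z)"
  proof (rule function_on_surface)
    fix w i w' i' and t t' :: real
    assume *: "w \<in> faces M" "w' \<in> faces M" "0 \<le> t" "t < 1" "0 \<le> t'" "t' < 1"
      "edge_curve M (cyclic_nth w i) t = edge_curve M (cyclic_nth w' i') t'"
    then show "disk_map M (T w) (\<rho> w (cis (rim_angle w (of_int i + t)))) = disk_map M (T w') (\<rho> w' (cis (rim_angle w' (of_int i' + t'))))"
      using rim\<rho>[of w t i] rim\<rho>[of w' t' i'] ec_iff[OF cyclic_nth_arc cyclic_nth_arc] by auto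
  qed
  then obtain h where h: "\<And>w z. w \<in> faces M \<Longrightarrow> z \<in> cball 0 1 \<Longrightarrow> h (disk_map M w z) = disk_map M (T w) (\<rho> w z)" by blast
  \<comment> \<open>The parameter is unchanged, so the identity will serve as the reparametrisation
    in \<open>maps_arc\<close>.\<close>
  have hedge: "h (edge_curve M s t) = edge_curve M (f s) t" if s: "s \<in> arcs M" and t: "0 \<le> t" "t \<le> 1" for s t
  proof -
    have *: "h (edge_curve M (cyclic_nth w i) t) = edge_curve M (f (cyclic_nth w i)) t"
      if w: "w \<in> faces M" "0 \<le> t" "t \<le> 1" for w i t
      using h[OF w(1), of "cis (rim_angle w (of_int i + t))"] rim\<rho>[OF w, of i] rim_edge[OF w, of i] by (simp add: rim_def)
    obtain w where w: "w \<in> faces M" "s \<in> set w \<or> ainv M s \<in> set w" using arc_in_face s by blast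
    then obtain i where "i < length w" "w ! i = s \<or> w ! i = ainv M s" by (metis in_set_conv_nth)
    then have "cyclic_nth w (int i) = s \<or> cyclic_nth w (int i) = ainv M s" by (simp add: cyclic_nth_nat)
    then show ?thesis
    proof
      assume "cyclic_nth w (int i) = s"
      then show ?thesis using *[OF w(1) t, of "int i"] by simp
    next
      assume "cyclic_nth w (int i) = ainv M s"
      then have "h (edge_curve M (ainv M s) (1 - t)) = edge_curve M (ainv M (f s)) (1 - t)"
        using *[OF w(1), of "1 - t" "int i"] t inv[OF s] by simp
      then show ?thesis using edge_curve_ainv[OF arc_graph s] edge_curve_ainv[OF arc_graph fa[OF s]] by simp
    qed
  qed
  have Tsurj: "T ` faces M = faces M"
    using endo_inj_surj[OF finite_faces _ injT] T by blast
  have closed: "closed_surface (surface M)" using conn by (rule closed_surface_surface)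
  have homeo: "homeomorphic_map (surface M) (surface M) h"
  proof (rule continuous_imp_homeomorphic_map)
    show "continuous_map (surface M) (surface M) h"
    proof (rule continuous_map_from_surface)
      fix w assume w: "w \<in> faces M"
      have "continuous_map (top_of_set (cball 0 1)) (top_of_set (cball 0 1)) (\<rho> w)"
        using cont\<rho>[OF w] norm\<rho>[OF w] by (auto simp: continuous_map_in_subtopology intro: continuous_on_subset)
      then have "continuous_map (top_of_set (cball 0 1)) (surface M) (disk_map M (T w) \<circ> \<rho> w)"
        using continuous_disk_map[OF T[OF w]] by (rule continuous_map_compose)
      then show "continuous_map (top_of_set (cball 0 1)) (surface M) (\<lambda>z. h (disk_map M w z))"
        by (rule continuous_map_eq) (simp add: h[OF w])
    qed
    show "compact_space (surface M)" "Hausdorff_space (surface M)" using closed by (auto simp: closed_surface_def)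
    show "h ` topspace (surface M) = topspace (surface M)"
    proof (intro equalityI subsetI)
      fix p assume "p \<in> h ` topspace (surface M)"
      then obtain q where "q \<in> topspace (surface M)" "p = h q" by blast
      then obtain w z where "w \<in> faces M" "z \<in> cball 0 1" "p = h (disk_map M w z)" by (metis disk_map_surj)
      then show "p \<in> topspace (surface M)"
        using h disk_map_in_surface_points[OF T] norm\<rho> by (simp add: topspace_surface)
    next
      fix p assume "p \<in> topspace (surface M)"
      then obtain w z where w: "w \<in> faces M" "z \<in> cball 0 1" "p = disk_map M w z" by (rule disk_map_surj)
      then obtain w' where w': "w' \<in> faces M" "w = T w'" using Tsurj by blast
      obtain z' where z': "z = \<rho> w' z'" using surj\<rho>[OF w'(1)] by (metis surjD)
      then have "z' \<in> cball 0 1" using w(2) norm\<rho>[OF w'(1), of z'] by simp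
      then have "p = h (disk_map M w' z')" "disk_map M w' z' \<in> topspace (surface M)"
        using h[OF w'(1)] w w' z' disk_map_in_surface_points[OF w'(1)] by (auto simp: topspace_surface)
      then show "p \<in> h ` topspace (surface M)" by blast
    qed
    show "inj_on h (topspace (surface M))"
    proof (rule inj_onI)
      fix p q assume p: "p \<in> topspace (surface M)" and q: "q \<in> topspace (surface M)" and eq: "h p = h q"
      obtain w z where w: "w \<in> faces M" "z \<in> cball 0 1" "p = disk_map M w z" using disk_map_surj[OF p] .
      obtain w' z' where w': "w' \<in> faces M" "z' \<in> cball 0 1" "q = disk_map M w' z'" using disk_map_surj[OF q] .
      have e: "disk_map M (T w) (\<rho> w z) = disk_map M (T w') (\<rho> w' z')" using eq h w w' by simp
      have VF: "disk_map M x y = FPt a b \<longleftrightarrow> norm y < 1 \<and> x = a \<and> y = b" for x y a b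
        by (auto simp: disk_map_def walk_curve_def Let_def edge_curve_def split: if_splits)
      show "p = q"
      proof (cases "norm z < 1")
        case True
        then have "disk_map M (T w) (\<rho> w z) = FPt (T w) (\<rho> w z)" using VF norm\<rho>[OF w(1)] by simp
        then have "T w = T w'" "\<rho> w z = \<rho> w' z'" using e VF by metis+
        then have "w = w'" using injT w w' by (auto simp: inj_on_def)
        moreover from this have "z = z'" using \<open>\<rho> w z = \<rho> w' z'\<close> inj\<rho>[OF w(1)] by (auto simp: inj_on_def)
        ultimately show ?thesis using w w' by simp
      next
        case False
        then have n1: "norm z = 1" using w by simp
        have "norm z' = 1"
        proof (rule ccontr)
          assume "norm z' \<noteq> 1"
          then have "norm z' < 1" using w' by simp
          then have "disk_map M (T w') (\<rho> w' z') = FPt (T w') (\<rho> w' z')" using VF norm\<rho>[OF w'(1)] by simp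
          then show False using e VF norm\<rho>[OF w(1)] False by metis
        qed
        obtain i t where it: "0 \<le> t" "t < 1" "disk_map M w z = edge_curve M (cyclic_nth w i) t"
          using norm_one_imp_rim[OF w(1) n1] by metis
        obtain i' t' where it': "0 \<le> t'" "t' < 1" "disk_map M w' z' = edge_curve M (cyclic_nth w' i') t'"
          using norm_one_imp_rim[OF w'(1) \<open>norm z' = 1\<close>] by metis
        have "edge_curve M (f (cyclic_nth w i)) t = edge_curve M (f (cyclic_nth w' i')) t'"
          using eq w w' it it' hedge[OF cyclic_nth_arc] by simp
        then show ?thesis using ec_iff[OF cyclic_nth_arc[OF w(1)] cyclic_nth_arc[OF w'(1)]] it it' w w' by simp
      qed
    qed
  qed
  have nodes: "nodes M = tail M ` arcs M" using node_has_arc ainv_arc(3) by blast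
  have fimg: "f ` arcs M = arcs M" using bij by (simp add: bij_betw_def)
  have hV: "h ` vertex_points M = vertex_points M"
  proof -
    have "h (VPt (tail M s)) = VPt (tail M (f s))" if "s \<in> arcs M" for s
      using hedge[OF that, of 0] by (simp add: edge_curve_def)
    then have "h ` vertex_points M = (\<lambda>s. VPt (tail M (f s))) ` arcs M"
      unfolding vertex_points_def nodes by (simp add: image_image)
    also have "\<dots> = (\<lambda>s. VPt (tail M s)) ` f ` arcs M" by (simp add: image_image)
    finally show ?thesis unfolding fimg vertex_points_def nodes by (simp add: image_image)
  qed
  have hE: "h ` edge_points M = edge_points M"
  proof -
    have "h ` edge_curve M s ` {0<..<1} = edge_curve M (f s) ` {0<..<1}" if "s \<in> arcs M" for s
      using hedge[OF that] by (force simp: image_image)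
    then have "h ` edge_points M = (\<Union>s\<in>arcs M. edge_curve M (f s) ` {0<..<1})"
      unfolding edge_points_def by (simp add: image_UN)
    also have "\<dots> = (\<Union>s\<in>f ` arcs M. edge_curve M s ` {0<..<1})" by simp
    finally show ?thesis unfolding fimg edge_points_def .
  qed
  have hF: "h ` open_face w = open_face (T w)" if w: "w \<in> faces M" for w
  proof -
    have 1: "h (FPt w z) = FPt (T w) (\<rho> w z)" if "norm z < 1" for z
      using h[OF w, of z] that norm\<rho>[OF w, of z] by (simp add: disk_map_def)
    have "\<rho> w ` ball 0 1 = ball 0 1"
    proof (intro equalityI subsetI)
      fix y assume y: "y \<in> ball (0::complex) 1"
      obtain x where "y = \<rho> w x" using surj\<rho>[OF w] by (metis surjD)
      then show "y \<in> \<rho> w ` ball 0 1" using y norm\<rho>[OF w, of x] by simp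
    qed (use norm\<rho>[OF w] in auto)
    then have "FPt (T w) ` \<rho> w ` ball 0 1 = open_face (T w)" by (simp add: open_face_def)
    moreover have "h ` open_face w = FPt (T w) ` \<rho> w ` ball 0 1"
      unfolding open_face_def using 1 by (simp add: image_image)
    ultimately show ?thesis by simp
  qed
  \<comment> \<open>Identity off the flags, as \<open>permutes\<close> demands.\<close>
  define \<pi> where "\<pi> x = (if x \<in> flags M then (f (fst x), T (snd x)) else x)" for x
  have member: "f s \<in> set (T w) \<or> ainv M (f s) \<in> set (T w)" if w: "w \<in> faces M" and s: "s \<in> set w" for s w
  proof -
    have Tn: "T w \<noteq> []" using face_nonempty T w by blast
    obtain i where "i < length w" "w ! i = s" using s by (metis in_set_conv_nth)
    then have "cyclic_nth w (int i) = s" by (simp add: cyclic_nth_nat)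
    then show ?thesis using turn[OF w] cyclic_nth_in_set[OF Tn] by metis
  qed
  have flag: "(f s, T w) \<in> flags M" if "(s, w) \<in> flags M" for s w
  proof -
    have s: "s \<in> arcs M" "w \<in> faces M" "s \<in> set w \<or> ainv M s \<in> set w" using that by (auto simp: flags_def)
    then have "f s \<in> set (T w) \<or> ainv M (f s) \<in> set (T w)"
      using member[OF s(2), of s] member[OF s(2), of "ainv M s"] inv[OF s(1)] ainv_arc(2)[OF fa[OF s(1)]] by auto
    then show ?thesis using fa T s by (simp add: flags_def)
  qed
  have "\<pi> permutes flags M"
  proof (rule bij_imp_permutes)
    have "finite (flags M)"
      by (rule finite_subset[of _ "arcs M \<times> faces M"]) (auto simp: flags_def finite_arcs finite_faces)
    moreover have "\<pi> ` flags M \<subseteq> flags M" using flag by (auto simp: \<pi>_def)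
    moreover have "inj_on \<pi> (flags M)"
      using finj injT by (auto simp: \<pi>_def flags_def inj_on_def)
    ultimately show "bij_betw \<pi> (flags M) (flags M)"
      by (simp add: bij_betw_def endo_inj_surj)
  qed (simp add: \<pi>_def)
  moreover have "maps_arc M h s (f s)" if "s \<in> arcs M" for s
    unfolding maps_arc_def using hedge[OF that]
    by (intro exI[of _ id]) (auto simp: strict_mono_on_def continuous_on_id)
  moreover have "\<pi> (s, w) = (f s, T w)" if "(s, w) \<in> flags M" for s w
    using that by (simp add: \<pi>_def)
  ultimately have "map_automorphism M \<pi>"
    unfolding map_automorphism_def
    using homeo hV hE hF by (intro conjI exI[of _ h]) (auto simp: flags_def)
  then show thesis using that[of \<pi>] by (simp add: \<pi>_def)
qed

end

section \<open>Girth cycles of signature (1,1,2)\<close>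

lemma cyclic_nth_mod: "cyclic_nth w (i mod int (length w)) = cyclic_nth w i"
  by (simp add: cyclic_nth_def)

lemma cyclic_nth_map: "w \<noteq> [] \<Longrightarrow> cyclic_nth (map f w) i = f (cyclic_nth w i)"
  by (simp add: cyclic_nth_def nat_less_iff)

lemma cyclic_nth_eq_iff:
  "distinct w \<Longrightarrow> w \<noteq> [] \<Longrightarrow> cyclic_nth w i = cyclic_nth w j \<longleftrightarrow> i mod int (length w) = j mod int (length w)"
  by (auto simp: cyclic_nth_def nth_eq_iff_index_eq nat_less_iff eq_nat_nat_iff)

lemma range_cyclic_nth: "w \<noteq> [] \<Longrightarrow> range (cyclic_nth w) = set w"
proof (intro equalityI subsetI)
  fix x assume "x \<in> set w"
  then obtain i where "i < length w" "x = cyclic_nth w (int i)" by (metis cyclic_nth_nat in_set_conv_nth)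
  then show "x \<in> range (cyclic_nth w)" by blast
qed (auto simp: cyclic_nth_in_set)

text \<open>A cycle as a periodic sequence on the integers. The congruence condition expresses
  closing up and distinctness at once, and a change of starting vertex is a shift of the
  index.\<close>

definition cycle_param :: "'a sgraph \<Rightarrow> nat \<Rightarrow> (int \<Rightarrow> 'a) \<Rightarrow> bool" where
  "cycle_param G k V \<longleftrightarrow> 3 \<le> k \<and> (\<forall>i j. V i = V j \<longleftrightarrow> i mod int k = j mod int k) \<and> range V \<subseteq> verts G \<and>
     (\<forall>i. {V i, V (i + 1)} \<in> edges G)"

lemma is_cycle_iff_cycle_param:
  "is_cycle G k C \<longleftrightarrow> (\<exists>V. cycle_param G k V \<and> C = range (\<lambda>i. {V i, V (i + 1)}))"
proof
  assume "is_cycle G k C"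
  then obtain vs where k: "3 \<le> k" and vs: "length vs = k" "distinct vs" "set vs \<subseteq> verts G"
    and C: "C = {{vs ! i, vs ! (Suc i mod k)} | i. i < k}" "C \<subseteq> edges G"
    by (auto simp: is_cycle_def)
  let ?V = "cyclic_nth vs"
  have ne: "vs \<noteq> []" using vs k by auto
  have "C = range (\<lambda>i. {?V i, ?V (i + 1)})"
  proof (intro equalityI subsetI)
    fix e assume "e \<in> C"
    then obtain i where i: "i < k" "e = {vs ! i, vs ! (Suc i mod k)}" using C by blast
    then have "e = {?V (int i), ?V (int i + 1)}"
      using vs(1) cyclic_nth_nat[of i vs] cyclic_nth_Suc[of i vs] by simp
    then show "e \<in> range (\<lambda>i. {?V i, ?V (i + 1)})" by blast
  next
    fix e assume "e \<in> range (\<lambda>i. {?V i, ?V (i + 1)})"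
    then obtain i where e: "e = {?V i, ?V (i + 1)}" by blast
    define j where "j = nat (i mod int k)"
    have j: "j < k" "int j = i mod int k" using k by (auto simp: j_def nat_less_iff)
    have "?V i = vs ! j" using vs by (simp add: cyclic_nth_def j_def)
    moreover have "?V (i + 1) = ?V (int j + 1)"
      using vs by (simp add: cyclic_nth_def j(2) mod_simps)
    ultimately have "e = {vs ! j, vs ! (Suc j mod k)}"
      using e j cyclic_nth_Suc[of j vs] vs by simp
    then show "e \<in> C" using C j by blast
  qed
  moreover from this have "cycle_param G k ?V"
    using k vs C(2) cyclic_nth_eq_iff[OF vs(2) ne] range_cyclic_nth[OF ne] by (auto simp: cycle_param_def)
  ultimately show "\<exists>V. cycle_param G k V \<and> C = range (\<lambda>i. {V i, V (i + 1)})" by blast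
next
  assume "\<exists>V. cycle_param G k V \<and> C = range (\<lambda>i. {V i, V (i + 1)})"
  then obtain V where V: "cycle_param G k V" and C: "C = range (\<lambda>i. {V i, V (i + 1)})" by blast
  have k: "3 \<le> k" and inj: "\<And>i j. V i = V j \<longleftrightarrow> i mod int k = j mod int k"
    using V by (auto simp: cycle_param_def)
  define vs where "vs = map (\<lambda>i. V (int i)) [0..<k]"
  have "C = {{vs ! i, vs ! (Suc i mod k)} | i. i < k}"
  proof -
    have nth: "{vs ! i, vs ! (Suc i mod k)} = {V (int i), V (int i + 1)}" if "i < k" for i
    proof -
      have "V (int (Suc i mod k)) = V (int i + 1)" by (simp add: inj zmod_int add.commute)
      then show ?thesis using that k by (simp add: vs_def)
    qed
    show ?thesis
    proof (intro equalityI subsetI)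
      fix e assume "e \<in> C"
      then obtain i where e: "e = {V i, V (i + 1)}" using C by blast
      define j where "j = nat (i mod int k)"
      have j: "j < k" "int j = i mod int k" using k by (auto simp: j_def nat_less_iff)
      have "V i = V (int j)" "V (i + 1) = V (int j + 1)" by (auto simp: inj j mod_simps)
      then show "e \<in> {{vs ! i, vs ! (Suc i mod k)} | i. i < k}" using nth[OF j(1)] e j(1) by auto
    next
      fix e assume "e \<in> {{vs ! i, vs ! (Suc i mod k)} | i. i < k}"
      then show "e \<in> C" using nth C by auto
    qed
  qed
  moreover have "distinct vs" by (auto simp: vs_def distinct_map inj_on_def inj)
  moreover have "V i \<in> verts G" for i using V unfolding cycle_param_def by blast
  then have "length vs = k" "set vs \<subseteq> verts G" by (auto simp: vs_def)
  moreover have "C \<subseteq> edges G" using V C by (auto simp: cycle_param_def)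
  ultimately show "is_cycle G k C" unfolding is_cycle_def using k by (intro conjI exI[of _ vs]) auto
qed

text \<open>Length at least 3 makes \<open>V (j - 1)\<close> and \<open>V (j + 1)\<close> different,
  so a cycle has exactly two edges at each of its vertices.\<close>

lemma cycle_incident:
  assumes V: "cycle_param G k V" and C: "C = range (\<lambda>i. {V i, V (i + 1)})"
  shows "C \<inter> incident G (V j) = {{V (j - 1), V j}, {V j, V (j + 1)}}" "{V (j - 1), V j} \<noteq> {V j, V (j + 1)}"
proof -
  have k: "3 \<le> k" and inj: "\<And>i j. V i = V j \<longleftrightarrow> i mod int k = j mod int k"
    using V by (auto simp: cycle_param_def)
  have cong: "V (i + d) = V (j + d)" if "V i = V j" for i j d
    using that mod_add_cong[of i "int k" j d d] by (simp add: inj)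
  show "C \<inter> incident G (V j) = {{V (j - 1), V j}, {V j, V (j + 1)}}"
  proof (intro equalityI subsetI)
    fix e assume "e \<in> C \<inter> incident G (V j)"
    then obtain i where e: "e = {V i, V (i + 1)}" "V j \<in> e" using C by (auto simp: incident_def)
    then consider "V i = V j" | "V (i + 1) = V j" by auto
    then show "e \<in> {{V (j - 1), V j}, {V j, V (j + 1)}}"
    proof cases
      case 1
      then show ?thesis using cong[of i j 1] e by simp
    next
      case 2
      then have "V i = V (j - 1)" using cong[of "i + 1" j "-1"] by simp
      then show ?thesis using 2 e by simp
    qed
  next
    fix e assume e: "e \<in> {{V (j - 1), V j}, {V j, V (j + 1)}}"
    have "\<exists>i. e = {V i, V (i + 1)}"
    proof (cases "e = {V j, V (j + 1)}")
      case False
      then have "e = {V (j - 1), V (j - 1 + 1)}" using e by simp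
      then show ?thesis by blast
    qed blast
    moreover have "V j \<in> e" using e by auto
    ultimately obtain i where "e = {V i, V (i + 1)}" "V j \<in> e" by blast
    then show "e \<in> C \<inter> incident G (V j)" using C V by (auto simp: incident_def cycle_param_def)
  qed
  show "{V (j - 1), V j} \<noteq> {V j, V (j + 1)}"
  proof
    assume "{V (j - 1), V j} = {V j, V (j + 1)}"
    then have "V (j - 1) = V (j + 1) \<or> V (j - 1) = V j" by (auto simp: doubleton_eq_iff)
    then have "(j - 1) mod int k = (j + 1) mod int k \<or> (j - 1) mod int k = j mod int k" by (simp add: inj)
    then have "int k dvd (j + 1) - (j - 1) \<or> int k dvd j - (j - 1)" by (metis mod_eq_dvd_iff)
    then have "int k dvd 2 \<or> int k dvd 1" by simp
    then show False using k by (auto dest!: zdvd_imp_le)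
  qed
qed

section \<open>Counting girth cycles at a vertex\<close>

locale cubic_112 =
  fixes \<Gamma> :: "'a sgraph" and g :: nat
  assumes simple: "simple_graph \<Gamma>" and finite_verts: "finite (verts \<Gamma>)"
    and connected: "connected_graph \<Gamma>" and cubic: "cubic \<Gamma>" and girth: "girth \<Gamma> = enat g"
    and signature: "v \<in> verts \<Gamma> \<Longrightarrow> signature \<Gamma> v = [1, 1, 2]"
begin

abbreviation "GC \<equiv> girth_cycles \<Gamma>"

lemma GC_iff: "C \<in> GC \<longleftrightarrow> is_cycle \<Gamma> g C"
  by (simp add: girth_cycles_def girth)

lemma girth_le: "is_cycle \<Gamma> k C \<Longrightarrow> g \<le> k"
proof -
  assume "is_cycle \<Gamma> k C"
  then have "girth \<Gamma> \<le> enat k" unfolding girth_def by (intro Inf_lower) blast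
  then show ?thesis by (simp add: girth)
qed

lemma edge_verts: "{x, y} \<in> edges \<Gamma> \<Longrightarrow> x \<in> verts \<Gamma> \<and> y \<in> verts \<Gamma> \<and> x \<noteq> y"
  using simple by (fastforce simp: simple_graph_def card_2_iff doubleton_eq_iff)

lemma edgeE: assumes "e \<in> edges \<Gamma>" "x \<in> e" obtains y where "e = {x, y}" "x \<noteq> y"
proof -
  have "card e = 2" using simple assms by (auto simp: simple_graph_def)
  then obtain a b where "e = {a, b}" "a \<noteq> b" by (auto simp: card_2_iff)
  then show thesis using that[of a] that[of b] assms by (auto simp: insert_commute)
qed

lemma finite_edges: "finite (edges \<Gamma>)"
  by (rule finite_subset[of _ "Pow (verts \<Gamma>)"]) (use simple finite_verts in \<open>auto simp: simple_graph_def\<close>)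

lemma GC_edges: "C \<in> GC \<Longrightarrow> C \<subseteq> edges \<Gamma>"
  by (auto simp: GC_iff is_cycle_def)

lemma finite_GC: "finite GC"
  by (rule finite_subset[of _ "Pow (edges \<Gamma>)"]) (use GC_edges finite_edges in auto)

lemma incident_edges:
  assumes "v \<in> verts \<Gamma>"
  obtains a b r where "incident \<Gamma> v = {a, b, r}" "a \<noteq> b" "a \<noteq> r" "b \<noteq> r" "eps \<Gamma> a = 1" "eps \<Gamma> b = 1" "eps \<Gamma> r = 2"
proof -
  have "card (incident \<Gamma> v) = 3" using cubic assms by (simp add: cubic_def)
  then obtain x y z where i: "incident \<Gamma> v = {x, y, z}" "x \<noteq> y" "x \<noteq> z" "y \<noteq> z" by (auto simp: card_3_iff)
  have "mset (signature \<Gamma> v) = image_mset (eps \<Gamma>) (mset_set (incident \<Gamma> v))" by (simp add: signature_def)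
  then have "{#1, 1, 2#} = {#eps \<Gamma> x, eps \<Gamma> y, eps \<Gamma> z#}" using signature[OF assms] i by simp
  then have "eps \<Gamma> x = 1 \<and> eps \<Gamma> y = 1 \<and> eps \<Gamma> z = 2 \<or> eps \<Gamma> x = 1 \<and> eps \<Gamma> y = 2 \<and> eps \<Gamma> z = 1 \<or>
      eps \<Gamma> x = 2 \<and> eps \<Gamma> y = 1 \<and> eps \<Gamma> z = 1"
    by (auto simp: add_eq_conv_ex)
  then show thesis
  proof (elim disjE conjE)
    assume "eps \<Gamma> x = 1" "eps \<Gamma> y = 1" "eps \<Gamma> z = 2"
    then show thesis using that[of x y z] i by blast
  next
    assume "eps \<Gamma> x = 1" "eps \<Gamma> y = 2" "eps \<Gamma> z = 1"
    moreover have "incident \<Gamma> v = {x, z, y}" using i(1) by (simp add: insert_commute)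
    ultimately show thesis using that[of x z y] i by metis
  next
    assume "eps \<Gamma> x = 2" "eps \<Gamma> y = 1" "eps \<Gamma> z = 1"
    moreover have "incident \<Gamma> v = {y, z, x}" using i(1) by (simp add: insert_commute)
    ultimately show thesis using that[of y z x] i by metis
  qed
qed

lemma unique_girth_cycle:
  assumes "eps \<Gamma> e = 1" "C1 \<in> GC" "C2 \<in> GC" "e \<in> C1" "e \<in> C2"
  shows "C1 = C2"
proof -
  obtain D where "{C \<in> GC. e \<in> C} = {D}" using assms(1) unfolding eps_def by (rule card_1_singletonE)
  then have "C \<in> GC \<and> e \<in> C \<Longrightarrow> C = D" for C by blast
  then show ?thesis using assms by blast
qed

text \<open>A girth cycle through the vertex uses two of the three edges. Were both blue, take a
  girth cycle through the red edge: it also uses a blue edge, so by uniqueness it is the same cycle,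
  which would then have three edges at the vertex.\<close>

lemma girth_cycle_colours:
  assumes C: "C \<in> GC" and v: "v \<in> verts \<Gamma>" and ne: "C \<inter> incident \<Gamma> v \<noteq> {}"
  obtains r b where "C \<inter> incident \<Gamma> v = {r, b}" "eps \<Gamma> r = 2" "eps \<Gamma> b = 1"
proof -
  have two: "card (C \<inter> incident \<Gamma> v) = 2" if C: "C \<in> GC" "C \<inter> incident \<Gamma> v \<noteq> {}" for C
  proof -
    obtain V where V: "cycle_param \<Gamma> g V" "C = range (\<lambda>i. {V i, V (i + 1)})"
      using C(1) by (auto simp: GC_iff is_cycle_iff_cycle_param)
    obtain i where "v \<in> {V i, V (i + 1)}" using C V(2) by (auto simp: incident_def)
    then obtain j where "v = V j" by blast
    then show ?thesis using cycle_incident[OF V, of j] by simp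
  qed
  obtain a b r where inc: "incident \<Gamma> v = {a, b, r}" "a \<noteq> b" "a \<noteq> r" "b \<noteq> r"
    and eps: "eps \<Gamma> a = 1" "eps \<Gamma> b = 1" "eps \<Gamma> r = 2" using incident_edges[OF v] .
  have one: "C1 = C2" if e: "eps \<Gamma> e = 1" "C1 \<in> GC" "C2 \<in> GC" "e \<in> C1" "e \<in> C2" for e C1 C2
    by (rule unique_girth_cycle[OF e])
  have "card {C \<in> GC. r \<in> C} = 2" using eps by (simp add: eps_def)
  then obtain C1 where C1: "C1 \<in> GC" "r \<in> C1" by (metis (no_types, lifting) card.empty empty_Collect_eq zero_neq_numeral)
  have sub: "C \<inter> incident \<Gamma> v = {a, b} \<or> C \<inter> incident \<Gamma> v = {r, a} \<or> C \<inter> incident \<Gamma> v = {r, b}"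
    if C: "C \<in> GC" "C \<inter> incident \<Gamma> v \<noteq> {}" for C
  proof -
    have "C \<inter> incident \<Gamma> v = (if a \<in> C then {a} else {}) \<union> (if b \<in> C then {b} else {}) \<union> (if r \<in> C then {r} else {})"
      using inc by auto
    then show ?thesis using two[OF C] inc by (auto split: if_splits)
  qed
  have "C \<inter> incident \<Gamma> v \<noteq> {a, b}"
  proof
    assume ab: "C \<inter> incident \<Gamma> v = {a, b}"
    have "C1 \<inter> incident \<Gamma> v \<noteq> {}" using C1 inc by auto
    then have "a \<in> C1 \<or> b \<in> C1" using sub[OF C1(1)] by blast
    then have "C1 = C" using one[of a C1 C] one[of b C1 C] eps C1 C ab by blast
    then have "r \<in> C \<inter> incident \<Gamma> v" using C1 inc by auto
    then show False using ab inc by auto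
  qed
  then consider "C \<inter> incident \<Gamma> v = {r, a}" | "C \<inter> incident \<Gamma> v = {r, b}" using sub[OF C ne] by metis
  then show thesis using that[OF _ eps(3) eps(1)] that[OF _ eps(3) eps(2)] by cases blast+
qed

end

section \<open>Alternation of red and blue edges\<close>

context cubic_112
begin

definition blue :: "'a \<Rightarrow> 'a \<Rightarrow> bool" where
  "blue x y \<longleftrightarrow> {x, y} \<in> edges \<Gamma> \<and> eps \<Gamma> {x, y} = 1"

definition red :: "'a \<Rightarrow> 'a \<Rightarrow> bool" where
  "red x y \<longleftrightarrow> {x, y} \<in> edges \<Gamma> \<and> eps \<Gamma> {x, y} = 2"

definition mate :: "'a \<Rightarrow> 'a" where
  "mate x = (SOME y. red x y)"

lemma blue_sym: "blue x y \<longleftrightarrow> blue y x" and red_sym: "red x y \<longleftrightarrow> red y x"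
  by (auto simp: blue_def red_def insert_commute)

lemma blue_verts: "blue x y \<Longrightarrow> x \<in> verts \<Gamma> \<and> y \<in> verts \<Gamma> \<and> x \<noteq> y"
  and red_verts: "red x y \<Longrightarrow> x \<in> verts \<Gamma> \<and> y \<in> verts \<Gamma> \<and> x \<noteq> y"
  using edge_verts by (auto simp: blue_def red_def)

lemma neighbours:
  assumes v: "v \<in> verts \<Gamma>"
  obtains x y z where "x \<noteq> y" "{u. blue v u} = {x, y}" "{u. red v u} = {z}"
proof -
  obtain a b r where inc: "incident \<Gamma> v = {a, b, r}" "a \<noteq> b" "a \<noteq> r" "b \<noteq> r"
    and eps: "eps \<Gamma> a = 1" "eps \<Gamma> b = 1" "eps \<Gamma> r = 2" using incident_edges[OF v] .
  have m: "e \<in> edges \<Gamma> \<and> v \<in> e" if "e \<in> {a, b, r}" for e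
    using that unfolding inc(1)[symmetric] by (simp add: incident_def)
  obtain x where x: "a = {v, x}" using edgeE[of a v] m[of a] by blast
  obtain y where y: "b = {v, y}" using edgeE[of b v] m[of b] by blast
  obtain z where z: "r = {v, z}" using edgeE[of r v] m[of r] by blast
  have iff: "{v, u} \<in> edges \<Gamma> \<longleftrightarrow> {v, u} \<in> {a, b, r}" for u
    unfolding inc(1)[symmetric] by (simp add: incident_def)
  have "blue v u \<longleftrightarrow> u = x \<or> u = y" for u
    unfolding blue_def iff using eps x y z by (auto simp: doubleton_eq_iff)
  moreover have "red v u \<longleftrightarrow> u = z" for u
    unfolding red_def iff using eps x y z by (auto simp: doubleton_eq_iff)
  moreover have "x \<noteq> y" using inc x y by auto
  ultimately show thesis using that[of x y z] by auto
qed

lemma red_mate: "v \<in> verts \<Gamma> \<Longrightarrow> red v u \<longleftrightarrow> u = mate v"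
proof -
  assume "v \<in> verts \<Gamma>"
  then obtain z where z: "{u. red v u} = {z}" by (rule neighbours)
  then have iff: "red v u \<longleftrightarrow> u = z" for u by blast
  then have "mate v = z" unfolding mate_def by (intro some_equality) auto
  then show ?thesis using iff by simp
qed

lemma mate: 
  assumes "v \<in> verts \<Gamma>"
  shows "mate v \<in> verts \<Gamma>" "mate v \<noteq> v" "mate (mate v) = v" "{v, mate v} \<in> edges \<Gamma>" "eps \<Gamma> {v, mate v} = 2"
proof -
  have r: "red v (mate v)" using red_mate assms by simp
  show m: "mate v \<in> verts \<Gamma>" and "mate v \<noteq> v" using red_verts[OF r] by auto
  have "red (mate v) v" using r red_sym by simp
  then show "mate (mate v) = v" using red_mate[OF m] by simp
  show "{v, mate v} \<in> edges \<Gamma>" "eps \<Gamma> {v, mate v} = 2" using r by (auto simp: red_def)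
qed

lemma mate_eq_iff: "x \<in> verts \<Gamma> \<Longrightarrow> y \<in> verts \<Gamma> \<Longrightarrow> mate x = mate y \<longleftrightarrow> x = y"
  using mate(3) by metis

lemma edge_cases:
  assumes "{x, y} \<in> edges \<Gamma>" shows "blue x y \<or> y = mate x"
proof -
  have v: "x \<in> verts \<Gamma>" using edge_verts assms by blast
  obtain a b r where inc: "incident \<Gamma> x = {a, b, r}"
    and eps: "eps \<Gamma> a = 1" "eps \<Gamma> b = 1" "eps \<Gamma> r = 2" using incident_edges[OF v] .
  have "{x, y} \<in> incident \<Gamma> x" using assms by (simp add: incident_def)
  then have "eps \<Gamma> {x, y} = 1 \<or> eps \<Gamma> {x, y} = 2" using inc eps by auto
  then have "blue x y \<or> red x y" using assms by (auto simp: blue_def red_def)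
  then show ?thesis using red_mate[OF v] by blast
qed

lemma edge_iff: "x \<in> verts \<Gamma> \<Longrightarrow> {x, y} \<in> edges \<Gamma> \<longleftrightarrow> blue x y \<or> y = mate x"
  using edge_cases mate(4) by (auto simp: blue_def)

lemma girth_cycle_at:
  assumes C: "C \<in> GC" and xy: "{x, y} \<in> C"
  shows "{x, mate x} \<in> C" "\<exists>!u. blue x u \<and> {x, u} \<in> C"
proof -
  have x: "x \<in> verts \<Gamma>" using GC_edges[OF C] xy edge_verts by blast
  have "{x, y} \<in> C \<inter> incident \<Gamma> x" using GC_edges[OF C] xy by (auto simp: incident_def)
  then obtain r b where rb: "C \<inter> incident \<Gamma> x = {r, b}" "eps \<Gamma> r = 2" "eps \<Gamma> b = 1"
    using girth_cycle_colours[OF C x] by (metis empty_iff)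
  have "r \<in> edges \<Gamma>" "x \<in> r" "b \<in> edges \<Gamma>" "x \<in> b" using rb(1) unfolding incident_def by auto
  then obtain u u' where u: "r = {x, u}" "b = {x, u'}" by (metis edgeE)
  then have "u = mate x" using red_mate[OF x, of u] \<open>r \<in> edges \<Gamma>\<close> rb by (simp add: red_def)
  then show "{x, mate x} \<in> C" using u rb by auto
  show "\<exists>!u. blue x u \<and> {x, u} \<in> C"
  proof
    show "blue x u' \<and> {x, u'} \<in> C" using u rb \<open>b \<in> edges \<Gamma>\<close> by (auto simp: blue_def)
    fix v assume v: "blue x v \<and> {x, v} \<in> C"
    then have "{x, v} \<in> C \<inter> incident \<Gamma> x" by (auto simp: blue_def incident_def)
    then have "{x, v} = r \<or> {x, v} = b" unfolding rb(1) by simp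
    then have "{x, v} = b" using v rb(2) unfolding blue_def by fastforce
    then show "v = u'" using u by (auto simp: doubleton_eq_iff)
  qed
qed

lemma girth_cycle_alternates:
  assumes C: "C \<in> GC"
  shows "even g \<and> (\<exists>V. cycle_param \<Gamma> g V \<and> C = range (\<lambda>i. {V i, V (i + 1)}) \<and>
    (\<forall>i. even i \<longrightarrow> V (i + 1) = mate (V i)) \<and> (\<forall>i. odd i \<longrightarrow> blue (V i) (V (i + 1))))"
proof -
  obtain V where V: "cycle_param \<Gamma> g V" and CV: "C = range (\<lambda>i. {V i, V (i + 1)})"
    using C by (auto simp: GC_iff is_cycle_iff_cycle_param)
  have Vv: "V i \<in> verts \<Gamma>" for i using V unfolding cycle_param_def by blast
  define R where "R i \<longleftrightarrow> V (i + 1) = mate (V i)" for i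
  have nR: "R i \<or> blue (V i) (V (i + 1))" for i
    using edge_cases[of "V i" "V (i + 1)"] V by (auto simp: R_def cycle_param_def)
  \<comment> \<open>Two consecutive red edges would both be the unique red edge at the middle
    vertex; two consecutive blue ones would violate \<open>girth_cycle_at\<close>.\<close>
  have alt: "R (i + 1) \<longleftrightarrow> \<not> R i" for i
  proof -
    have e1: "{V (i + 1), V i} \<in> C" using CV by (auto simp: insert_commute)
    have e2: "{V (i + 1), V (i + 2)} \<in> C" using CV rangeI[of "\<lambda>i. {V i, V (i + 1)}" "i + 1"] by (simp add: add.assoc)
    have ne: "V i \<noteq> V (i + 2)" using cycle_incident(2)[OF V CV, of "i + 1"] by (auto simp: insert_commute add.assoc)
    have Ri: "R i \<longleftrightarrow> V i = mate (V (i + 1))" using mate(3) Vv unfolding R_def by metis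
    have "\<not> (blue (V (i + 1)) (V i) \<and> blue (V (i + 1)) (V (i + 2)))"
      using girth_cycle_at(2)[OF C e1] e1 e2 ne by auto
    moreover have "V (i + 1 + 1) = V (i + 2)" by (simp add: add.assoc)
    moreover from this have "\<not> (R i \<and> R (i + 1))" using Ri ne R_def[of "i + 1"] by metis
    ultimately show ?thesis using nR[of i] nR[of "i + 1"] blue_sym[of "V i" "V (i + 1)"] by metis
  qed
  have par: "R i \<longleftrightarrow> (even i \<longleftrightarrow> R 0)" for i
  proof (induction i rule: int_induct[where k = 0])
    case (step2 i)
    then show ?case using alt[of "i - 1"] by auto
  qed (use alt in auto)
  \<comment> \<open>Going once around returns to the same colour, which forces the parity of
    \<open>g\<close>.\<close>
  have "R (int g) \<longleftrightarrow> R 0"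
  proof -
    have "V (int g) = V 0" "V (int g + 1) = V 1" using V by (auto simp: cycle_param_def)
    then show ?thesis by (simp add: R_def)
  qed
  then have g: "even g" using par[of "int g"] by auto
  \<comment> \<open>Shifts the start by one if necessary, so that red edges begin at even
    indices.\<close>
  define d :: int where "d = (if R 0 then 0 else 1)"
  define V' where "V' i = V (i + d)" for i
  have V1: "V' (i + 1) = V (i + d + 1)" for i by (simp add: V'_def algebra_simps)
  have R': "V' (i + 1) = mate (V' i) \<longleftrightarrow> even i" for i
  proof -
    have "V' (i + 1) = mate (V' i) \<longleftrightarrow> R (i + d)" unfolding V1 unfolding V'_def R_def ..
    then show ?thesis using par[of "i + d"] by (cases "R 0") (simp_all add: d_def)
  qed
  have "cycle_param \<Gamma> g V'"
  proof -
    have "(i + d) mod int g = (j + d) mod int g \<longleftrightarrow> i mod int g = j mod int g" for i j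
      by (simp add: mod_eq_dvd_iff)
    then show ?thesis using V Vv unfolding cycle_param_def V1 unfolding V'_def by auto
  qed
  moreover have "C = range (\<lambda>i. {V' i, V' (i + 1)})"
  proof -
    have "range (\<lambda>i. {V' i, V' (i + 1)}) = (\<lambda>i. {V i, V (i + 1)}) ` range (\<lambda>i. i + d)"
      unfolding V1 unfolding V'_def image_image ..
    moreover have "range (\<lambda>i. i + d) = UNIV" by (auto intro: surjI[of _ "\<lambda>i. i - d"])
    ultimately show ?thesis using CV by simp
  qed
  moreover have "blue (V' i) (V' (i + 1))" if "odd i" for i
    using nR[of "i + d"] R'[of i] that unfolding V1 unfolding V'_def R_def by blast
  ultimately show ?thesis using R' g by blast
qed

text \<open>Every other vertex of the girth cycle is listed; the vertices in between are their mates.\<close>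

definition face_walk :: "'a set set \<Rightarrow> 'a list \<Rightarrow> bool" where
  "face_walk C w \<longleftrightarrow> length w = g div 2 \<and> distinct w \<and> set w \<subseteq> verts \<Gamma> \<and> set w \<inter> mate ` set w = {} \<and>
     (\<forall>i. blue (mate (cyclic_nth w i)) (cyclic_nth w (i + 1))) \<and>
     C = (\<lambda>x. {x, mate x}) ` set w \<union> range (\<lambda>i. {mate (cyclic_nth w i), cyclic_nth w (i + 1)})"

lemma half_girth: "GC \<noteq> {} \<Longrightarrow> even g \<and> 2 \<le> g div 2"
proof -
  assume "GC \<noteq> {}"
  then obtain C where C: "C \<in> GC" by blast
  then have "3 \<le> g" by (auto simp: GC_iff is_cycle_def)
  moreover have "even g" using girth_cycle_alternates[OF C] by blast
  ultimately show ?thesis by auto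
qed

lemma face_walk_exists:
  assumes C: "C \<in> GC" shows "\<exists>w. face_walk C w"
proof -
  obtain V where V: "cycle_param \<Gamma> g V" and CV: "C = range (\<lambda>i. {V i, V (i + 1)})"
    and red_i: "\<forall>i. even i \<longrightarrow> V (i + 1) = mate (V i)" and bl_i: "\<forall>i. odd i \<longrightarrow> blue (V i) (V (i + 1))"
    using girth_cycle_alternates[OF C] by blast
  note red = red_i[rule_format] and bl = bl_i[rule_format]
  have inj: "\<And>i j. V i = V j \<longleftrightarrow> i mod int g = j mod int g" and Vv: "\<And>i. V i \<in> verts \<Gamma>"
    using V unfolding cycle_param_def by blast+
  define m where "m = g div 2"
  have "even g \<and> 2 \<le> g div 2" using half_girth C by blast
  then have g: "g = 2 * m" "2 \<le> m" by (auto simp: m_def)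
  define w where "w = map (\<lambda>i. V (2 * int i)) [0..<m]"
  have len: "length w = m" by (simp add: w_def)
  have ne: "w \<noteq> []" using len g by auto
  have cyc: "cyclic_nth w i = V (2 * i)" for i
  proof -
    have "cyclic_nth w i = V (2 * (i mod int m))" using g by (simp add: cyclic_nth_def len w_def nat_less_iff)
    also have "2 * (i mod int m) = (2 * i) mod int g" 
      unfolding g(1) by (simp only: of_nat_mult of_nat_numeral mult_mod_right)
    also have "V ((2 * i) mod int g) = V (2 * i)" unfolding inj by (rule mod_mod_trivial)
    finally show ?thesis .
  qed
  \<comment> \<open>As \<open>g\<close> is even, the parity of an index is well defined modulo
    \<open>g\<close>; it separates the listed vertices from their mates.\<close>
  have evenmod: "even (i mod int g) \<longleftrightarrow> even i" for i using g by (simp add: dvd_mod_iff)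
  have "i = j" if "i < m" "j < m" "V (2 * int i) = V (2 * int j)" for i j
    using that g by (simp add: inj)
  then have "distinct w" by (auto simp: w_def distinct_map inj_on_def)
  moreover have sw: "set w = range (\<lambda>i. V (2 * i))" using range_cyclic_nth[OF ne] cyc by auto
  moreover have "set w \<inter> mate ` set w = {}"
  proof -
    have "V (2 * i) \<noteq> mate (V (2 * j))" for i j
    proof
      assume "V (2 * i) = mate (V (2 * j))"
      then have "V (2 * i) = V (2 * j + 1)" using red[of "2 * j"] by simp
      then have "(2 * i) mod int g = (2 * j + 1) mod int g" by (simp add: inj)
      then have "even (2 * i) \<longleftrightarrow> even (2 * j + 1)" using evenmod by metis
      then show False by simp
    qed
    then show ?thesis unfolding sw by blast
  qed
  moreover have blues: "blue (mate (cyclic_nth w i)) (cyclic_nth w (i + 1))" for i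
    using bl[of "2 * i + 1"] red[of "2 * i"] by (simp add: cyc algebra_simps)
  moreover have "C = (\<lambda>x. {x, mate x}) ` set w \<union> range (\<lambda>i. {mate (cyclic_nth w i), cyclic_nth w (i + 1)})"
  proof -
    have 1: "(\<lambda>x. {x, mate x}) ` set w = range (\<lambda>i. {V (2 * i), V (2 * i + 1)})"
      unfolding sw using red by (simp add: image_image)
    have 2: "{mate (cyclic_nth w i), cyclic_nth w (i + 1)} = {V (2 * i + 1), V (2 * i + 1 + 1)}" for i
      using red[of "2 * i"] by (simp add: cyc algebra_simps)
    have "{V i, V (i + 1)} \<in> range (\<lambda>i. {V (2 * i), V (2 * i + 1)}) \<union> range (\<lambda>i. {V (2 * i + 1), V (2 * i + 1 + 1)})" for i
    proof (cases "even i")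
      case True
      then obtain l where "i = 2 * l" by blast
      then show ?thesis by blast
    next
      case False
      then obtain l where "i = 2 * l + 1" by (elim oddE)
      then show ?thesis by blast
    qed
    then show ?thesis unfolding 1 2 CV by auto
  qed
  ultimately have "face_walk C w" unfolding face_walk_def using len Vv by (auto simp: m_def)
  then show ?thesis by blast
qed

lemma face_walkD:
  assumes "face_walk C w" "C \<in> GC"
  shows "w \<noteq> []" "cyclic_nth w i \<in> verts \<Gamma>" "length w = g div 2" "distinct w"
    "cyclic_nth w i \<noteq> mate (cyclic_nth w j)"
    "blue (mate (cyclic_nth w i)) (cyclic_nth w (i + 1))"
    "{cyclic_nth w i, mate (cyclic_nth w i)} \<in> C" "{mate (cyclic_nth w i), cyclic_nth w (i + 1)} \<in> C"
proof -
  show len: "length w = g div 2" using assms by (simp add: face_walk_def)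
  then show ne: "w \<noteq> []" using half_girth assms by fastforce
  have r: "cyclic_nth w i \<in> set w" for i using cyclic_nth_in_set[OF ne] .
  show "cyclic_nth w i \<in> verts \<Gamma>" using r[of i] assms by (auto simp: face_walk_def)
  show "distinct w" using assms by (simp add: face_walk_def)
  show "cyclic_nth w i \<noteq> mate (cyclic_nth w j)" using r[of i] r[of j] assms unfolding face_walk_def by blast
  show "blue (mate (cyclic_nth w i)) (cyclic_nth w (i + 1))" using assms by (simp add: face_walk_def)
  have "C = (\<lambda>x. {x, mate x}) ` set w \<union> range (\<lambda>i. {mate (cyclic_nth w i), cyclic_nth w (i + 1)})"
    using assms(1) by (simp add: face_walk_def)
  then show "{cyclic_nth w i, mate (cyclic_nth w i)} \<in> C" "{mate (cyclic_nth w i), cyclic_nth w (i + 1)} \<in> C"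
    using r by blast+
qed

text \<open>The colour tells the two kinds of edges of \<open>C\<close> apart: \<open>eps\<close> is
  2 on an edge \<open>{x, mate x}\<close> and 1 on an edge from a mate to the next listed
  vertex.\<close>

lemma face_walk_red:
  assumes fw: "face_walk C w" "C \<in> GC" and x: "x \<in> verts \<Gamma>"
  shows "{x, mate x} \<in> C \<longleftrightarrow> x \<in> set w \<or> mate x \<in> set w"
proof
  assume "{x, mate x} \<in> C"
  moreover have "{x, mate x} \<noteq> {mate (cyclic_nth w i), cyclic_nth w (i + 1)}" for i
  proof
    assume "{x, mate x} = {mate (cyclic_nth w i), cyclic_nth w (i + 1)}"
    then show False using face_walkD(6)[OF fw, of i] mate(5)[OF x] by (simp add: blue_def)
  qed
  ultimately have "{x, mate x} \<in> (\<lambda>y. {y, mate y}) ` set w" using fw(1) unfolding face_walk_def by blast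
  then obtain y where "y \<in> set w" "{x, mate x} = {y, mate y}" by blast
  then show "x \<in> set w \<or> mate x \<in> set w" by (auto simp: doubleton_eq_iff)
next
  have *: "{y, mate y} \<in> C" if "y \<in> set w" for y using that fw(1) unfolding face_walk_def by blast
  assume "x \<in> set w \<or> mate x \<in> set w"
  then show "{x, mate x} \<in> C" using *[of x] *[of "mate x"] mate(3)[OF x] by (auto simp: insert_commute)
qed

lemma face_walk_blue:
  assumes fw: "face_walk C w" "C \<in> GC" and "{x, y} \<in> C" "blue x y"
  obtains i where "{x, y} = {mate (cyclic_nth w i), cyclic_nth w (i + 1)}"
proof -
  have "{x, y} \<noteq> {z, mate z}" if "z \<in> set w" for z
  proof
    assume "{x, y} = {z, mate z}"
    moreover have "z \<in> verts \<Gamma>" using that fw(1) by (auto simp: face_walk_def)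
    ultimately show False using assms(4) mate(5)[of z] by (simp add: blue_def)
  qed
  then have "{x, y} \<in> range (\<lambda>i. {mate (cyclic_nth w i), cyclic_nth w (i + 1)})"
    using assms(3) fw(1) unfolding face_walk_def by blast
  then show thesis using that by blast
qed

text \<open>The red edge at a vertex is unique, and so is the blue edge of \<open>C\<close> there,
  so one listed vertex determines the walk. Two walks list either the same half of the vertices of
  \<open>C\<close> and differ by a rotation, or complementary halves and run in opposite
  directions.\<close>

lemma face_walk_unique:
  assumes fw: "face_walk C w" "face_walk C w'" and C: "C \<in> GC"
  shows "(\<exists>r. \<forall>i. cyclic_nth w' (i + r) = cyclic_nth w i) \<or> (\<exists>r. \<forall>i. cyclic_nth w' (r - i) = mate (cyclic_nth w i))"
proof -
  note D = face_walkD[OF fw(1) C] and D' = face_walkD[OF fw(2) C]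
  have next_unique: "u = v" if "blue x u" "blue x v" "{x, u} \<in> C" "{x, v} \<in> C" for x u v
    using girth_cycle_at(2)[OF C that(3)] that by blast
  have per: "cyclic_nth w i = cyclic_nth w (i mod int (length w))" for i by (simp add: cyclic_nth_mod)
  have mod: "cyclic_nth w' i = cyclic_nth w' j" if "i mod int (length w) = j mod int (length w)" for i j
    using that D(3) D'(3) by (simp add: cyclic_nth_def)
  have "cyclic_nth w 0 \<in> set w' \<or> mate (cyclic_nth w 0) \<in> set w'"
    using face_walk_red[OF fw(2) C D(2)] D(7) by simp
  then consider r where "cyclic_nth w' r = cyclic_nth w 0" | r where "cyclic_nth w' r = mate (cyclic_nth w 0)"
    unfolding range_cyclic_nth[OF D'(1), symmetric] by auto
  then show ?thesis
  proof cases
    case 1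
    have n: "cyclic_nth w' (int n + r) = cyclic_nth w (int n)" for n
    proof (induction n)
      case (Suc n)
      have "blue (mate (cyclic_nth w (int n))) (cyclic_nth w' (int n + r + 1))"
        "{mate (cyclic_nth w (int n)), cyclic_nth w' (int n + r + 1)} \<in> C"
        using D'(6,8)[of "int n + r"] Suc by auto
      then have "cyclic_nth w' (int n + r + 1) = cyclic_nth w (int n + 1)"
        using next_unique[OF _ D(6) _ D(8)] by blast
      then show ?case by (simp add: algebra_simps)
    qed (use 1 in simp)
    \<comment> \<open>The induction reaches natural indices; periodicity extends it to all
      integers.\<close>
    have "cyclic_nth w' (i + r) = cyclic_nth w i" for i
    proof -
      define n where "n = nat (i mod int (length w))"
      have "int n = i mod int (length w)" using D(1) by (simp add: n_def)
      then show ?thesis using n[of n] per[of i] mod[of "i + r" "int n + r"] by (simp add: mod_simps)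
    qed
    then show ?thesis by blast
  next
    case 2
    have n: "cyclic_nth w' (r - int n) = mate (cyclic_nth w (int n))" for n
    proof (induction n)
      case (Suc n)
      let ?y = "cyclic_nth w' (r - int n - 1)"
      have "blue (mate (cyclic_nth w (int n))) (mate ?y)" "{mate (cyclic_nth w (int n)), mate ?y} \<in> C"
        using D'(6,8)[of "r - int n - 1"] Suc blue_sym[of "mate ?y"] by (auto simp: insert_commute)
      then have "mate ?y = cyclic_nth w (int n + 1)" using next_unique[OF _ D(6) _ D(8)] by blast
      then have "?y = mate (cyclic_nth w (int n + 1))" using mate(3)[OF D'(2)] by metis
      then show ?case by (simp add: algebra_simps)
    qed (use 2 in simp)
    have "cyclic_nth w' (r - i) = mate (cyclic_nth w i)" for i
    proof -
      define n where "n = nat (i mod int (length w))"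
      have "int n = i mod int (length w)" using D(1) by (simp add: n_def)
      then show ?thesis using n[of n] per[of i] mod[of "r - i" "r - int n"] by (simp add: mod_simps)
    qed
    then show ?thesis by blast
  qed
qed

end

section \<open>Blue components\<close>

context cubic_112
begin

definition blue_component :: "'a \<Rightarrow> 'a set" where
  "blue_component x = {y. (x, y) \<in> {(x, y). blue x y}\<^sup>*}"

lemma blue_component_self: "x \<in> blue_component x"
  by (simp add: blue_component_def)

lemma blue_component_eq_iff: "blue_component x = blue_component y \<longleftrightarrow> y \<in> blue_component x"
proof
  assume "blue_component x = blue_component y"
  then show "y \<in> blue_component x" using blue_component_self by simp
next
  have "sym {(x, y). blue x y}" using blue_sym by (auto intro!: symI)
  then have s: "sym ({(x, y). blue x y}\<^sup>*)" by (rule sym_rtrancl)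
  assume "y \<in> blue_component x"
  then have "(x, y) \<in> {(x, y). blue x y}\<^sup>*" "(y, x) \<in> {(x, y). blue x y}\<^sup>*"
    using s by (auto simp: blue_component_def dest: symD)
  then show "blue_component x = blue_component y" by (auto simp: blue_component_def)
qed

lemma blue_component_blue: "blue x y \<Longrightarrow> blue_component x = blue_component y"
  unfolding blue_component_eq_iff by (auto simp: blue_component_def)

lemma blue_component_verts: assumes "x \<in> verts \<Gamma>" shows "blue_component x \<subseteq> verts \<Gamma>"
proof
  fix y assume "y \<in> blue_component x"
  then have "(x, y) \<in> {(x, y). blue x y}\<^sup>*" by (simp add: blue_component_def)
  then show "y \<in> verts \<Gamma>" using assms blue_verts by (induction rule: rtrancl_induct) auto
qed

lemma blue_third:
  assumes "blue x y" shows "\<exists>u. blue y u \<and> u \<noteq> x"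
proof -
  have "y \<in> verts \<Gamma>" using blue_verts assms by blast
  then obtain a b where "a \<noteq> b" "{u. blue y u} = {a, b}" by (rule neighbours)
  then have "blue y a" "blue y b" "a \<noteq> x \<or> b \<noteq> x" by auto
  then show ?thesis by blast
qed

lemma blue_neighbours:
  assumes "blue v a" "blue v b" "a \<noteq> b" shows "blue v u \<longleftrightarrow> u = a \<or> u = b"
proof -
  have "v \<in> verts \<Gamma>" using blue_verts assms by blast
  then obtain x y where "{u. blue v u} = {x, y}" by (rule neighbours)
  then have "blue v u \<longleftrightarrow> u = x \<or> u = y" for u by blast
  then show ?thesis using assms by metis
qed

text \<open>Walk along blue edges without turning back. By finiteness some vertex recurs, and since
  all blue degrees are 2 the first vertex to recur is the start.\<close>

lemma blue_component_cycle:
  assumes s: "s \<in> verts \<Gamma>"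
  shows "\<exists>k S. 3 \<le> k \<and> inj_on S {..<k} \<and> S ` {..<k} = blue_component s \<and>
    (\<forall>j<k. blue (S j) (S (Suc j mod k))) \<and>
    (\<forall>x\<in>blue_component s. \<forall>y. blue x y \<longrightarrow> (\<exists>j<k. {x, y} = {S j, S (Suc j mod k)}))"
proof -
  obtain a b where "{u. blue s u} = {a, b}" using neighbours[OF s] by metis
  then have "blue s a" by blast
  \<comment> \<open>The state is the pair of previous and current vertex, so that a step can avoid
    going back.\<close>
  define nx where "nx p = (snd p, SOME u. blue (snd p) u \<and> u \<noteq> fst p)" for p
  define P where "P n = (nx ^^ n) (s, a)" for n
  define Q where "Q n = fst (P n)" for n
  have PS: "P (Suc n) = nx (P n)" for n by (simp add: P_def)
  have inv: "blue (fst (P n)) (snd (P n))" for n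
  proof (induction n)
    case 0
    then show ?case using \<open>blue s a\<close> by (simp add: P_def)
  next
    case (Suc n)
    then show ?case unfolding PS nx_def using someI_ex[OF blue_third[OF Suc]] by simp
  qed
  have QS: "snd (P n) = Q (Suc n)" for n by (simp add: Q_def PS nx_def)
  have bl: "blue (Q n) (Q (Suc n))" for n using inv[of n] by (simp add: QS) (simp add: Q_def)
  have nb: "Q (Suc (Suc n)) \<noteq> Q n" for n
  proof -
    have "Q (Suc (Suc n)) = (SOME u. blue (snd (P n)) u \<and> u \<noteq> fst (P n))"
      unfolding Q_def PS nx_def by simp
    then show ?thesis using someI_ex[OF blue_third[OF inv[of n]]] by (simp add: Q_def)
  qed
  have irr: "Q (Suc n) \<noteq> Q n" for n using bl[of n] blue_verts by metis
  have nbr: "blue (Q (Suc n)) u \<longleftrightarrow> u = Q n \<or> u = Q (Suc (Suc n))" for n u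
    using blue_neighbours[of "Q (Suc n)" "Q n" "Q (Suc (Suc n))"] bl blue_sym nb by metis
  have "\<exists>j. \<exists>i<j. Q i = Q j"
  proof (rule ccontr)
    assume none: "\<not> (\<exists>j. \<exists>i<j. Q i = Q j)"
    then have "inj Q" by (intro linorder_injI) auto
    moreover have "range Q \<subseteq> verts \<Gamma>" using bl blue_verts by blast
    ultimately show False using finite_verts by (metis finite_imageD finite_subset infinite_UNIV_nat)
  qed
  define k where "k = (LEAST j. \<exists>i<j. Q i = Q j)"
  have kex: "\<exists>i<k. Q i = Q k" unfolding k_def by (rule LeastI_ex) fact
  then obtain i where i: "i < k" "Q i = Q k" by blast
  have nol: "Q a \<noteq> Q b" if "a < b" "b < k" for a b
    using not_less_Least[of b "\<lambda>j. \<exists>i<j. Q i = Q j"] that unfolding k_def by blast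
  have inj: "inj_on Q {..<k}"
  proof (rule inj_onI)
    fix a b assume "a \<in> {..<k}" "b \<in> {..<k}" "Q a = Q b"
    then show "a = b" using nol[of a b] nol[of b a] by (metis lessThan_iff linorder_neqE_nat)
  qed
  obtain k' where k': "k = Suc k'" using i by (cases k) auto
  \<comment> \<open>Otherwise the last vertex before the return is a blue neighbour of
    \<open>Q i\<close>, hence \<open>Q (i - 1)\<close> or \<open>Q (i + 1)\<close>; this gives an
    earlier recurrence, a loop or a reversal of direction.\<close>
  have "i = 0"
  proof (rule ccontr)
    assume "i \<noteq> 0"
    then obtain i' where i': "i = Suc i'" by (cases i) auto
    have "blue (Q (Suc i')) (Q k')" using bl[of k'] i i' k' blue_sym by metis
    then consider "Q k' = Q i'" | "Q k' = Q (Suc i)" using nbr[of i' "Q k'"] i' by blast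
    then show False
    proof cases
      case 1
      then show False using nol[of i' k'] i i' k' by simp
    next
      case 2
      show False
      proof (cases "Suc i < k'")
        case True
        then show False using nol[of "Suc i" k'] 2 k' by simp
      next
        case False
        then have "Suc i = k' \<or> Suc i = k" using i k' by auto
        then show False using i 2 k' nb[of i] irr[of k'] by auto
      qed
    qed
  qed
  then have Qk: "Q k = Q 0" using i by simp
  have k3: "3 \<le> k"
  proof (rule ccontr)
    assume "\<not> 3 \<le> k"
    then have "k = 1 \<or> k = 2" using i by auto
    then show False using Qk irr[of 0] nb[of 0] by (auto simp: numeral_2_eq_2)
  qed
  have modk: "Q (Suc j mod k) = Q (Suc j)" if "j < k" for j
    using that Qk by (cases "Suc j = k") auto
  \<comment> \<open>Vertex 0 is special: its second blue neighbour \<open>Q k'\<close> is joined to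
    it by the closing edge.\<close>
  have close: "\<exists>l<k. {Q j, y} = {Q l, Q (Suc l mod k)}" if j: "j < k" and y: "blue (Q j) y" for j y
  proof (cases j)
    case 0
    have "blue (Q 0) (Q k')" using bl[of k'] Qk k' blue_sym by metis
    moreover have "Q (Suc 0) \<noteq> Q k'" using nol[of "Suc 0" k'] k3 k' by simp
    ultimately have "y = Q (Suc 0) \<or> y = Q k'" using blue_neighbours[OF bl[of 0], of "Q k'" y] y 0 by blast
    then show ?thesis
    proof
      assume "y = Q (Suc 0)"
      then show ?thesis using modk[of 0] 0 k3 by (intro exI[of _ 0]) simp
    next
      assume "y = Q k'"
      then show ?thesis using modk[of k'] 0 k' Qk by (intro exI[of _ k']) (simp add: insert_commute)
    qed
  next
    case (Suc j')
    then consider "y = Q j'" | "y = Q (Suc j)" using nbr y by blast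
    then show ?thesis
    proof cases
      case 1
      then show ?thesis using modk[of j'] Suc j by (intro exI[of _ j']) (simp add: insert_commute)
    next
      case 2
      then show ?thesis using modk[OF j] j by (intro exI[of _ j]) simp
    qed
  qed
  have Q0: "Q 0 = s" by (simp add: Q_def P_def)
  have comp: "Q ` {..<k} = blue_component s"
  proof (intro equalityI subsetI)
    have Qin: "Q n \<in> blue_component s" for n
    proof (induction n)
      case (Suc n)
      then show ?case using bl[of n] unfolding blue_component_def by (auto intro: rtrancl_into_rtrancl)
    qed (simp add: Q0 blue_component_self)
    then show "x \<in> blue_component s" if "x \<in> Q ` {..<k}" for x using that by blast
    fix x assume "x \<in> blue_component s"
    then have "(s, x) \<in> {(x, y). blue x y}\<^sup>*" by (simp add: blue_component_def)
    then show "x \<in> Q ` {..<k}"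
    proof (induction rule: rtrancl_induct)
      case base
      then show ?case using Q0 k3 by (intro image_eqI[of _ _ 0]) auto
    next
      case (step y z)
      then obtain j where j: "j < k" "y = Q j" by blast
      then obtain l where l: "l < k" "{y, z} = {Q l, Q (Suc l mod k)}" using close[of j z] step by auto
      have "Suc l mod k < k" using k3 by simp
      moreover have "z = Q l \<or> z = Q (Suc l mod k)" using l by auto
      ultimately show ?case using l(1) by auto
    qed
  qed
  show ?thesis
  proof (intro exI[of _ k] exI[of _ Q] conjI)
    show "\<forall>j<k. blue (Q j) (Q (Suc j mod k))" using bl modk by simp
    show "\<forall>x\<in>blue_component s. \<forall>y. blue x y \<longrightarrow> (\<exists>j<k. {x, y} = {Q j, Q (Suc j mod k)})"
      unfolding comp[symmetric] using close by auto
  qed (use k3 inj comp in auto)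
qed

text \<open>The component is a cycle, so its length is at least \<open>g\<close>; equality would
  make it a girth cycle without red edges.\<close>

lemma girth_less_blue_component:
  assumes s: "s \<in> verts \<Gamma>"
  shows "g < card (blue_component s)"
proof -
  from blue_component_cycle[OF s] obtain k S where k: "3 \<le> k" and inj: "inj_on S {..<k}"
    and comp: "S ` {..<k} = blue_component s" and bl: "\<forall>j<k. blue (S j) (S (Suc j mod k))"
    by (elim exE conjE) (rule that)
  define V where "V i = S (nat (i mod int k))" for i
  have lt: "nat (i mod int k) < k" for i using k by (simp add: nat_less_iff)
  have Vinj: "V i = V j \<longleftrightarrow> i mod int k = j mod int k" for i j
  proof -
    have "V i = V j \<longleftrightarrow> nat (i mod int k) = nat (j mod int k)"
      unfolding V_def using inj lt by (auto simp: inj_on_def)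
    then show ?thesis using k by (simp add: eq_nat_nat_iff)
  qed
  have Vb: "blue (V i) (V (i + 1))" for i
  proof -
    define j where "j = nat (i mod int k)"
    have j: "j < k" "int j = i mod int k" using k lt by (auto simp: j_def)
    have "int (Suc j mod k) = (i + 1) mod int k" using j(2) by (simp add: zmod_int add.commute mod_simps)
    then have "nat ((i + 1) mod int k) = Suc j mod k" by linarith
    then show ?thesis using bl j unfolding V_def j_def by metis
  qed
  have Vv: "V i \<in> verts \<Gamma>" for i using blue_verts[OF Vb] by blast
  have param: "cycle_param \<Gamma> k V"
    unfolding cycle_param_def using k Vinj Vb Vv by (auto simp: blue_def)
  let ?C = "range (\<lambda>i. {V i, V (i + 1)})"
  have cyc: "is_cycle \<Gamma> k ?C" using param is_cycle_iff_cycle_param by blast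
  then have "g \<le> k" by (rule girth_le)
  moreover have "g \<noteq> k"
  proof
    assume "g = k"
    then have C: "?C \<in> GC" using cyc by (simp add: GC_iff)
    have "{V 0, V (0 + 1)} \<in> ?C" by blast
    then have "{V 0, mate (V 0)} \<in> ?C" by (rule girth_cycle_at(1)[OF C])
    then obtain i where "{V 0, mate (V 0)} = {V i, V (i + 1)}" by blast
    moreover have "V 0 \<in> verts \<Gamma>" using Vb blue_verts by blast
    ultimately show False using Vb[of i] mate(5)[of "V 0"] by (simp add: blue_def)
  qed
  moreover have "card (blue_component s) = k" using card_image[OF inj] comp by simp
  ultimately show ?thesis by simp
qed

end

section \<open>The map of girth cycles\<close>

context cubic_112
begin

text \<open>One walk is chosen for each girth cycle: a second walk along the same cycle would attach a
  second disk.\<close>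

definition walk_of :: "'a set set \<Rightarrow> 'a list" where
  "walk_of C = (SOME w. face_walk C w)"

definition girth_map :: "('a set, 'a) premap" where
  "girth_map = \<lparr>nodes = blue_component ` verts \<Gamma>, arcs = verts \<Gamma>, ainv = mate, tail = blue_component,
     faces = walk_of ` GC\<rparr>"

lemma girth_map_simps [simp]:
  "nodes girth_map = blue_component ` verts \<Gamma>" "arcs girth_map = verts \<Gamma>" "ainv girth_map = mate"
  "tail girth_map = blue_component" "faces girth_map = walk_of ` GC"
  by (simp_all add: girth_map_def)

lemma face_walk_walk_of: "C \<in> GC \<Longrightarrow> face_walk C (walk_of C)"
  unfolding walk_of_def by (rule someI_ex) (rule face_walk_exists)

lemma inj_on_walk_of: "inj_on walk_of GC"
proof (rule inj_onI)
  fix C D assume "C \<in> GC" "D \<in> GC" "walk_of C = walk_of D"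
  then have "face_walk C (walk_of C)" "face_walk D (walk_of C)" using face_walk_walk_of by metis+
  then show "C = D" unfolding face_walk_def by metis
qed

lemma walk_of_nth:
  assumes C: "C \<in> GC" and i: "i < length (walk_of C)"
  shows "walk_of C ! i \<in> verts \<Gamma>"
    "blue (mate (walk_of C ! i)) (walk_of C ! (Suc i mod length (walk_of C)))"
    "{mate (walk_of C ! i), walk_of C ! (Suc i mod length (walk_of C))} \<in> C"
  using face_walkD(2,6,8)[OF face_walk_walk_of[OF C] C, of "int i"] i
  by (simp_all add: cyclic_nth_nat cyclic_nth_Suc)

lemma walk_of_corner:
  assumes C: "C \<in> GC" and "{x, y} \<in> C" "blue x y"
  obtains i where "i < length (walk_of C)"
    "{x, y} = {mate (walk_of C ! i), walk_of C ! (Suc i mod length (walk_of C))}"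
proof -
  note fw = face_walk_walk_of[OF C]
  let ?w = "walk_of C"
  obtain i where i: "{x, y} = {mate (cyclic_nth ?w i), cyclic_nth ?w (i + 1)}"
    using face_walk_blue[OF fw C] assms by metis
  define j where "j = nat (i mod int (length ?w))"
  have ne: "?w \<noteq> []" by (rule face_walkD(1)[OF fw C])
  have j: "j < length ?w" "int j = i mod int (length ?w)" using ne by (auto simp: j_def nat_less_iff)
  have "cyclic_nth ?w i = ?w ! j" by (simp add: cyclic_nth_def j_def)
  moreover have "cyclic_nth ?w (i + 1) = cyclic_nth ?w (int j + 1)"
    by (simp add: cyclic_nth_def j(2) mod_simps)
  ultimately show thesis using that[OF j(1)] i cyclic_nth_Suc[OF j(1)] by simp
qed

text \<open>The unordered pairs could also agree crosswise, which is excluded because no listed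
  vertex is the mate of a listed one. What remains is injectivity of \<open>mate\<close> and
  distinctness of the walk.\<close>

lemma walk_of_corner_unique:
  assumes C: "C \<in> GC" and i: "i < length (walk_of C)" and j: "j < length (walk_of C)"
    and eq: "{mate (walk_of C ! i), walk_of C ! (Suc i mod length (walk_of C))} =
        {mate (walk_of C ! j), walk_of C ! (Suc j mod length (walk_of C))}"
  shows "i = j"
proof -
  let ?w = "walk_of C"
  note fw = face_walk_walk_of[OF C]
  note D = face_walkD[OF fw C]
  have "?w ! (Suc j mod length ?w) \<noteq> mate (?w ! i)"
    using D(5)[of "int j + 1" "int i"] i j by (simp add: cyclic_nth_nat cyclic_nth_Suc)
  then have "mate (?w ! i) = mate (?w ! j)" using eq by (auto simp: doubleton_eq_iff)
  then have "?w ! i = ?w ! j" using mate_eq_iff walk_of_nth(1)[OF C] i j by metis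
  then show ?thesis using D(4) i j by (simp add: nth_eq_iff_index_eq)
qed

lemma two_girth_cycles:
  assumes s: "s \<in> verts \<Gamma>"
  obtains C D where "C \<noteq> D" "{B \<in> GC. {s, mate s} \<in> B} = {C, D}"
proof -
  have "card {B \<in> GC. {s, mate s} \<in> B} = 2" using mate(5)[OF s] by (simp add: eps_def)
  then show thesis using that by (auto simp: card_2_iff)
qed

lemma GC_nonempty: "GC \<noteq> {}"
proof -
  obtain s where s: "s \<in> verts \<Gamma>" using connected by (auto simp: connected_graph_def)
  obtain C D where "C \<noteq> D" "{B \<in> GC. {s, mate s} \<in> B} = {C, D}" using two_girth_cycles[OF s] .
  then show ?thesis by blast
qed

lemma walk_of_index:
  assumes C: "C \<in> GC" and s: "s \<in> verts \<Gamma>" and sC: "{s, mate s} \<in> C"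
  obtains i where "i < length (walk_of C)" "walk_of C ! i \<in> {s, mate s}"
    "\<And>j. j < length (walk_of C) \<Longrightarrow> walk_of C ! j \<in> {s, mate s} \<Longrightarrow> j = i"
proof -
  note fw = face_walk_walk_of[OF C]
  let ?w = "walk_of C"
  have "\<exists>i<length ?w. ?w ! i \<in> {s, mate s}"
    using face_walk_red[OF fw C s] sC by (auto simp: in_set_conv_nth)
  then obtain i where i: "i < length ?w" "?w ! i \<in> {s, mate s}" by blast
  have "j = i" if j: "j < length ?w" "?w ! j \<in> {s, mate s}" for j
  proof -
    have "set ?w \<inter> mate ` set ?w = {}" using fw by (simp add: face_walk_def)
    then have "?w ! i \<noteq> mate (?w ! j)" "?w ! j \<noteq> mate (?w ! i)" using i(1) j(1) by (metis disjoint_iff imageI nth_mem)+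
    then have "?w ! i = ?w ! j" using i(2) j(2) mate(3)[OF s] by auto
    then show ?thesis using face_walkD(4)[OF fw C] i j by (simp add: nth_eq_iff_index_eq)
  qed
  then show thesis using that i by blast
qed

text \<open>The two sides of an edge are the two girth cycles through a red edge. The corners at a
  node are the blue edges of its component, each on a single girth cycle, taken in the order of the
  blue cycle.\<close>

lemma polygonal_map_girth_map: "polygonal_map girth_map"
proof unfold_locales
  show "arc_graph girth_map" using mate by (auto simp: arc_graph_def)
  show "simple_closed_walk girth_map w" if face: "w \<in> faces girth_map" for w
  proof -
    obtain C where C: "C \<in> GC" and w: "w = walk_of C" using face by auto
    note fw = face_walk_walk_of[OF C]
    have sub: "set w \<subseteq> verts \<Gamma>" and dis: "distinct w" and dj: "set w \<inter> mate ` set w = {}"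
      using fw by (auto simp: face_walk_def w)
    \<comment> \<open>Distinct listed vertices give the same edge only if they are mates, and no
      listed vertex has its mate listed.\<close>
    have "inj_on (arc_edge girth_map) (set w)"
      using dj by (auto simp: inj_on_def arc_edge_def doubleton_eq_iff)
    then have "distinct (map (arc_edge girth_map) w)" using dis by (simp add: distinct_map)
    then show ?thesis
      using face_walkD(1)[OF fw C] sub blue_component_blue[OF walk_of_nth(2)[OF C]] by (auto simp: simple_closed_walk_def w)
  qed
  show "2 \<le> length w" if "w \<in> faces girth_map" for w
    using that half_girth[OF GC_nonempty] face_walkD(3)[OF face_walk_walk_of] by auto
  show "finite (faces girth_map)" using finite_GC by simp
  show "\<exists>w\<in>faces girth_map. s \<in> set w \<or> ainv girth_map s \<in> set w" if s: "s \<in> arcs girth_map" for s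
  proof -
    have s': "s \<in> verts \<Gamma>" using s by simp
    obtain C D where "C \<noteq> D" "{B \<in> GC. {s, mate s} \<in> B} = {C, D}" using two_girth_cycles[OF s'] .
    then have "C \<in> GC" "{s, mate s} \<in> C" by auto
    then show ?thesis using face_walk_red[OF face_walk_walk_of _ s'] by auto
  qed
  show "\<exists>s\<in>arcs girth_map. tail girth_map s = v" if "v \<in> nodes girth_map" for v using that by auto
  show "\<exists>w0 i0 w1 i1. w0 \<in> faces girth_map \<and> w1 \<in> faces girth_map \<and> w0 \<noteq> w1 \<and>
      i0 < length w0 \<and> i1 < length w1 \<and> w0 ! i0 \<in> {s, ainv girth_map s} \<and> w1 ! i1 \<in> {s, ainv girth_map s} \<and>
      (\<forall>w\<in>faces girth_map. \<forall>i<length w. w ! i \<in> {s, ainv girth_map s} \<longrightarrow> w = w0 \<and> i = i0 \<or> w = w1 \<and> i = i1)"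
    if "s \<in> arcs girth_map" for s
  proof -
    have s: "s \<in> verts \<Gamma>" using that by simp
    obtain C D where CD: "C \<noteq> D" "{B \<in> GC. {s, mate s} \<in> B} = {C, D}" using two_girth_cycles[OF s] .
    then have C: "C \<in> GC" "{s, mate s} \<in> C" and D: "D \<in> GC" "{s, mate s} \<in> D" by auto
    obtain i where i: "i < length (walk_of C)" "walk_of C ! i \<in> {s, mate s}"
      and iu: "\<And>j. j < length (walk_of C) \<Longrightarrow> walk_of C ! j \<in> {s, mate s} \<Longrightarrow> j = i"
      by (rule walk_of_index[OF C(1) s C(2)]) blast
    obtain j where j: "j < length (walk_of D)" "walk_of D ! j \<in> {s, mate s}"
      and ju: "\<And>i. i < length (walk_of D) \<Longrightarrow> walk_of D ! i \<in> {s, mate s} \<Longrightarrow> i = j"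
      by (rule walk_of_index[OF D(1) s D(2)]) blast
    have uniq: "w = walk_of C \<and> l = i \<or> w = walk_of D \<and> l = j"
      if w: "w \<in> walk_of ` GC" and l: "l < length w" "w ! l \<in> {s, mate s}" for w l
    proof -
      obtain B where B: "B \<in> GC" "w = walk_of B" using w by blast
      have "s \<in> set w \<or> mate s \<in> set w" using l by (metis insertE nth_mem singletonD)
      then have "{s, mate s} \<in> B" using face_walk_red[OF face_walk_walk_of[OF B(1)] B(1) s] B(2) by simp
      then have "B = C \<or> B = D" using CD(2) B(1) by blast
      then show ?thesis using iu ju l B by blast
    qed
    have ne: "walk_of C \<noteq> walk_of D" using inj_on_walk_of C D CD(1) by (auto simp: inj_on_def)
    have all: "\<forall>w\<in>walk_of ` GC. \<forall>l<length w. w ! l \<in> {s, mate s} \<longrightarrow> w = walk_of C \<and> l = i \<or> w = walk_of D \<and> l = j"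
      by (intro ballI allI impI uniq)
    show ?thesis
      unfolding girth_map_simps
      by (rule exI[of _ "walk_of C"], rule exI[of _ i], rule exI[of _ "walk_of D"], rule exI[of _ j])
        (intro conjI imageI C(1) D(1) ne i j all)
  qed
  show "\<exists>k S W I. 0 < k \<and> inj_on S {..<k} \<and> inj_on (\<lambda>j. (W j, I j)) {..<k} \<and>
      (\<forall>j<k. W j \<in> faces girth_map \<and> I j < length (W j) \<and> S j \<in> arcs girth_map \<and> tail girth_map (S j) = v \<and>
         (ainv girth_map (W j ! I j) = S j \<and> W j ! (Suc (I j) mod length (W j)) = S (Suc j mod k) \<or>
          ainv girth_map (W j ! I j) = S (Suc j mod k) \<and> W j ! (Suc (I j) mod length (W j)) = S j)) \<and>
      (\<forall>w\<in>faces girth_map. \<forall>i<length w. tail girth_map (ainv girth_map (w ! i)) = v \<longrightarrow> (\<exists>j<k. w = W j \<and> i = I j))"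
    if node: "v \<in> nodes girth_map" for v
  proof -
    obtain s where s: "s \<in> verts \<Gamma>" and v: "v = blue_component s" using node by auto
    from blue_component_cycle[OF s] obtain k S where k: "3 \<le> k" and inj: "inj_on S {..<k}"
      and comp: "S ` {..<k} = blue_component s" and bl: "\<forall>j<k. blue (S j) (S (Suc j mod k))"
      and nbr: "\<forall>x\<in>blue_component s. \<forall>y. blue x y \<longrightarrow> (\<exists>j<k. {x, y} = {S j, S (Suc j mod k)})"
      by (elim exE conjE) (rule that)
    \<comment> \<open>The unique girth cycle through a blue edge supplies the face and the index of
      the corner.\<close>
    have "\<exists>C i. C \<in> GC \<and> i < length (walk_of C) \<and>
        {S j, S (Suc j mod k)} = {mate (walk_of C ! i), walk_of C ! (Suc i mod length (walk_of C))}" if "j < k" for j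
    proof -
      have b: "blue (S j) (S (Suc j mod k))" using bl that by blast
      then have "card {C \<in> GC. {S j, S (Suc j mod k)} \<in> C} = 1" by (simp add: blue_def eps_def)
      then obtain C where C: "C \<in> GC" "{S j, S (Suc j mod k)} \<in> C"
        by (metis (no_types, lifting) card.empty empty_Collect_eq zero_neq_one)
      obtain i where "i < length (walk_of C)"
        "{S j, S (Suc j mod k)} = {mate (walk_of C ! i), walk_of C ! (Suc i mod length (walk_of C))}"
        using walk_of_corner[OF C b] .
      then show ?thesis using C by blast
    qed
    then obtain C I where CI: "\<And>j. j < k \<Longrightarrow> C j \<in> GC \<and> I j < length (walk_of (C j)) \<and>
        {S j, S (Suc j mod k)} = {mate (walk_of (C j) ! I j), walk_of (C j) ! (Suc (I j) mod length (walk_of (C j)))}"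
      by metis
    let ?W = "\<lambda>j. walk_of (C j)"
    \<comment> \<open>Only a cycle of length 2 could use the same edge once in each direction, and
      \<open>k\<close> is at least 3.\<close>
    have edge_inj: "j = l" if j: "j < k" and l: "l < k" and e: "{S j, S (Suc j mod k)} = {S l, S (Suc l mod k)}" for j l
    proof -
      have m: "Suc j mod k < k" "Suc l mod k < k" using k by auto
      have "S j = S l \<or> S j = S (Suc l mod k) \<and> S (Suc j mod k) = S l" using e by (auto simp: doubleton_eq_iff)
      then have "j = l \<or> j = Suc l mod k \<and> Suc j mod k = l" using inj j l m by (auto simp: inj_on_def)
      then show ?thesis using j l k by (auto simp: mod_Suc split: if_splits)
    qed
    have "inj_on (\<lambda>j. (?W j, I j)) {..<k}"
    proof (rule inj_onI)
      fix j l assume "j \<in> {..<k}" "l \<in> {..<k}" "(?W j, I j) = (?W l, I l)"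
      then show "j = l" using edge_inj[of j l] CI[of j] CI[of l] by simp
    qed
    moreover have "?W j \<in> faces girth_map \<and> I j < length (?W j) \<and> S j \<in> arcs girth_map \<and> tail girth_map (S j) = v \<and>
         (ainv girth_map (?W j ! I j) = S j \<and> ?W j ! (Suc (I j) mod length (?W j)) = S (Suc j mod k) \<or>
          ainv girth_map (?W j ! I j) = S (Suc j mod k) \<and> ?W j ! (Suc (I j) mod length (?W j)) = S j)" if j: "j < k" for j
    proof -
      have "S j \<in> blue_component s" using comp j by blast
      then have "S j \<in> verts \<Gamma>" "blue_component (S j) = v"
        using blue_component_verts[OF s] blue_component_eq_iff[of s "S j"] v by auto
      then show ?thesis using CI[OF j] by (auto simp: doubleton_eq_iff)
    qed
    moreover have "\<exists>j<k. w = ?W j \<and> i = I j"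
      if w: "w \<in> faces girth_map" and i: "i < length w" and t: "tail girth_map (ainv girth_map (w ! i)) = v" for w i
    proof -
      obtain B where B: "B \<in> GC" "w = walk_of B" using w by auto
      let ?x = "mate (w ! i)" and ?y = "w ! (Suc i mod length w)"
      have b: "blue ?x ?y" "{?x, ?y} \<in> B" using walk_of_nth(2,3)[OF B(1)] i B(2) by auto
      have "blue_component s = blue_component ?x" using t v by simp
      then have "?x \<in> blue_component s" using blue_component_eq_iff by blast
      then obtain j where j: "j < k" "{?x, ?y} = {S j, S (Suc j mod k)}" using nbr b(1) by blast
      have Cj: "C j \<in> GC" "{?x, ?y} \<in> C j" using CI[OF j(1)] walk_of_nth(3)[of "C j" "I j"] j(2) by auto
      have "B = C j" using unique_girth_cycle[of "{?x, ?y}" B "C j"] b B(1) Cj by (simp add: blue_def)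
      moreover have "i = I j"
        using walk_of_corner_unique[OF Cj(1), of i "I j"] CI[OF j(1)] j(2) i B(2) \<open>B = C j\<close> by simp
      ultimately show ?thesis using j B by blast
    qed
    moreover have "0 < k" using k by simp
    ultimately show ?thesis using inj by (intro exI[of _ k] exI[of _ S] exI[of _ ?W] exI[of _ I]) blast
  qed
qed

text \<open>A path in \<open>\<Gamma>\<close> projects to the skeleton: blue steps stay at one node
  and red steps follow an arc.\<close>

lemma connected_arc_graph_girth_map: "connected_arc_graph girth_map"
proof -
  let ?R = "{(tail girth_map s, tail girth_map (ainv girth_map s)) | s. s \<in> arcs girth_map}"
  have "(blue_component s, blue_component t) \<in> ?R\<^sup>*" if "s \<in> verts \<Gamma>" "t \<in> verts \<Gamma>" for s t
  proof -
    have "(s, t) \<in> {(x, y). {x, y} \<in> edges \<Gamma>}\<^sup>*" using connected that by (simp add: connected_graph_def)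
    then show ?thesis
    proof (induction rule: rtrancl_induct)
      case (step x y)
      then have e: "{x, y} \<in> edges \<Gamma>" by simp
      then have "x \<in> verts \<Gamma>" using edge_verts by blast
      then have "(blue_component x, blue_component (mate x)) \<in> ?R" by auto
      then show ?case using edge_cases[OF e] blue_component_blue[of x y] step.IH by (auto intro: rtrancl_into_rtrancl)
    qed simp
  qed
  then show ?thesis using connected by (auto simp: connected_arc_graph_def connected_graph_def)
qed

lemma is_map_girth_map: "is_map girth_map"
proof -
  interpret polygonal_map girth_map by (rule polygonal_map_girth_map)
  show ?thesis
    unfolding is_map_def
    using arc_graph connected_arc_graph_girth_map walks closed_surface_surface by blast
qed

lemma length_girth_map_face: "w \<in> faces girth_map \<Longrightarrow> length w = g div 2"
  using face_walkD(3)[OF face_walk_walk_of] by auto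

text \<open>A corner of a face pairs the mate of a listed vertex with the next listed vertex, which
  is a blue edge; conversely every blue edge lies on a girth cycle and so is one of its
  corners.\<close>

lemma dihedral_scheme_girth_map: "dihedral_scheme girth_map s t \<longleftrightarrow> blue s t"
proof
  assume "dihedral_scheme girth_map s t"
  then obtain C i where "C \<in> GC" "i < length (walk_of C)"
    "{s, t} = {mate (walk_of C ! i), walk_of C ! (Suc i mod length (walk_of C))}"
    by (auto simp: dihedral_scheme_def)
  then show "blue s t" using walk_of_nth(2)[of C i] blue_sym by (auto simp: doubleton_eq_iff)
next
  assume b: "blue s t"
  then have "card {C \<in> GC. {s, t} \<in> C} = 1" by (simp add: blue_def eps_def)
  then obtain C where C: "C \<in> GC" "{s, t} \<in> C"
    by (metis (no_types, lifting) card.empty empty_Collect_eq zero_neq_one)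
  obtain i where "i < length (walk_of C)"
    "{s, t} = {mate (walk_of C ! i), walk_of C ! (Suc i mod length (walk_of C))}"
    using walk_of_corner[OF C b] .
  then show "dihedral_scheme girth_map s t"
    using C blue_component_blue[OF b] unfolding dihedral_scheme_def girth_map_simps by blast
qed

lemma truncation_girth_map: "isomorphic_graphs \<Gamma> (truncation girth_map)"
proof -
  have "{u, v} \<in> edges \<Gamma> \<longleftrightarrow> {u, v} \<in> edges (truncation girth_map)" if u: "u \<in> verts \<Gamma>" and v: "v \<in> verts \<Gamma>" for u v
  proof
    assume e: "{u, v} \<in> edges \<Gamma>"
    then have "blue u v \<or> v = mate u" "u \<noteq> v" using edge_cases edge_verts by blast+
    then show "{u, v} \<in> edges (truncation girth_map)"
      using u v dihedral_scheme_girth_map by (auto simp: truncation_def)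
  next
    assume "{u, v} \<in> edges (truncation girth_map)"
    then obtain s t where st: "{u, v} = {s, t}" "s \<in> verts \<Gamma>" "blue s t \<or> t = mate s"
      using dihedral_scheme_girth_map by (auto simp: truncation_def)
    then show "{u, v} \<in> edges \<Gamma>" using edge_iff[of s t] by simp
  qed
  then have "graph_iso id \<Gamma> (truncation girth_map)"
    by (simp add: graph_iso_def truncation_def)
  then show ?thesis unfolding isomorphic_graphs_def by blast
qed

text \<open>Double counting of vertices against girth cycles containing their red edge: each vertex
  has two such cycles and each girth cycle has \<open>g\<close> such vertices, so
  \<open>2 * card (verts \<Gamma>) = card GC * g\<close>.\<close>

lemma half_girth_dvd_order: "g div 2 dvd card (verts \<Gamma>)"
proof -
  have "card {s \<in> verts \<Gamma>. {s, mate s} \<in> C} = g" if C: "C \<in> GC" for C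
  proof -
    note fw = face_walk_walk_of[OF C]
    let ?w = "walk_of C"
    have sub: "set ?w \<subseteq> verts \<Gamma>" and dj: "set ?w \<inter> mate ` set ?w = {}" and dis: "distinct ?w" and len: "length ?w = g div 2"
      using fw by (auto simp: face_walk_def)
    have "{s \<in> verts \<Gamma>. {s, mate s} \<in> C} = set ?w \<union> mate ` set ?w"
    proof (intro equalityI subsetI)
      fix s assume "s \<in> {s \<in> verts \<Gamma>. {s, mate s} \<in> C}"
      then have s: "s \<in> verts \<Gamma>" "s \<in> set ?w \<or> mate s \<in> set ?w" using face_walk_red[OF fw C] by auto
      then show "s \<in> set ?w \<union> mate ` set ?w" using mate(3)[OF s(1)] by (metis UnI1 UnI2 imageI)
    next
      fix s assume "s \<in> set ?w \<union> mate ` set ?w"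
      then have "s \<in> verts \<Gamma> \<and> (s \<in> set ?w \<or> mate s \<in> set ?w)" using sub mate by auto
      then show "s \<in> {s \<in> verts \<Gamma>. {s, mate s} \<in> C}" using face_walk_red[OF fw C] by auto
    qed
    also have "card \<dots> = card (set ?w) + card (mate ` set ?w)" using dj by (intro card_Un_disjoint) auto
    also have "card (mate ` set ?w) = card (set ?w)"
      by (rule card_image) (use sub mate_eq_iff in \<open>auto simp: inj_on_def\<close>)
    also have "card (set ?w) = g div 2" using dis len by (simp add: distinct_card)
    finally show ?thesis using half_girth[OF GC_nonempty] by auto
  qed
  then have "(\<Sum>s\<in>verts \<Gamma>. card {C \<in> GC. {s, mate s} \<in> C}) = (\<Sum>C\<in>GC. g)"
    using finite_verts finite_GC by (intro sum_multicount_gen) auto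
  moreover have "card {C \<in> GC. {s, mate s} \<in> C} = 2" if "s \<in> verts \<Gamma>" for s
    using mate(5)[OF that] by (simp add: eps_def)
  ultimately have "2 * card (verts \<Gamma>) = card GC * g" by simp
  moreover have "g = 2 * (g div 2)" using half_girth[OF GC_nonempty] by simp
  ultimately have "card (verts \<Gamma>) = card GC * (g div 2)" by (metis mult.left_commute mult_left_cancel zero_neq_numeral)
  then show ?thesis by simp
qed

end

section \<open>Action of graph automorphisms on the map\<close>

context cubic_112
begin

text \<open>An automorphism permutes the girth cycles, so it preserves \<open>eps\<close> and with
  it colours, mates and blue components. The image of a chosen walk need not be the walk chosen for
  the image cycle, but \<open>face_walk_unique\<close> makes them agree up to rotation or
  reversal.\<close>

lemma automorphism_girth_map:
  assumes iso: "graph_iso f \<Gamma> \<Gamma>"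
  shows "x \<in> verts \<Gamma> \<Longrightarrow> blue_component (f x) = f ` blue_component x"
    and "\<exists>\<pi>. map_automorphism girth_map \<pi> \<and> (\<forall>(s, w)\<in>flags girth_map. fst (\<pi> (s, w)) = f s)"
proof -
  have bij: "bij_betw f (verts \<Gamma>) (verts \<Gamma>)" using iso by (simp add: graph_iso_def)
  have inj: "inj_on f (verts \<Gamma>)" and img: "f ` verts \<Gamma> = verts \<Gamma>" using bij by (auto simp: bij_betw_def)
  have fv: "f x \<in> verts \<Gamma>" if "x \<in> verts \<Gamma>" for x using img that by blast
  have feq: "f x = f y \<longleftrightarrow> x = y" if "x \<in> verts \<Gamma>" "y \<in> verts \<Gamma>" for x y using inj that by (auto simp: inj_on_def)
  have fe: "{f u, f v} \<in> edges \<Gamma> \<longleftrightarrow> {u, v} \<in> edges \<Gamma>" if "u \<in> verts \<Gamma>" "v \<in> verts \<Gamma>" for u v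
    using iso that by (simp add: graph_iso_def)
  define F where "F C = (`) f ` C" for C :: "'a set set"
  \<comment> \<open>\<open>f\<close> is known to be injective only on the vertices, so injectivity
    is lifted first to edges and then to girth cycles.\<close>
  have "\<Union> (edges \<Gamma>) \<subseteq> verts \<Gamma>" using simple by (auto simp: simple_graph_def)
  then have injE: "inj_on ((`) f) (edges \<Gamma>)" using inj by (intro inj_on_image) (rule inj_on_subset)
  have "\<Union> GC \<subseteq> edges \<Gamma>" using GC_edges by blast
  then have injF: "inj_on F GC" unfolding F_def by (rule inj_on_image[OF inj_on_subset[OF injE]])
  have FGC: "F C \<in> GC" if "C \<in> GC" for C
  proof -
    obtain V where V: "cycle_param \<Gamma> g V" and CV: "C = range (\<lambda>i. {V i, V (i + 1)})"
      using \<open>C \<in> GC\<close> by (auto simp: GC_iff is_cycle_iff_cycle_param)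
    have Vv: "V i \<in> verts \<Gamma>" for i using V unfolding cycle_param_def by blast
    have "cycle_param \<Gamma> g (\<lambda>i. f (V i))"
      using V feq[OF Vv Vv] fe[OF Vv Vv] fv[OF Vv] unfolding cycle_param_def by auto
    moreover have "F C = range (\<lambda>i. {f (V i), f (V (i + 1))})" by (simp add: F_def CV image_image)
    ultimately show ?thesis unfolding GC_iff is_cycle_iff_cycle_param by blast
  qed
  have surjF: "F ` GC = GC" using endo_inj_surj[OF finite_GC _ injF] FGC by blast
  have eps: "eps \<Gamma> (f ` e) = eps \<Gamma> e" if e: "e \<in> edges \<Gamma>" for e
  proof -
    have mem: "f ` e \<in> F C \<longleftrightarrow> e \<in> C" if "C \<in> GC" for C
      unfolding F_def using inj_on_image_mem_iff[OF injE e GC_edges[OF that]] .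
    have "F ` {C \<in> GC. e \<in> C} = {C \<in> GC. f ` e \<in> C}"
    proof (intro equalityI subsetI)
      fix D assume D: "D \<in> {C \<in> GC. f ` e \<in> C}"
      then have "D \<in> F ` GC" unfolding surjF by simp
      then obtain C where C: "C \<in> GC" "D = F C" by (rule imageE) auto
      then have "e \<in> C" using D mem[of C] by simp
      then show "D \<in> F ` {C \<in> GC. e \<in> C}" using C by simp
    next
      fix D assume "D \<in> F ` {C \<in> GC. e \<in> C}"
      then obtain C where "C \<in> GC" "e \<in> C" "D = F C" by auto
      then show "D \<in> {C \<in> GC. f ` e \<in> C}" using FGC[of C] mem[of C] by simp
    qed
    moreover have "inj_on F {C \<in> GC. e \<in> C}" by (rule inj_on_subset[OF injF]) auto
    ultimately show ?thesis unfolding eps_def using card_image[of F "{C \<in> GC. e \<in> C}"] by simp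
  qed
  have fblue: "blue (f x) (f y) \<longleftrightarrow> blue x y" if "x \<in> verts \<Gamma>" "y \<in> verts \<Gamma>" for x y
    using fe[OF that] eps[of "{x, y}"] by (auto simp: blue_def)
  have fmate: "f (mate x) = mate (f x)" if x: "x \<in> verts \<Gamma>" for x
  proof -
    have "red (f x) (f (mate x))"
      using fe[OF x mate(1)[OF x]] eps[OF mate(4)[OF x]] mate(4,5)[OF x] by (simp add: red_def)
    then show ?thesis using red_mate[OF fv[OF x]] by simp
  qed
  show comp: "blue_component (f x) = f ` blue_component x" if x: "x \<in> verts \<Gamma>" for x
  proof (intro equalityI subsetI)
    fix z assume "z \<in> blue_component (f x)"
    then have "(f x, z) \<in> {(x, y). blue x y}\<^sup>*" by (simp add: blue_component_def)
    then show "z \<in> f ` blue_component x"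
    proof (induction rule: rtrancl_induct)
      case base
      then show ?case using blue_component_self by blast
    next
      case (step z z')
      then obtain y where y: "y \<in> blue_component x" "z = f y" by blast
      have b: "blue z z'" using step by simp
      then obtain y' where y': "y' \<in> verts \<Gamma>" "z' = f y'" using blue_verts img by blast
      have "y \<in> verts \<Gamma>" using y blue_component_verts[OF x] by blast
      then have "blue y y'" using fblue y y' b by simp
      then have "y' \<in> blue_component x"
        using y(1) unfolding blue_component_def by (auto intro: rtrancl_into_rtrancl)
      then show ?case using y' by blast
    qed
  next
    fix z assume "z \<in> f ` blue_component x"
    then obtain y where y: "(x, y) \<in> {(x, y). blue x y}\<^sup>*" "z = f y" by (auto simp: blue_component_def)
    from y(1) have "f y \<in> blue_component (f x)"
    proof (induction rule: rtrancl_induct)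
      case base
      then show ?case by (rule blue_component_self)
    next
      case (step y y')
      then have "blue (f y) (f y')" using fblue blue_verts[of y y'] by simp
      then show ?case using step.IH unfolding blue_component_def by (auto intro: rtrancl_into_rtrancl)
    qed
    then show "z \<in> blue_component (f x)" using y by simp
  qed
  have fwalk: "face_walk (F C) (map f w)" if fw: "face_walk C w" and C: "C \<in> GC" for C w
  proof -
    note D = face_walkD[OF fw C]
    have sub: "set w \<subseteq> verts \<Gamma>" and dj: "set w \<inter> mate ` set w = {}"
      and Ceq: "C = (\<lambda>x. {x, mate x}) ` set w \<union> range (\<lambda>i. {mate (cyclic_nth w i), cyclic_nth w (i + 1)})"
      using fw by (auto simp: face_walk_def)
    have fm: "f (mate x) = mate (f x)" if "x \<in> set w" for x using fmate sub that by blast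
    have mv: "mate (cyclic_nth w i) \<in> verts \<Gamma>" for i using mate(1)[OF D(2)] .
    have fm': "f (mate (cyclic_nth w i)) = mate (f (cyclic_nth w i))" for i using fmate[OF D(2)] .
    have "distinct (map f w)" using D(4) inj_on_subset[OF inj sub] by (simp add: distinct_map)
    moreover have "set (map f w) \<subseteq> verts \<Gamma>" using sub fv by auto
    moreover have "set (map f w) \<inter> mate ` set (map f w) = {}"
    proof -
      have "f x \<noteq> mate (f y)" if "x \<in> set w" "y \<in> set w" for x y
      proof
        assume "f x = mate (f y)"
        then have "f x = f (mate y)" using fm[OF that(2)] by simp
        then have "x = mate y" using feq[of x "mate y"] mate(1)[of y] sub that by blast
        then show False using dj that by blast
      qed
      then show ?thesis by auto
    qed
    moreover have "blue (mate (cyclic_nth (map f w) i)) (cyclic_nth (map f w) (i + 1))" for i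
      unfolding cyclic_nth_map[OF D(1)] fm'[symmetric] using fblue[OF mv D(2)] D(6) by simp
    moreover have "F C = (\<lambda>x. {x, mate x}) ` set (map f w) \<union>
        range (\<lambda>i. {mate (cyclic_nth (map f w) i), cyclic_nth (map f w) (i + 1)})"
    proof -
      have "(`) f ` (\<lambda>x. {x, mate x}) ` set w = (\<lambda>x. {x, mate x}) ` set (map f w)"
        unfolding image_image set_map using fm by (intro image_cong) auto
      then show ?thesis
        unfolding F_def cyclic_nth_map[OF D(1)] fm'[symmetric] by (subst Ceq) (simp add: image_Un image_image)
    qed
    ultimately show ?thesis unfolding face_walk_def using D(3) by simp
  qed
  interpret polygonal_map girth_map by (rule polygonal_map_girth_map)
  \<comment> \<open>Faces move through their cycles: the walk of \<open>C\<close> goes to the walk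
    chosen for \<open>F C\<close>.\<close>
  define T where "T w = walk_of (F (inv_into GC walk_of w))" for w
  have TC: "T (walk_of C) = walk_of (F C)" if "C \<in> GC" for C
    using that inj_on_walk_of by (simp add: T_def)
  obtain \<pi> where \<pi>: "map_automorphism girth_map \<pi>" "\<And>s w. (s, w) \<in> flags girth_map \<Longrightarrow> \<pi> (s, w) = (f s, T w)"
  proof (rule map_automorphism_of_arc_permutation[of f T])
    show "connected_arc_graph girth_map" by (rule connected_arc_graph_girth_map)
    show "bij_betw f (arcs girth_map) (arcs girth_map)" using bij by simp
    show "f (ainv girth_map s) = ainv girth_map (f s)" if "s \<in> arcs girth_map" for s using fmate that by simp
    show "tail girth_map (f s) = tail girth_map (f t) \<longleftrightarrow> tail girth_map s = tail girth_map t"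
      if "s \<in> arcs girth_map" "t \<in> arcs girth_map" for s t
    proof -
      have "f ` blue_component s = f ` blue_component t \<longleftrightarrow> blue_component s = blue_component t"
        using inj_on_image_eq_iff[OF inj blue_component_verts blue_component_verts] that by simp
      then show ?thesis using comp that by simp
    qed
    show "T w \<in> faces girth_map" if "w \<in> faces girth_map" for w using that TC FGC by auto
    show "inj_on T (faces girth_map)"
    proof (rule inj_onI)
      fix v w assume "v \<in> faces girth_map" "w \<in> faces girth_map" and eq: "T v = T w"
      then obtain C D where C: "C \<in> GC" "v = walk_of C" and D: "D \<in> GC" "w = walk_of D" by auto
      then have "walk_of (F C) = walk_of (F D)" using eq TC by simp
      then have "F C = F D" using inj_onD[OF inj_on_walk_of] FGC C(1) D(1) by blast
      then show "v = w" using inj_onD[OF injF] C D by blast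
    qed
    show "length (T w) = length w" if "w \<in> faces girth_map" for w
      using that TC FGC length_girth_map_face by auto
    show "(\<exists>r. \<forall>i. cyclic_nth (T w) (i + r) = f (cyclic_nth w i)) \<or>
        (\<exists>r. \<forall>i. cyclic_nth (T w) (r - i) = ainv girth_map (f (cyclic_nth w i)))" if w: "w \<in> faces girth_map" for w
    proof -
      obtain C where C: "C \<in> GC" "w = walk_of C" using w by auto
      have "face_walk (F C) (map f w)" "face_walk (F C) (T w)"
        using fwalk[OF face_walk_walk_of[OF C(1)] C(1)] face_walk_walk_of[OF FGC[OF C(1)]] TC[OF C(1)] C(2) by auto
      from face_walk_unique[OF this FGC[OF C(1)]] show ?thesis
        using face_nonempty[OF w] by (simp add: cyclic_nth_map)
    qed
  qed blast
  then show "\<exists>\<pi>. map_automorphism girth_map \<pi> \<and> (\<forall>(s, w)\<in>flags girth_map. fst (\<pi> (s, w)) = f s)"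
    by (intro exI[of _ \<pi>]) auto
qed

lemma arc_transitive_girth_map:
  assumes "vertex_transitive \<Gamma>"
  shows "arc_transitive_map girth_map"
  unfolding arc_transitive_map_def
proof (intro ballI)
  interpret polygonal_map girth_map by (rule polygonal_map_girth_map)
  fix s t assume s: "s \<in> arcs girth_map" and t: "t \<in> arcs girth_map"
  then obtain f where f: "graph_iso f \<Gamma> \<Gamma>" "f s = t" using assms by (auto simp: vertex_transitive_def)
  obtain \<pi> where \<pi>: "map_automorphism girth_map \<pi>" "\<forall>(s, w)\<in>flags girth_map. fst (\<pi> (s, w)) = f s"
    using automorphism_girth_map(2)[OF f(1)] by blast
  \<comment> \<open>Some flag lies over \<open>s\<close>, so the image is \<open>{t}\<close> and not
    empty.\<close>
  obtain w where "w \<in> faces girth_map" "s \<in> set w \<or> ainv girth_map s \<in> set w" using arc_in_face[OF s] by blast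
  then have "(s, w) \<in> flags girth_map" using s by (simp add: flags_def)
  moreover have "fst (\<pi> x) = t" if "x \<in> flags girth_map" "fst x = s" for x
    using \<pi>(2) f(2) that by (cases x) auto
  ultimately have "fst ` \<pi> ` {x \<in> flags girth_map. fst x = s} = {t}" by force
  then show "\<exists>\<pi>. map_automorphism girth_map \<pi> \<and> fst ` \<pi> ` {x \<in> flags girth_map. fst x = s} = {t}"
    using \<pi>(1) by blast
qed

text \<open>The arcs leaving a node are the members of a blue component, and automorphisms carry
  components bijectively to components.\<close>

lemma regular_girth_map:
  assumes "vertex_transitive \<Gamma>" "s \<in> verts \<Gamma>"
  shows "regular_arc_graph girth_map (card (blue_component s))"
  unfolding regular_arc_graph_def
proof (intro ballI)
  fix v assume "v \<in> nodes girth_map"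
  then obtain t where t: "t \<in> verts \<Gamma>" "v = blue_component t" by auto
  obtain f where f: "graph_iso f \<Gamma> \<Gamma>" "f s = t" using assms t by (auto simp: vertex_transitive_def)
  have "{x \<in> arcs girth_map. tail girth_map x = v} = blue_component t"
    using blue_component_verts[OF t(1)] blue_component_eq_iff[of t] t(2) by auto
  moreover have "finite (blue_component t)" using finite_subset[OF blue_component_verts[OF t(1)] finite_verts] .
  moreover have "blue_component t = f ` blue_component s"
    using automorphism_girth_map(1)[OF f(1) assms(2)] f(2) by simp
  moreover have "inj_on f (blue_component s)"
    using f(1) inj_on_subset[OF _ blue_component_verts[OF assms(2)]] by (auto simp: graph_iso_def bij_betw_def)
  ultimately show "finite {x \<in> arcs girth_map. tail girth_map x = v} \<and>
      card {x \<in> arcs girth_map. tail girth_map x = v} = card (blue_component s)"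
    by (simp add: card_image)
qed

end

theorem theorem3p14:
  fixes \<Gamma> :: "'a sgraph" and g n :: nat
  assumes "simple_graph \<Gamma>" and "finite (verts \<Gamma>)" and "card (verts \<Gamma>) = n"
    and "connected_graph \<Gamma>" and "cubic \<Gamma>"
    and "girth \<Gamma> = enat g"
    and "girth_regular \<Gamma>"
    and "\<forall>v\<in>verts \<Gamma>. signature \<Gamma> v = [1, 1, 2]"
  shows "even g \<and> (g div 2) dvd n \<and>
    (\<exists>M :: ('a set, 'a) premap.
       is_map M \<and> (\<forall>w\<in>faces M. length w = g div 2) \<and>
       isomorphic_graphs \<Gamma> (truncation M) \<and>
       (vertex_transitive \<Gamma> \<longrightarrow>
          (\<exists>l>g. mk_map M (g div 2) l \<and> arc_transitive_map M)))"
proof -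
  interpret cubic_112 \<Gamma> g by unfold_locales (use assms in auto)
  obtain s where s: "s \<in> verts \<Gamma>" using connected by (auto simp: connected_graph_def)
  \<comment> \<open>The degree \<open>l\<close> is the length of a blue cycle; by transitivity one
    component determines it for all nodes.\<close>
  have "\<exists>l>g. mk_map girth_map (g div 2) l \<and> arc_transitive_map girth_map" if "vertex_transitive \<Gamma>"
    using girth_less_blue_component[OF s] regular_girth_map[OF that s] arc_transitive_girth_map[OF that]
      is_map_girth_map length_girth_map_face unfolding mk_map_def by blast
  then show ?thesis
    using half_girth[OF GC_nonempty] half_girth_dvd_order assms(3) is_map_girth_map length_girth_map_face
      truncation_girth_map by blast
qed

end
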